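(* Let $G$ be a t.d.l.c.s.c. group that is locally pro-nilpotent. Then either $G$ is elementary, or the ascending elementary series $\{1\}\le A_1\le A_2\le G$ satisfies: (1) $A_1$ and $G/A_2$ are elementary; and (2) there is a (possibly infinite) set of primes $\pi$ such that $A_2/A_1\simeq\bigoplus_{p\in\pi}(L_p,U_p)$, where each $L_p$ is a locally pro-$p$ t.d.l.c.s.c. group and $U_p$ is a compact open pro-$p$ subgroup of $L_p$.
   Context: t.d.l.c.s.c. = totally disconnected, locally compact, second countable; $\simeq$ is topological isomorphism. A t.d.l.c. group is locally pro-nilpotent (resp. locally pro-$p$) if it has a compact open subgroup that is pro-nilpotent (resp. pro-$p$). Elementary groups: the smallest class $\mathscr E$ of t.d.l.c.s.c. groups containing all second countable profinite and countable discrete groups, containing $G$ whenever $G$ has a closed normal $H\in\mathscr E$ with $G/H$ profinite or discrete, and containing $G=\bigcup_{i\in\omega}O_i$ whenever $(O_i)$ is an increasing sequence of open subgroups in $\mathscr E$. $\mathrm{Rad}_{\mathscr E}(G)$: largest closed normal elementary subgroup; $\mathrm{Res}_{\mathscr E}(G)$: smallest closed normal subgroup with elementary quotient; ascending elementary series $A_1=\mathrm{Rad}_{\mathscr E}(G)$, $A_2=q^{-1}(\mathrm{Res}_{\mathscr E}(G/A_1))$ with $q:G\to G/A_1$. Local direct product: for countable $A$ enumerated $(a_i)_{i\in\omega}$, t.d.l.c.s.c. $G_a$ and compact open $U_a\le G_a$, let $S_0=\prod_i U_{a_i}$, $S_{n+1}=G_{a_0}\times\dots\times G_{a_n}\times\prod_{i\ge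 n+1}U_{a_i}$ with product topologies, and $\bigoplus_{a\in A}(G_a,U_a)=\bigcup_n S_n$ with the inductive limit topology. *)

theory Defs
  imports "HOL-Analysis.Analysis" "HOL-Computational_Algebra.Primes" "HOL-Algebra.Algebra"
begin

record 'a tgroup = "'a monoid" + tp :: "'a topology"

definition topological_group :: "'a tgroup \<Rightarrow> bool" where
  "topological_group G \<longleftrightarrow> group G \<and> topspace (tp G) = carrier G
     \<and> continuous_map (prod_topology (tp G) (tp G)) (tp G) (\<lambda>(x, y). x \<otimes>\<^bsub>G\<^esub> y)
     \<and> continuous_map (tp G) (tp G) (\<lambda>x. inv\<^bsub>G\<^esub> x)"

definition totally_disconnected_space :: "'a topology \<Rightarrow> bool" where
  "totally_disconnected_space T \<longleftrightarrow> (\<forall>C. connectedin T C \<longrightarrow> (\<exists>a. \<forall>x\<in>C. x = a))"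

definition tdlcsc :: "'a tgroup \<Rightarrow> bool" where
  "tdlcsc G \<longleftrightarrow> topological_group G \<and> Hausdorff_space (tp G)
     \<and> totally_disconnected_space (tp G) \<and> locally_compact_space (tp G)
     \<and> second_countable (tp G)"

definition subtg :: "'a tgroup \<Rightarrow> 'a set \<Rightarrow> 'a tgroup" where
  "subtg G H = G\<lparr>carrier := H, tp := subtopology (tp G) H\<rparr>"

text \<open>Quotient topology on the set of right cosets: a set of cosets is open iff its union
  (= preimage under the projection) is open.\<close>
definition quot_top :: "'a topology \<Rightarrow> 'a set set \<Rightarrow> 'a set topology" where
  "quot_top T C = topology (\<lambda>S. S \<subseteq> C \<and> openin T (\<Union>S))"

definition quottg :: "'a tgroup \<Rightarrow> 'a set \<Rightarrow> 'a set tgroup" where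
  "quottg G H = \<lparr>carrier = rcosets\<^bsub>G\<^esub> H, mult = set_mult G, one = H,
                 tp = quot_top (tp G) (rcosets\<^bsub>G\<^esub> H)\<rparr>"

definition closed_normal :: "'a set \<Rightarrow> 'a tgroup \<Rightarrow> bool" where
  "closed_normal H G \<longleftrightarrow> H \<lhd> G \<and> closedin (tp G) H"

definition open_subgroup :: "'a set \<Rightarrow> 'a tgroup \<Rightarrow> bool" where
  "open_subgroup H G \<longleftrightarrow> subgroup H G \<and> openin (tp G) H"

definition tg_iso :: "'a tgroup \<Rightarrow> 'b tgroup \<Rightarrow> bool" where
  "tg_iso G H \<longleftrightarrow> (\<exists>f. f \<in> hom G H \<and> bij_betw f (carrier G) (carrier H)
                        \<and> homeomorphic_map (tp G) (tp H) f)"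

definition profinite :: "'a tgroup \<Rightarrow> bool" where
  "profinite G \<longleftrightarrow> tdlcsc G \<and> compact_space (tp G)"

definition discrete_tg :: "'a tgroup \<Rightarrow> bool" where
  "discrete_tg G \<longleftrightarrow> tdlcsc G \<and> countable (carrier G) \<and> tp G = discrete_topology (carrier G)"

fun lower_central :: "('a, 'b) monoid_scheme \<Rightarrow> nat \<Rightarrow> 'a set" where
  "lower_central G 0 = carrier G"
| "lower_central G (Suc n) = generate G
     {x \<otimes>\<^bsub>G\<^esub> y \<otimes>\<^bsub>G\<^esub> inv\<^bsub>G\<^esub> x \<otimes>\<^bsub>G\<^esub> inv\<^bsub>G\<^esub> y | x y. x \<in> lower_central G n \<and> y \<in> carrier G}"

definition nilpotent :: "('a, 'b) monoid_scheme \<Rightarrow> bool" where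
  "nilpotent G \<longleftrightarrow> group G \<and> (\<exists>n. lower_central G n = {\<one>\<^bsub>G\<^esub>})"

text \<open>Pro-p: profinite, and every open normal subgroup has p-power index
  (i.e. an inverse limit of finite p-groups).\<close>
definition pro_p :: "nat \<Rightarrow> 'a tgroup \<Rightarrow> bool" where
  "pro_p p G \<longleftrightarrow> profinite G \<and>
     (\<forall>N. N \<lhd> G \<and> openin (tp G) N \<longrightarrow> (\<exists>k. card (rcosets\<^bsub>G\<^esub> N) = p ^ k))"

text \<open>Pro-nilpotent: profinite, and every quotient by an open normal subgroup is nilpotent
  (i.e. an inverse limit of finite nilpotent groups).\<close>
definition pro_nilpotent :: "'a tgroup \<Rightarrow> bool" where
  "pro_nilpotent G \<longleftrightarrow> profinite G \<and>
     (\<forall>N. N \<lhd> G \<and> openin (tp G) N \<longrightarrow> nilpotent (G Mod N))"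

definition locally_pro_nilpotent :: "'a tgroup \<Rightarrow> bool" where
  "locally_pro_nilpotent G \<longleftrightarrow> (\<exists>U. open_subgroup U G \<and> compactin (tp G) U
                                      \<and> pro_nilpotent (subtg G U))"

definition locally_pro_p :: "nat \<Rightarrow> 'a tgroup \<Rightarrow> bool" where
  "locally_pro_p p G \<longleftrightarrow> (\<exists>U. open_subgroup U G \<and> compactin (tp G) U
                                  \<and> pro_p p (subtg G U))"

text \<open>The class is defined inductively on groups whose carrier lives in the fixed type
  nat set (of cardinality continuum, so every t.d.l.c.s.c. group has an isomorphic
  copy there); all closure conditions only involve subgroups of the same carrier type.\<close>
inductive elem_univ :: "nat set tgroup \<Rightarrow> bool" where
  base_profinite: "profinite G \<Longrightarrow> elem_univ G"
| base_discrete: "discrete_tg G \<Longrightarrow> elem_univ G"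
| extension: "\<lbrakk> tdlcsc G; closed_normal H G; elem_univ (subtg G H);
               profinite (quottg G H) \<or> discrete_tg (quottg G H) \<rbrakk> \<Longrightarrow> elem_univ G"
| union: "\<lbrakk> tdlcsc G; \<And>i. open_subgroup (Os i) G; \<And>i. elem_univ (subtg G (Os i));
           \<And>i. Os i \<subseteq> Os (Suc i); carrier G = (\<Union>i. Os i) \<rbrakk> \<Longrightarrow> elem_univ G"

definition elementary :: "'a tgroup \<Rightarrow> bool" where
  "elementary G \<longleftrightarrow> (\<exists>H :: nat set tgroup. elem_univ H \<and> tg_iso G H)"

definition is_Rad :: "'a tgroup \<Rightarrow> 'a set \<Rightarrow> bool" where
  "is_Rad G A \<longleftrightarrow> closed_normal A G \<and> elementary (subtg G A) \<and>
     (\<forall>M. closed_normal M G \<and> elementary (subtg G M) \<longrightarrow> M \<subseteq> A)"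

definition is_Res :: "'a tgroup \<Rightarrow> 'a set \<Rightarrow> bool" where
  "is_Res G R \<longleftrightarrow> closed_normal R G \<and> elementary (quottg G R) \<and>
     (\<forall>M. closed_normal M G \<and> elementary (quottg G M) \<longrightarrow> R \<subseteq> M)"

text \<open>Index set: a set of primes \<pi> \<subseteq> nat, enumerated increasingly.
  S n: elements g with g p in L p for all p in pi, and g p in U p for p in pi with
  p \<ge> n; product topology (L p for p < n, U p for p \<ge> n).\<close>
definition ldp_S :: "nat set \<Rightarrow> (nat \<Rightarrow> 'b tgroup) \<Rightarrow> (nat \<Rightarrow> 'b set) \<Rightarrow> nat \<Rightarrow> (nat \<Rightarrow> 'b) topology" where
  "ldp_S \<pi> L U n = product_topology
      (\<lambda>p. if p < n then tp (L p) else subtopology (tp (L p)) (U p)) \<pi>"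

definition ldp :: "nat set \<Rightarrow> (nat \<Rightarrow> 'b tgroup) \<Rightarrow> (nat \<Rightarrow> 'b set) \<Rightarrow> (nat \<Rightarrow> 'b) tgroup" where
  "ldp \<pi> L U =
     \<lparr>carrier = (\<Union>n. topspace (ldp_S \<pi> L U n)),
      mult = (\<lambda>f g. \<lambda>p. if p \<in> \<pi> then f p \<otimes>\<^bsub>L p\<^esub> g p else undefined),
      one = (\<lambda>p. if p \<in> \<pi> then \<one>\<^bsub>L p\<^esub> else undefined),
      tp = topology (\<lambda>W. W \<subseteq> (\<Union>n. topspace (ldp_S \<pi> L U n)) \<and>
                         (\<forall>n. openin (ldp_S \<pi> L U n) (W \<inter> topspace (ldp_S \<pi> L U n))))\<rparr>"

end

theory Submission
  imports Defs
begin

text \<open>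
  Pass to \<open>H = G/A\<^sub>1\<close>. Elementary groups are closed under extensions, so \<open>H\<close> has no non-trivial elementary
  closed normal subgroup. The closure of the quasi-center (the elements with open centralizer) is elementary,
  so the quasi-center of \<open>H\<close> is trivial.

  Let \<open>U\<close> be a compact open pro-nilpotent subgroup of \<open>H\<close>. For each prime \<open>p\<close> it is the direct product of its
  pro-\<open>p\<close> part \<open>U\<^sub>p\<close> and its pro-\<open>p'\<close> part \<open>V\<^sub>p\<close>. Both are cut out of \<open>U\<close> by a condition that is invariant under
  conjugation in \<open>H\<close>, so \<open>V\<^sub>p\<close> and its conjugates agree near the identity. An element centralizing \<open>V\<^sub>p\<close> near the
  identity centralizes \<open>V\<^sub>p\<close>, because the obstruction lies in the quasi-center. Hence \<open>C\<^sub>p = C\<^sub>H(V\<^sub>p)\<close> is a closed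
  normal subgroup with \<open>C\<^sub>p \<inter> U = U\<^sub>p\<close>, and \<open>C\<^sub>p\<close> and \<open>C\<^sub>q\<close> commute for \<open>p \<noteq> q\<close>.

  Let \<open>R\<close> be the elementary residual of \<open>H\<close> and \<open>M\<close> the closure of the subgroup generated by all \<open>R \<inter> C\<^sub>p\<close>. It
  contains \<open>R \<inter> U\<close>, so it is open in \<open>R\<close>, and \<open>H/M\<close> is an extension of the discrete group \<open>R/M\<close> by the elementary
  group \<open>H/R\<close>. Minimality of \<open>R\<close> gives \<open>M = R\<close>. Every element of \<open>R\<close> is then the product of an element of
  \<open>R \<inter> C\<^sub>p\<close> and one centralizing \<open>C\<^sub>p\<close>, and these coordinates identify \<open>R\<close> with the local direct product of the
  groups \<open>R \<inter> C\<^sub>p\<close>, taken over all primes; factors may be trivial.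
\<close>


section \<open>Topological groups\<close>

text \<open>\<open>elem_univ\<close> is generated on one fixed carrier type, and its extension rule
  admits only profinite or discrete quotients; the argument needs arbitrary elementary quotients and
  groups on other types, such as sets of cosets. Quotients are therefore treated through continuous
  open surjective homomorphisms (\<open>quot_hom\<close>), which compose, restrict to preimages of
  subgroups and factor through one another, however the cosets are encoded. The second obstacle is
  that a Sylow part of \<open>U\<close> is only commensurated by the ambient group, not normal in
  it. Centralizers repair this: when the quasi-center is trivial, centralizing
  \<open>V\<^sub>p\<close> near the identity is the same as centralizing it, and the local condition
  does not depend on the chosen compact open subgroup. Triviality of the quasi-center enters
  throughout in one form: an element commuting with an open subgroup is the identity. No inverse
  limits are formed. A claim about \<open>U\<close> is proved modulo each open normal subgroup and
  lifted by compactness, density or separation.\<close>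

lemma subtg_simps [simp]:
  "carrier (subtg G H) = H" "mult (subtg G H) = mult G" "one (subtg G H) = one G"
  "tp (subtg G H) = subtopology (tp G) H"
  by (simp_all add: subtg_def)

lemma subtg_subtg: "K \<subseteq> H \<Longrightarrow> subtg (subtg G H) K = subtg G K"
  by (simp add: subtg_def subtopology_subtopology inf.absorb2)

lemma quottg_simps [simp]:
  "carrier (quottg G N) = rcosets\<^bsub>G\<^esub> N" "mult (quottg G N) = set_mult G" "one (quottg G N) = N"
  "tp (quottg G N) = quot_top (tp G) (rcosets\<^bsub>G\<^esub> N)"
  by (simp_all add: quottg_def)

text \<open>The group axioms read only these three fields, so they pass between records that differ
  in their topology or in the record extension, such as \<open>quottg\<close> and
  \<open>Mod\<close>.\<close>

lemma group_cong:
  assumes "group G" "carrier H = carrier G" "mult H = mult G" "one H = one G"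
  shows "group H"
proof -
  interpret group G by fact
  show ?thesis
    by (rule groupI) (use assms(2-) l_inv_ex in \<open>auto simp: m_assoc\<close>)
qed

lemma m_inv_cong:
  assumes "carrier H = carrier G" "mult H = mult G" "one H = one G"
  shows "inv\<^bsub>H\<^esub> x = inv\<^bsub>G\<^esub> x"
  using assms by (simp add: m_inv_def)

lemma (in group) cancel_left [simp]:
  assumes "a \<in> carrier G" "b \<in> carrier G"
  shows "inv a \<otimes> (a \<otimes> b) = b" "a \<otimes> (inv a \<otimes> b) = b"
  using assms by (simp_all flip: m_assoc)

lemmas (in group) word_simps = m_assoc inv_mult_group

locale topgroup = group G for G :: "'a tgroup" (structure) +
  assumes topspace_tp [simp]: "topspace (tp G) = carrier G"
    and continuous_mult: "continuous_map (prod_topology (tp G) (tp G)) (tp G) (\<lambda>(x, y). x \<otimes> y)"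
    and continuous_inv: "continuous_map (tp G) (tp G) (\<lambda>x. inv x)"

lemma topological_group_iff: "topological_group G \<longleftrightarrow> topgroup G"
  by (auto simp: topological_group_def topgroup_def topgroup_axioms_def)

context topgroup begin

lemma group_subtg: "subgroup H G \<Longrightarrow> group (subtg G H)"
  by (rule group_cong[OF subgroup.subgroup_is_group[OF _ is_group]]) (auto simp: subtg_def)

lemma inv_subtg: "subgroup H G \<Longrightarrow> x \<in> H \<Longrightarrow> inv\<^bsub>subtg G H\<^esub> x = inv x"
  using m_inv_consistent[of H x] m_inv_cong[of "subtg G H" "G\<lparr>carrier := H\<rparr>" x] by (simp add: subtg_def)

lemma pow_subtg: "x [^]\<^bsub>subtg G H\<^esub> (n::nat) = x [^] n"
  by (simp add: nat_pow_def)

lemma subgroup_subtg_iff: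
  assumes "subgroup H G"
  shows "subgroup K (subtg G H) \<longleftrightarrow> subgroup K G \<and> K \<subseteq> H"
  using inv_subtg[OF assms] subgroup.subset[OF assms] by (auto simp: subgroup_def subset_iff)

lemma normal_iff: "N \<lhd> G \<longleftrightarrow> subgroup N G \<and> (\<forall>x\<in>carrier G. \<forall>h\<in>N. x \<otimes> h \<otimes> inv x \<in> N)"
  by (rule normal_inv_iff)

lemma cmult:
  assumes "continuous_map Z (tp G) f" "continuous_map Z (tp G) g"
  shows "continuous_map Z (tp G) (\<lambda>x. f x \<otimes> g x)"
proof -
  have "continuous_map Z (prod_topology (tp G) (tp G)) (\<lambda>x. (f x, g x))"
    using assms by (simp add: continuous_map_pairedI)
  from continuous_map_compose[OF this continuous_mult] show ?thesis by (simp add: o_def)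
qed

lemma cinv: "continuous_map Z (tp G) f \<Longrightarrow> continuous_map Z (tp G) (\<lambda>x. inv (f x))"
  using continuous_map_compose[OF _ continuous_inv, of Z f] by (simp add: o_def)

lemma cconst: "a \<in> carrier G \<Longrightarrow> continuous_map Z (tp G) (\<lambda>x. a)"
  by simp

lemma cid: "continuous_map (tp G) (tp G) (\<lambda>x. x)"
  by (simp flip: id_def)

lemmas cintros = cmult cinv cconst cid

lemma open_preimage:
  "continuous_map (tp G) (tp G) f \<Longrightarrow> openin (tp G) V \<Longrightarrow> openin (tp G) {x \<in> carrier G. f x \<in> V}"
  using openin_continuous_map_preimage[of "tp G" "tp G" f V] by simp

lemma closed_preimage:
  "continuous_map (tp G) (tp G) f \<Longrightarrow> closedin (tp G) V \<Longrightarrow> closedin (tp G) {x \<in> carrier G. f x \<in> V}"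
  using closedin_continuous_map_preimage[of "tp G" "tp G" f V] by simp

lemma subtg_topgroup:
  assumes H: "subgroup H G" shows "topgroup (subtg G H)"
proof -
  interpret S: group "subtg G H" using group_subtg[OF H] .
  have Hc: "H \<subseteq> carrier G" using H by (rule subgroup.subset)
  have "continuous_map (prod_topology (subtopology (tp G) H) (subtopology (tp G) H))
     (subtopology (tp G) H) (\<lambda>(x, y). x \<otimes> y)"
    using H Hc by (auto simp: continuous_map_in_subtopology subtopology_Times[symmetric]
        intro!: continuous_map_from_subtopology continuous_mult subgroup.m_closed)
  moreover have "continuous_map (subtopology (tp G) H) (subtopology (tp G) H) (\<lambda>x. inv\<^bsub>subtg G H\<^esub> x)"
  proof (rule continuous_map_eq)
    show "continuous_map (subtopology (tp G) H) (subtopology (tp G) H) (\<lambda>x. inv x)"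
      using H Hc by (auto simp: continuous_map_in_subtopology
        intro!: continuous_map_from_subtopology continuous_inv subgroup.m_inv_closed)
  qed (use inv_subtg[OF H] Hc in auto)
  ultimately show ?thesis
    using Hc by unfold_locales auto
qed

lemma osubD: assumes "open_subgroup V G" shows "subgroup V G" "openin (tp G) V" "V \<subseteq> carrier G"
    "\<one> \<in> V" "\<And>x y. x \<in> V \<Longrightarrow> y \<in> V \<Longrightarrow> x \<otimes> y \<in> V" "\<And>x. x \<in> V \<Longrightarrow> inv x \<in> V" "\<And>x. x \<in> V \<Longrightarrow> x \<in> carrier G"
  using assms by (auto simp: open_subgroup_def subgroup_def)

text \<open>\<open>S\<close> is a union of left cosets of \<open>V\<close>, and each coset is open
  as the preimage of \<open>V\<close> under a translation.\<close>

lemma open_if_coset_stable: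
  assumes V: "open_subgroup V G" and S: "S \<subseteq> carrier G" and st: "\<And>s v. s \<in> S \<Longrightarrow> v \<in> V \<Longrightarrow> s \<otimes> v \<in> S"
  shows "openin (tp G) S"
proof (subst openin_subopen, intro ballI)
  fix s assume s: "s \<in> S"
  then have sc: "s \<in> carrier G" using S by auto
  have "openin (tp G) {x \<in> carrier G. inv s \<otimes> x \<in> V}"
    by (rule open_preimage) (use sc osubD[OF V] in \<open>auto intro!: cintros\<close>)
  moreover have "{x \<in> carrier G. inv s \<otimes> x \<in> V} \<subseteq> S"
  proof safe
    fix x assume x: "x \<in> carrier G" "inv s \<otimes> x \<in> V"
    have "s \<otimes> (inv s \<otimes> x) \<in> S" by (rule st[OF s x(2)])
    then show "x \<in> S" using x sc by (simp add: m_assoc[symmetric])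
  qed
  ultimately show "\<exists>T. openin (tp G) T \<and> s \<in> T \<and> T \<subseteq> S"
    using sc osubD[OF V] by (intro exI[of _ "{x \<in> carrier G. inv s \<otimes> x \<in> V}"]) auto
qed

text \<open>The complement of a union of cosets is again a union of cosets.\<close>

lemma closed_if_coset_stable:
  assumes V: "open_subgroup V G" and S: "S \<subseteq> carrier G" and st: "\<And>s v. s \<in> S \<Longrightarrow> v \<in> V \<Longrightarrow> s \<otimes> v \<in> S"
  shows "closedin (tp G) S"
proof -
  have "openin (tp G) (carrier G - S)"
  proof (rule open_if_coset_stable[OF V])
    fix s v assume s: "s \<in> carrier G - S" and v: "v \<in> V"
    then have c: "s \<in> carrier G" "v \<in> carrier G" using osubD[OF V] by auto
    have "s \<otimes> v \<notin> S"
    proof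
      assume "s \<otimes> v \<in> S"
      then have "s \<otimes> v \<otimes> inv v \<in> S" using st osubD[OF V] v by auto
      then show False using s c by (simp add: m_assoc)
    qed
    then show "s \<otimes> v \<in> carrier G - S" using c by auto
  qed auto
  then show ?thesis using S by (simp add: closedin_def)
qed

lemma osub_closed: "open_subgroup V G \<Longrightarrow> closedin (tp G) V"
  using closed_if_coset_stable[of V V] osubD[of V] by auto

lemma osubI: "subgroup K G \<Longrightarrow> open_subgroup V G \<Longrightarrow> V \<subseteq> K \<Longrightarrow> open_subgroup K G"
  using open_if_coset_stable[of V K] unfolding open_subgroup_def
  by (metis subgroup.subset subgroup.m_closed subsetD)

lemma osub_carrier: "open_subgroup (carrier G) G"
  unfolding open_subgroup_def using subgroup_self openin_topspace[of "tp G"] by simp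

lemma osub_Int: "open_subgroup V G \<Longrightarrow> open_subgroup W G \<Longrightarrow> open_subgroup (V \<inter> W) G"
  by (auto simp: open_subgroup_def subgroups_Inter_pair)

lemma subgroup_conj_preimage:
  assumes V: "subgroup V G" and a: "a \<in> carrier G"
  shows "subgroup {x \<in> carrier G. a \<otimes> x \<otimes> inv a \<in> V} G"
proof (rule subgroupI)
  show "{x \<in> carrier G. a \<otimes> x \<otimes> inv a \<in> V} \<noteq> {}"
    using a subgroup.one_closed[OF V] by (auto intro!: exI[of _ "\<one>"])
next
  fix x assume "x \<in> {x \<in> carrier G. a \<otimes> x \<otimes> inv a \<in> V}"
  then have x: "x \<in> carrier G" "a \<otimes> x \<otimes> inv a \<in> V" by auto
  have "inv (a \<otimes> x \<otimes> inv a) \<in> V" using subgroup.m_inv_closed[OF V x(2)] .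
  then show "inv x \<in> {x \<in> carrier G. a \<otimes> x \<otimes> inv a \<in> V}"
    using x a by (simp add: inv_mult_group m_assoc)
next
  fix x y assume "x \<in> {x \<in> carrier G. a \<otimes> x \<otimes> inv a \<in> V}" "y \<in> {x \<in> carrier G. a \<otimes> x \<otimes> inv a \<in> V}"
  then have x: "x \<in> carrier G" "a \<otimes> x \<otimes> inv a \<in> V" and y: "y \<in> carrier G" "a \<otimes> y \<otimes> inv a \<in> V" by auto
  have "(a \<otimes> x \<otimes> inv a) \<otimes> (a \<otimes> y \<otimes> inv a) \<in> V" using subgroup.m_closed[OF V x(2) y(2)] .
  moreover have "(a \<otimes> x \<otimes> inv a) \<otimes> (a \<otimes> y \<otimes> inv a) = a \<otimes> (x \<otimes> y) \<otimes> inv a"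
    using x y a by (simp add: m_assoc)
  ultimately show "x \<otimes> y \<in> {x \<in> carrier G. a \<otimes> x \<otimes> inv a \<in> V}" using x y by auto
qed auto

lemma osub_conj:
  assumes V: "open_subgroup V G" and a: "a \<in> carrier G"
  shows "open_subgroup {x \<in> carrier G. a \<otimes> x \<otimes> inv a \<in> V} G"
proof -
  have "continuous_map (tp G) (tp G) (\<lambda>x. a \<otimes> x \<otimes> inv a)"
    using a by (intro cintros) auto
  then show ?thesis unfolding open_subgroup_def
    using subgroup_conj_preimage[OF osubD(1)[OF V] a] open_preimage[OF _ osubD(2)[OF V], of "\<lambda>x. a \<otimes> x \<otimes> inv a"] by simp
qed

text \<open>A tube lemma: the complement is the projection of a closed set along the compact factor
  \<open>C\<close>, and such a projection is a closed map.\<close>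

lemma open_all_compact:
  assumes C: "compactin (tp G) C" and W: "openin (tp G) W"
    and f: "continuous_map (prod_topology (tp G) (tp G)) (tp G) (\<lambda>(c, x). f c x)"
  shows "openin (tp G) {x \<in> carrier G. \<forall>c\<in>C. f c x \<in> W}"
proof -
  let ?Z = "subtopology (tp G) C"
  have Cc: "C \<subseteq> carrier G" using compactin_subset_topspace[OF C] by simp
  have cX: "compact_space ?Z" using C compact_space_subtopology by blast
  have cf: "continuous_map (prod_topology ?Z (tp G)) (tp G) (\<lambda>(c, x). f c x)"
  proof -
    have "prod_topology ?Z (tp G) = subtopology (prod_topology (tp G) (tp G)) (C \<times> carrier G)"
      by (metis subtopology_Times subtopology_topspace topspace_tp)
    then show ?thesis using f by (simp add: continuous_map_from_subtopology)
  qed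
  have "closedin (prod_topology ?Z (tp G)) {z \<in> topspace (prod_topology ?Z (tp G)). (\<lambda>(c, x). f c x) z \<in> carrier G - W}"
    by (rule closedin_continuous_map_preimage[OF cf]) (use W openin_closedin_eq[of "tp G" W] in simp)
  then have "closedin (tp G) (snd ` {z \<in> topspace (prod_topology ?Z (tp G)). (\<lambda>(c, x). f c x) z \<in> carrier G - W})"
    using closed_map_snd[OF cX, of "tp G"] by (simp add: closed_map_def)
  then have "openin (tp G) (carrier G - snd ` {z \<in> topspace (prod_topology ?Z (tp G)). (\<lambda>(c, x). f c x) z \<in> carrier G - W})"
    using openin_diff[OF openin_topspace[of "tp G"]] by simp
  moreover have "f c x \<in> carrier G" if "c \<in> C" "x \<in> carrier G" for c x
    using continuous_map_image_subset_topspace[OF f] that Cc by auto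
  then have "carrier G - snd ` {z \<in> topspace (prod_topology ?Z (tp G)). (\<lambda>(c, x). f c x) z \<in> carrier G - W} = {x \<in> carrier G. \<forall>c\<in>C. f c x \<in> W}"
    using Cc by (auto simp: image_iff)
  ultimately show ?thesis by simp
qed

lemma continuous_conj: "continuous_map (prod_topology (tp G) (tp G)) (tp G) (\<lambda>(c, x). c \<otimes> x \<otimes> inv c)"
proof -
  have "continuous_map (prod_topology (tp G) (tp G)) (tp G) (\<lambda>z. fst z \<otimes> snd z \<otimes> inv (fst z))"
    by (intro cmult cinv continuous_map_fst continuous_map_snd)
  then show ?thesis by (simp add: case_prod_unfold)
qed

text \<open>\<open>N\<close> is the intersection of all \<open>U\<close>-conjugates of
  \<open>V \<inter> U\<close>. Infinitely many conjugates are intersected, so openness has to come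
  from compactness of \<open>U\<close>, through \<open>open_all_compact\<close>.\<close>

lemma normal_core:
  assumes U: "open_subgroup U G" "compactin (tp G) U" and V: "open_subgroup V G"
  shows "\<exists>N. open_subgroup N G \<and> N \<subseteq> V \<and> N \<subseteq> U \<and> (\<forall>u\<in>U. \<forall>x\<in>N. u \<otimes> x \<otimes> inv u \<in> N)"
proof -
  define W where "W = V \<inter> U"
  have W: "open_subgroup W G" using osub_Int[OF V U(1)] by (simp add: W_def)
  define N where "N = {x \<in> carrier G. \<forall>c\<in>U. c \<otimes> x \<otimes> inv c \<in> W}"
  have Uc: "c \<in> carrier G" if "c \<in> U" for c using that osubD(7)[OF U(1)] by auto
  have 1: "\<one> \<in> U" using osubD(4)[OF U(1)] .
  have Nc: "x \<in> carrier G" if "x \<in> N" for x using that by (simp add: N_def)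
  have ND: "c \<otimes> x \<otimes> inv c \<in> W" if "x \<in> N" "c \<in> U" for x c using that by (simp add: N_def)
  have "N = (\<Inter>c\<in>U. {x \<in> carrier G. c \<otimes> x \<otimes> inv c \<in> W})"
    using 1 unfolding N_def by blast
  moreover have "subgroup (\<Inter>c\<in>U. {x \<in> carrier G. c \<otimes> x \<otimes> inv c \<in> W}) G"
  proof (rule subgroups_Inter)
    fix H assume "H \<in> (\<lambda>c. {x \<in> carrier G. c \<otimes> x \<otimes> inv c \<in> W}) ` U"
    then obtain c where "c \<in> U" "H = {x \<in> carrier G. c \<otimes> x \<otimes> inv c \<in> W}" by blast
    then show "subgroup H G" using subgroup_conj_preimage[OF osubD(1)[OF W] Uc[of c]] by simp
  qed (use 1 in blast)
  ultimately have "subgroup N G" by simp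
  moreover have "openin (tp G) N"
    unfolding N_def by (rule open_all_compact[OF U(2) osubD(2)[OF W] continuous_conj])
  moreover have "N \<subseteq> W"
  proof
    fix x assume x: "x \<in> N"
    show "x \<in> W" using ND[OF x 1] Nc[OF x] by simp
  qed
  moreover have "u \<otimes> x \<otimes> inv u \<in> N" if u: "u \<in> U" and x: "x \<in> N" for u x
  proof -
    have "c \<otimes> (u \<otimes> x \<otimes> inv u) \<otimes> inv c \<in> W" if c: "c \<in> U" for c
      using ND[OF x osubD(5)[OF U(1) c u]] Nc[OF x] Uc[OF u] Uc[OF c] by (simp add: word_simps)
    then show ?thesis using Nc[OF x] Uc[OF u] by (simp add: N_def)
  qed
  ultimately show ?thesis unfolding open_subgroup_def W_def by blast
qed

end

section \<open>Compact open subgroups as a base at the identity (van Dantzig)\<close>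

locale tdgroup = topgroup +
  assumes Haus: "Hausdorff_space (tp G)"
    and base: "openin (tp G) O' \<Longrightarrow> \<one> \<in> O' \<Longrightarrow> \<exists>V. open_subgroup V G \<and> compactin (tp G) V \<and> V \<subseteq> O'"

text \<open>The elements that multiply \<open>K\<close> into itself from the right form a monoid
  \<open>S\<close>, open because \<open>K\<close> is compact and open. Then \<open>V\<close> is
  \<open>S\<close> intersected with its inverse, and it lies in \<open>K\<close> because
  \<open>\<one> \<in> K\<close>.\<close>

lemma (in topgroup) compact_open_contains_subgroup:
  assumes K: "compactin (tp G) K" "openin (tp G) K" "\<one> \<in> K"
  shows "\<exists>V. open_subgroup V G \<and> V \<subseteq> K"
proof -
  define S where "S = {x \<in> carrier G. \<forall>k\<in>K. k \<otimes> x \<in> K}"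
  have Kc: "k \<in> carrier G" if "k \<in> K" for k using that openin_subset[OF K(2)] by auto
  have oS: "openin (tp G) S" unfolding S_def by (rule open_all_compact[OF K(1,2) continuous_mult])
  define V where "V = S \<inter> {x \<in> carrier G. inv x \<in> S}"
  have Vo: "openin (tp G) V" using oS open_preimage[OF continuous_inv oS] unfolding V_def by blast
  have Sc: "x \<in> carrier G" if "x \<in> S" for x using that by (simp add: S_def)
  have SD: "k \<otimes> x \<in> K" if "x \<in> S" "k \<in> K" for x k using that by (simp add: S_def)
  have mS: "x \<otimes> y \<in> S" if x: "x \<in> S" and y: "y \<in> S" for x y
  proof -
    have "k \<otimes> (x \<otimes> y) \<in> K" if k: "k \<in> K" for k
      using SD[OF y SD[OF x k]] Kc[OF k] Sc[OF x] Sc[OF y] by (simp add: m_assoc)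
    then show ?thesis using Sc[OF x] Sc[OF y] by (simp add: S_def)
  qed
  have "\<one> \<in> V" using Kc by (simp add: V_def S_def)
  then have "subgroup V G"
  proof (intro subgroupI)
    fix x y assume "x \<in> V" "y \<in> V"
    then show "x \<otimes> y \<in> V" using mS[of x y] mS[of "inv y" "inv x"] Sc by (simp add: V_def inv_mult_group)
  qed (auto simp: V_def Sc)
  moreover have "V \<subseteq> K"
  proof
    fix x assume "x \<in> V"
    then show "x \<in> K" using SD[OF _ K(3), of x] Sc by (simp add: V_def)
  qed
  ultimately show ?thesis using Vo unfolding open_subgroup_def by blast
qed

text \<open>In a compact Hausdorff neighbourhood \<open>C\<close> quasi-components agree with
  components, which are points. So a clopen subset \<open>D\<close> of \<open>C\<close> separates
  \<open>x\<close> from the compact set \<open>C - A\<close>; lying in the open set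
  \<open>A\<close>, it is open in the whole space.\<close>

lemma zero_dimensional_nhd:
  assumes H: "Hausdorff_space Z" and td: "totally_disconnected_space Z" and lc: "locally_compact_space Z"
    and W: "openin Z W" "x \<in> W"
  shows "\<exists>K. compactin Z K \<and> openin Z K \<and> x \<in> K \<and> K \<subseteq> W"
proof -
  have "neighbourhood_base_of (compactin Z) Z"
    using lc H locally_compact_space_neighbourhood_base by blast
  then obtain A C where A: "openin Z A" "compactin Z C" "x \<in> A" "A \<subseteq> C" "C \<subseteq> W"
    using W unfolding neighbourhood_base_of by metis
  let ?Y = "subtopology Z C"
  have Cs: "C \<subseteq> topspace Z" using compactin_subset_topspace[OF A(2)] .
  have Y1: "compact_space ?Y" using A(2) by (rule compact_space_subtopology)
  have Y2: "Hausdorff_space ?Y" using H by (rule Hausdorff_space_subtopology)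
  have Y3: "x \<in> topspace ?Y" using subsetD[OF A(4,3)] subsetD[OF Cs] by simp
  note Y = Y1 Y2 Y3
  have "quasi_components_of ?Y = connected_components_of ?Y"
    by (rule quasi_eq_connected_components_of) (simp add: Y1 Y2)
  then have qc: "quasi_component_of ?Y x = connected_component_of ?Y x"
    unfolding quasi_eq_connected_components_of_pointwise_alt by simp
  have xx: "connected_component_of ?Y x x"
    using Y3 connected_component_of_refl[of ?Y x] by blast
  have "connectedin Z (connected_component_of_set ?Y x)"
    using connectedin_connected_component_of[of ?Y x] by (simp add: connectedin_subtopology)
  then obtain a where "\<forall>y\<in>connected_component_of_set ?Y x. y = a"
    using td unfolding totally_disconnected_space_def by blast
  then have q: "quasi_component_of_set ?Y x = {x}"
    using xx unfolding qc by auto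
  have cA: "compactin ?Y (C - A)"
  proof -
    have "closedin ?Y (C \<inter> (topspace Z - A))"
      using closedin_subtopology_Int_closed[of Z "topspace Z - A" C] A(1) openin_closedin_eq[of Z A] by simp
    moreover have "C \<inter> (topspace Z - A) = C - A" using Cs by auto
    ultimately have "closedin ?Y (C - A)" by simp
    then show ?thesis using Y closedin_compact_space by blast
  qed
  have "{x} \<in> quasi_components_of ?Y"
    using q Y(3) quasi_component_in_quasi_components_of[of ?Y x] by simp
  then have "separated_between ?Y {x} (C - A)"
    using separated_between_quasi_component_compact[OF _ cA, of "{x}"] A by (auto simp: disjnt_def)
  then obtain D E where D: "openin ?Y D" "openin ?Y E" "D \<union> E = topspace ?Y" "disjnt D E" "{x} \<subseteq> D" "C - A \<subseteq> E"
    unfolding separated_between_def by blast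
  have "topspace ?Y = C" using Cs by auto
  then have DA: "D \<subseteq> A" "D = C - E" using D by (auto simp: disjnt_def)
  have "closedin ?Y D" using DA(2) D(2) \<open>topspace ?Y = C\<close> openin_closedin_eq[of ?Y E] by simp
  then have "compactin ?Y D" using Y closedin_compact_space by blast
  then have "compactin Z D" by (simp add: compactin_subtopology)
  moreover have "openin Z D"
  proof -
    obtain T where T: "openin Z T" "D = T \<inter> C" using D(1) by (auto simp: openin_subtopology)
    then have "D = T \<inter> A" using DA A(4) by auto
    then have "openin (subtopology Z A) D" using T by (auto simp: openin_subtopology)
    then show ?thesis using A(1) openin_trans_full by blast
  qed
  ultimately show ?thesis using D(5) DA(1) A by blast
qed

lemma tdlcsc_tdgroup: fixes G (structure) assumes "tdlcsc G" shows "tdgroup G"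
proof -
  interpret topgroup G using assms by (simp add: tdlcsc_def topological_group_iff)
  show ?thesis
  proof
    show H: "Hausdorff_space (tp G)" using assms by (simp add: tdlcsc_def)
    fix W assume W: "openin (tp G) W" "\<one> \<in> W"
    obtain K where K: "compactin (tp G) K" "openin (tp G) K" "\<one> \<in> K" "K \<subseteq> W"
      using zero_dimensional_nhd[OF H _ _ W] assms unfolding tdlcsc_def by blast
    obtain V where V: "open_subgroup V G" "V \<subseteq> K" using compact_open_contains_subgroup[OF K(1-3)] by blast
    have "compactin (tp G) V" using closed_compactin[OF K(1) V(2) osub_closed[OF V(1)]] .
    then show "\<exists>V. open_subgroup V G \<and> compactin (tp G) V \<and> V \<subseteq> W" using V K by blast
  qed
qed

context tdgroup begin

lemma separate:
  assumes "x \<in> carrier G" "x \<noteq> \<one>" obtains V where "open_subgroup V G" "x \<notin> V"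
proof -
  have "openin (tp G) (carrier G - {x})"
    using Hausdorff_imp_t1_space[OF Haus] assms openin_diff[OF openin_topspace[of "tp G"], of "{x}"]
    by (simp add: t1_space_closedin_singleton)
  then show ?thesis using base[of "carrier G - {x}"] assms that by auto
qed

text \<open>Cosets of open subgroups are clopen, so they split any two points of a connected set;
  cosets of compact open subgroups are the compact neighbourhoods. Together with
  \<open>tdlcsc_tdgroup\<close> this lets t.d.l.c. groups be handled through their open
  subgroups.\<close>

lemma tdlcscI: assumes "second_countable (tp G)" shows "tdlcsc G"
proof -
  have "totally_disconnected_space (tp G)"
    unfolding totally_disconnected_space_def
  proof (intro allI impI)
    fix C assume C: "connectedin (tp G) C"
    show "\<exists>a. \<forall>x\<in>C. x = a"
    proof (cases "C = {}")
      case False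
      then obtain a where a: "a \<in> C" by auto
      have Cc: "C \<subseteq> carrier G" using connectedin_subset_topspace[OF C] by simp
      have "x = a" if x: "x \<in> C" for x
      proof (rule ccontr)
        assume "x \<noteq> a"
        have xc: "x \<in> carrier G" "a \<in> carrier G" using x a Cc by auto
        have "inv a \<otimes> x \<noteq> \<one>" using xc \<open>x \<noteq> a\<close> by (metis inv_equality inv_inv inv_closed)
        then obtain V where V: "open_subgroup V G" "inv a \<otimes> x \<notin> V" using separate[of "inv a \<otimes> x"] xc by blast
        let ?D = "{y \<in> carrier G. inv a \<otimes> y \<in> V}"
        have ct: "continuous_map (tp G) (tp G) (\<lambda>y. inv a \<otimes> y)"
          using xc by (intro cintros) auto
        have "openin (tp G) ?D" "closedin (tp G) ?D"
          by (rule open_preimage[OF ct osubD(2)[OF V(1)]], rule closed_preimage[OF ct osub_closed[OF V(1)]])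
        then have "C \<subseteq> ?D \<or> disjnt C ?D" using C connectedin_clopen_cases by blast
        moreover have "a \<in> ?D" using xc osubD[OF V(1)] by simp
        ultimately show False using x V a by (auto simp: disjnt_iff)
      qed
      then show ?thesis by blast
    qed auto
  qed
  moreover have "locally_compact_space (tp G)"
    unfolding locally_compact_space_def
  proof
    fix x assume "x \<in> topspace (tp G)"
    then have x: "x \<in> carrier G" by simp
    obtain V where V: "open_subgroup V G" "compactin (tp G) V"
      using base[of "carrier G"] osub_carrier openin_topspace[of "tp G"] by auto
    have "compactin (tp G) ((\<lambda>y. x \<otimes> y) ` V)"
      by (rule image_compactin[OF V(2)]) (use x in \<open>auto intro!: cintros\<close>)
    moreover have "openin (tp G) {y \<in> carrier G. inv x \<otimes> y \<in> V}"
      by (rule open_preimage) (use x osubD[OF V(1)] in \<open>auto intro!: cintros\<close>)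
    moreover have "{y \<in> carrier G. inv x \<otimes> y \<in> V} \<subseteq> (\<lambda>y. x \<otimes> y) ` V"
    proof
      fix y assume "y \<in> {y \<in> carrier G. inv x \<otimes> y \<in> V}"
      then show "y \<in> (\<lambda>y. x \<otimes> y) ` V"
        using x cancel_left(2)[of x y] by (metis (mono_tags, lifting) imageI mem_Collect_eq)
    qed
    moreover have "x \<in> {y \<in> carrier G. inv x \<otimes> y \<in> V}" using x osubD[OF V(1)] by simp
    ultimately show "\<exists>U K. openin (tp G) U \<and> compactin (tp G) K \<and> x \<in> U \<and> U \<subseteq> K" by blast
  qed
  ultimately show ?thesis
    using assms Haus topgroup_axioms by (simp add: tdlcsc_def topological_group_iff)
qed

end

section \<open>Quotient homomorphisms\<close>

text \<open>These maps present \<open>Q\<close> as the topological quotient of \<open>G\<close> by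
  the kernel; the injective ones are the topological isomorphisms.\<close>

definition quot_hom :: "('a \<Rightarrow> 'b) \<Rightarrow> 'a tgroup \<Rightarrow> 'b tgroup \<Rightarrow> bool" where
  "quot_hom f G Q \<longleftrightarrow> topgroup G \<and> topgroup Q \<and> f \<in> hom G Q \<and> f ` carrier G = carrier Q
     \<and> continuous_map (tp G) (tp Q) f \<and> open_map (tp G) (tp Q) f"

lemma quot_homD:
  assumes "quot_hom f G Q"
  shows "topgroup G" "topgroup Q" "f \<in> hom G Q" "f ` carrier G = carrier Q" "group_hom G Q f"
    "continuous_map (tp G) (tp Q) f" "open_map (tp G) (tp Q) f"
    "\<And>x. x \<in> carrier G \<Longrightarrow> f x \<in> carrier Q"
    "\<And>x y. x \<in> carrier G \<Longrightarrow> y \<in> carrier G \<Longrightarrow> f (x \<otimes>\<^bsub>G\<^esub> y) = f x \<otimes>\<^bsub>Q\<^esub> f y"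
    "f \<one>\<^bsub>G\<^esub> = \<one>\<^bsub>Q\<^esub>" "\<And>x. x \<in> carrier G \<Longrightarrow> f (inv\<^bsub>G\<^esub> x) = inv\<^bsub>Q\<^esub> f x"
proof -
  show *: "topgroup G" "topgroup Q" "f \<in> hom G Q" "f ` carrier G = carrier Q"
    "continuous_map (tp G) (tp Q) f" "open_map (tp G) (tp Q) f"
    using assms by (simp_all add: quot_hom_def)
  then show gh: "group_hom G Q f" by (simp add: group_hom_def group_hom_axioms_def topgroup_def)
  show "\<And>x. x \<in> carrier G \<Longrightarrow> f x \<in> carrier Q"
    "\<And>x y. x \<in> carrier G \<Longrightarrow> y \<in> carrier G \<Longrightarrow> f (x \<otimes>\<^bsub>G\<^esub> y) = f x \<otimes>\<^bsub>Q\<^esub> f y"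
    using *(3) by (auto simp: hom_def)
  show "f \<one>\<^bsub>G\<^esub> = \<one>\<^bsub>Q\<^esub>" "\<And>x. x \<in> carrier G \<Longrightarrow> f (inv\<^bsub>G\<^esub> x) = inv\<^bsub>Q\<^esub> f x"
    using gh by (simp_all add: group_hom.hom_one group_hom.hom_inv)
qed

text \<open>Openness of \<open>f\<close> pushes a rectangle \<open>A \<times> B\<close> on which
  multiplication lands in the preimage of \<open>W\<close> down to such a rectangle in
  \<open>Q\<close>; inversion descends because \<open>f\<close> is a quotient map. This is what
  makes \<open>quottg\<close> and \<open>copytg\<close> topological groups.\<close>

lemma topgroup_image:
  assumes G: "topgroup G" and Q: "group Q" "topspace (tp Q) = carrier Q"
    and f: "f \<in> hom G Q" "f ` carrier G = carrier Q" "continuous_map (tp G) (tp Q) f" "open_map (tp G) (tp Q) f"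
  shows "topgroup Q"
proof -
  interpret G: topgroup G by fact
  interpret Q: group Q by fact
  interpret f: group_hom G Q f using f by unfold_locales (simp add: hom_def)
  show ?thesis
  proof
    show "topspace (tp Q) = carrier Q" by fact
    show "continuous_map (prod_topology (tp Q) (tp Q)) (tp Q) (\<lambda>(x, y). x \<otimes>\<^bsub>Q\<^esub> y)"
      unfolding continuous_map
    proof (intro conjI allI impI)
      fix W assume W: "openin (tp Q) W"
      let ?S = "{z \<in> topspace (prod_topology (tp Q) (tp Q)). (case z of (x, y) \<Rightarrow> x \<otimes>\<^bsub>Q\<^esub> y) \<in> W}"
      have "openin (tp G) {x \<in> carrier G. f x \<in> W}"
        using openin_continuous_map_preimage[OF f(3) W] by simp
      then have S': "openin (prod_topology (tp G) (tp G))
          {z \<in> topspace (prod_topology (tp G) (tp G)). (\<lambda>(x, y). x \<otimes>\<^bsub>G\<^esub> y) z \<in> {x \<in> carrier G. f x \<in> W}}"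
        by (rule openin_continuous_map_preimage[OF G.continuous_mult])
      show "openin (prod_topology (tp Q) (tp Q)) ?S"
        unfolding openin_prod_topology_alt
      proof (intro allI impI)
        fix x y assume "(x, y) \<in> ?S"
        then have xy: "x \<in> carrier Q" "y \<in> carrier Q" "x \<otimes>\<^bsub>Q\<^esub> y \<in> W" using Q by auto
        then obtain a b where ab: "a \<in> carrier G" "b \<in> carrier G" "x = f a" "y = f b"
          using f(2) by (metis imageE)
        have "(a, b) \<in> {z \<in> topspace (prod_topology (tp G) (tp G)). (\<lambda>(x, y). x \<otimes>\<^bsub>G\<^esub> y) z \<in> {x \<in> carrier G. f x \<in> W}}"
          using ab xy by simp
        then obtain A B where AB: "openin (tp G) A" "openin (tp G) B" "a \<in> A" "b \<in> B"
          "A \<times> B \<subseteq> {z \<in> topspace (prod_topology (tp G) (tp G)). (\<lambda>(x, y). x \<otimes>\<^bsub>G\<^esub> y) z \<in> {x \<in> carrier G. f x \<in> W}}"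
          using S' unfolding openin_prod_topology_alt by meson
        have "f ` A \<times> f ` B \<subseteq> ?S"
        proof
          fix z assume "z \<in> f ` A \<times> f ` B"
          then obtain c d where cd: "c \<in> A" "d \<in> B" and z: "z = (f c, f d)" by blast
          then have "(c, d) \<in> {z \<in> topspace (prod_topology (tp G) (tp G)). (\<lambda>(x, y). x \<otimes>\<^bsub>G\<^esub> y) z \<in> {x \<in> carrier G. f x \<in> W}}"
            using AB(5) by blast
          then have "c \<in> carrier G" "d \<in> carrier G" "f (c \<otimes>\<^bsub>G\<^esub> d) \<in> W" by auto
          then show "z \<in> ?S" using Q z by simp
        qed
        then show "\<exists>U V. openin (tp Q) U \<and> openin (tp Q) V \<and> x \<in> U \<and> y \<in> V \<and> U \<times> V \<subseteq> ?S"
          using AB f(4) ab unfolding open_map_def by (intro exI[of _ "f ` A"] exI[of _ "f ` B"]) simp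
      qed
    qed (use Q in auto)
    show "continuous_map (tp Q) (tp Q) (\<lambda>x. inv\<^bsub>Q\<^esub> x)"
    proof (rule continuous_compose_quotient_map[OF continuous_open_imp_quotient_map[OF f(3,4)]])
      show "f ` topspace (tp G) = topspace (tp Q)" using f Q by simp
      have "continuous_map (tp G) (tp Q) (\<lambda>x. f (inv\<^bsub>G\<^esub> x))"
        using continuous_map_compose[OF G.continuous_inv f(3)] by (simp add: o_def)
      then show "continuous_map (tp G) (tp Q) ((\<lambda>x. inv\<^bsub>Q\<^esub> x) \<circ> f)"
        by (rule continuous_map_eq) (simp add: G.topspace_tp)
    qed
  qed
qed

lemma quot_hom_id: assumes "topgroup G" shows "quot_hom (\<lambda>x. x) G G"
proof -
  have "continuous_map (tp G) (tp G) (\<lambda>x. x)" using topgroup.cid[OF assms] .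
  moreover have "open_map (tp G) (tp G) (\<lambda>x. x)" unfolding open_map_def by simp
  moreover have "(\<lambda>x. x) \<in> hom G G" by (rule homI) simp_all
  ultimately show ?thesis using assms unfolding quot_hom_def by simp
qed

lemma quot_hom_comp:
  assumes "quot_hom f G P" "quot_hom g P Q"
  shows "quot_hom (\<lambda>x. g (f x)) G Q"
proof -
  have "continuous_map (tp G) (tp Q) (g \<circ> f)" "open_map (tp G) (tp Q) (g \<circ> f)"
    using continuous_map_compose[OF quot_homD(6)[OF assms(1)] quot_homD(6)[OF assms(2)]]
      open_map_compose[OF quot_homD(7)[OF assms(1)] quot_homD(7)[OF assms(2)]] by simp_all
  moreover have "(\<lambda>x. g (f x)) \<in> hom G Q" using quot_homD(8,9)[OF assms(1)] quot_homD(8,9)[OF assms(2)] by (simp add: hom_def)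
  moreover have "(\<lambda>x. g (f x)) ` carrier G = carrier Q"
    using quot_homD(4)[OF assms(1)] quot_homD(4)[OF assms(2)] by (metis image_image)
  ultimately show ?thesis using assms by (simp add: quot_hom_def o_def)
qed

lemma quot_hom_preimage_subgroup:
  assumes f: "quot_hom f G Q" and S: "subgroup S Q"
  shows "subgroup {x \<in> carrier G. f x \<in> S} G"
proof -
  interpret group_hom G Q f by (rule quot_homD[OF f])
  show ?thesis
    using S by (intro G.subgroupI) (auto simp: subgroup.m_closed subgroup.m_inv_closed subgroup.one_closed intro!: exI[of _ "\<one>\<^bsub>G\<^esub>"])
qed

lemma quot_hom_preimage_normal:
  assumes f: "quot_hom f G Q" and S: "S \<lhd> Q"
  shows "{x \<in> carrier G. f x \<in> S} \<lhd> G"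
proof -
  interpret group_hom G Q f by (rule quot_homD[OF f])
  show ?thesis
    using S quot_hom_preimage_subgroup[OF f] by (auto simp: G.normal_inv_iff H.normal_inv_iff)
qed

lemma quot_hom_preimage_closed:
  assumes f: "quot_hom f G Q" and S: "closedin (tp Q) S"
  shows "closedin (tp G) {x \<in> carrier G. f x \<in> S}"
  using closedin_continuous_map_preimage[OF quot_homD(6)[OF f] S] topgroup.topspace_tp[OF quot_homD(1)[OF f]] by simp

lemma quot_hom_preimage_open:
  assumes f: "quot_hom f G Q" and S: "openin (tp Q) S"
  shows "openin (tp G) {x \<in> carrier G. f x \<in> S}"
  using openin_continuous_map_preimage[OF quot_homD(6)[OF f] S] topgroup.topspace_tp[OF quot_homD(1)[OF f]] by simp

lemma quot_hom_restrict:
  assumes f: "quot_hom f G Q" and S: "subgroup S Q"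
  shows "quot_hom f (subtg G {x \<in> carrier G. f x \<in> S}) (subtg Q S)"
proof -
  interpret G: topgroup G by (rule quot_homD[OF f])
  interpret Q: topgroup Q by (rule quot_homD[OF f])
  let ?K = "{x \<in> carrier G. f x \<in> S}"
  have Sc: "S \<subseteq> carrier Q" using S by (rule subgroup.subset)
  have "f ` ?K = S" using quot_homD(4)[OF f] Sc by auto
  moreover have "open_map (subtopology (tp G) ?K) (subtopology (tp Q) S) f"
    by (rule open_map_restriction[OF quot_homD(7)[OF f]]) simp
  moreover have "continuous_map (subtopology (tp G) ?K) (subtopology (tp Q) S) f"
    using quot_homD(6)[OF f] by (auto simp: continuous_map_in_subtopology continuous_map_from_subtopology)
  moreover have "f \<in> hom (subtg G ?K) (subtg Q S)"
    using quot_homD(9)[OF f] by (simp add: hom_def)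
  ultimately show ?thesis
    using G.subtg_topgroup[OF quot_hom_preimage_subgroup[OF f S]] Q.subtg_topgroup[OF S] by (simp add: quot_hom_def)
qed

lemma kernel_restrict:
  "subgroup S Q \<Longrightarrow> kernel (subtg G {x \<in> carrier G. f x \<in> S}) (subtg Q S) f = kernel G Q f"
  using subgroup.one_closed by (fastforce simp: kernel_def)

lemma kernel_normal: "quot_hom f G Q \<Longrightarrow> kernel G Q f \<lhd> G"
  using quot_homD(5) group_hom.normal_kernel by blast

lemma kernel_subgroup: "quot_hom f G Q \<Longrightarrow> subgroup (kernel G Q f) G"
  using quot_homD(5) group_hom.subgroup_kernel by blast

lemma quot_hom_eq_iff:
  assumes f: "quot_hom f G Q" and xy: "x \<in> carrier G" "y \<in> carrier G"
  shows "f x = f y \<longleftrightarrow> inv\<^bsub>G\<^esub> x \<otimes>\<^bsub>G\<^esub> y \<in> kernel G Q f"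
proof -
  interpret group_hom G Q f by (rule quot_homD[OF f])
  have "f (inv\<^bsub>G\<^esub> x \<otimes>\<^bsub>G\<^esub> y) = inv\<^bsub>Q\<^esub> (f x) \<otimes>\<^bsub>Q\<^esub> f y" using xy by simp
  moreover have "inv\<^bsub>Q\<^esub> (f x) \<otimes>\<^bsub>Q\<^esub> f y = \<one>\<^bsub>Q\<^esub> \<longleftrightarrow> f x = f y"
    using xy H.inv_equality[of "inv\<^bsub>Q\<^esub> (f x)" "f y"] H.inv_inv[of "f x"] H.inv_inv[of "f y"] by auto
  ultimately show ?thesis using xy by (simp add: kernel_def)
qed

lemma quot_hom_inj_iff:
  assumes f: "quot_hom f G Q"
  shows "inj_on f (carrier G) \<longleftrightarrow> kernel G Q f = {\<one>\<^bsub>G\<^esub>}"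
  using group_hom.inj_iff_trivial_ker[OF quot_homD(5)[OF f]] by simp

text \<open>The universal property of a quotient: \<open>g\<close> composed with any choice of
  \<open>f\<close>-preimages does not depend on the choice, by the inclusion of kernels. The kernel
  formula plays the part of the third isomorphism theorem.\<close>

lemma quot_hom_factor:
  assumes f: "quot_hom f G P" and g: "quot_hom g G Q" and k: "kernel G P f \<subseteq> kernel G Q g"
  obtains h where "quot_hom h P Q" "\<And>x. x \<in> carrier G \<Longrightarrow> h (f x) = g x" "kernel P Q h = f ` kernel G Q g"
proof -
  interpret G: topgroup G by (rule quot_homD[OF f])
  interpret P: topgroup P by (rule quot_homD[OF f])
  interpret Q: topgroup Q by (rule quot_homD[OF g])
  define h where "h y = g (SOME x. x \<in> carrier G \<and> f x = y)" for y
  have h: "h (f x) = g x" if x: "x \<in> carrier G" for x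
  proof -
    let ?x = "SOME z. z \<in> carrier G \<and> f z = f x"
    have s: "?x \<in> carrier G \<and> f ?x = f x" by (rule someI[of _ x]) (use x in simp)
    then have "inv\<^bsub>G\<^esub> ?x \<otimes>\<^bsub>G\<^esub> x \<in> kernel G P f" using quot_hom_eq_iff[OF f, of ?x x] x by simp
    then have "g ?x = g x" using quot_hom_eq_iff[OF g, of ?x x] k x s by blast
    then show ?thesis by (simp add: h_def)
  qed
  have ex: "\<exists>x\<in>carrier G. y = f x" if "y \<in> carrier P" for y
    using that quot_homD(4)[OF f] by auto
  have qm: "quotient_map (tp G) (tp P) f"
    using f by (intro continuous_open_imp_quotient_map) (simp_all add: quot_hom_def topgroup.topspace_tp)
  have "continuous_map (tp G) (tp Q) (h \<circ> f)"
    by (rule continuous_map_eq[OF quot_homD(6)[OF g]]) (simp add: h)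
  then have "continuous_map (tp P) (tp Q) h"
    by (rule continuous_compose_quotient_map[OF qm])
  moreover have "open_map (tp P) (tp Q) h"
    unfolding open_map_def
  proof (intro allI impI)
    fix W assume W: "openin (tp P) W"
    have Wc: "W \<subseteq> carrier P" using openin_subset[OF W] by simp
    have "W \<subseteq> f ` {x \<in> carrier G. f x \<in> W}"
    proof
      fix y assume y: "y \<in> W"
      then obtain x where "x \<in> carrier G" "y = f x" using ex Wc by blast
      then show "y \<in> f ` {x \<in> carrier G. f x \<in> W}" using y by simp
    qed
    then have "W = f ` {x \<in> carrier G. f x \<in> W}" by auto
    then have "h ` W = h ` (f ` {x \<in> carrier G. f x \<in> W})" by simp
    also have "\<dots> = (\<lambda>x. h (f x)) ` {x \<in> carrier G. f x \<in> W}" by (simp add: image_image)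
    also have "\<dots> = g ` {x \<in> carrier G. f x \<in> W}" by (rule image_cong) (auto simp: h)
    finally have "h ` W = g ` {x \<in> carrier G. f x \<in> W}" .
    then show "openin (tp Q) (h ` W)"
      using quot_hom_preimage_open[OF f W] quot_homD(7)[OF g] by (simp add: open_map_def)
  qed
  moreover have "h ` carrier P = carrier Q"
    using quot_homD(4)[OF g] h by (simp add: quot_homD(4)[OF f, symmetric] image_image)
  moreover have "h \<in> hom P Q"
  proof (rule homI)
    fix x y assume "x \<in> carrier P" "y \<in> carrier P"
    then obtain a b where "a \<in> carrier G" "x = f a" "b \<in> carrier G" "y = f b" using ex[of x] ex[of y] by metis
    then show "h (x \<otimes>\<^bsub>P\<^esub> y) = h x \<otimes>\<^bsub>Q\<^esub> h y"
      using h[of a] h[of b] h[of "a \<otimes>\<^bsub>G\<^esub> b"] quot_homD(9)[OF f, of a b] quot_homD(9)[OF g, of a b] by simp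
  next
    fix x assume "x \<in> carrier P"
    then obtain a where "a \<in> carrier G" "x = f a" using ex by blast
    then show "h x \<in> carrier Q" using h[of a] quot_homD(8)[OF g, of a] by simp
  qed
  moreover have "kernel P Q h = f ` kernel G Q g"
  proof
    show "kernel P Q h \<subseteq> f ` kernel G Q g"
    proof
      fix y assume y: "y \<in> kernel P Q h"
      then obtain x where "x \<in> carrier G" "y = f x" using ex by (auto simp: kernel_def)
      then show "y \<in> f ` kernel G Q g" using y h[of x] by (simp add: kernel_def)
    qed
    show "f ` kernel G Q g \<subseteq> kernel P Q h"
      using h quot_homD(8)[OF f] by (auto simp: kernel_def)
  qed
  ultimately show ?thesis using that f g h by (simp add: quot_hom_def)
qed

text \<open>The identity of \<open>G\<close> factors through an injective \<open>f\<close>, and the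
  factor is the inverse.\<close>

lemma quot_hom_inverse:
  assumes f: "quot_hom f G Q" and inj: "inj_on f (carrier G)"
  obtains h where "quot_hom h Q G" "\<And>x. x \<in> carrier G \<Longrightarrow> h (f x) = x" "inj_on h (carrier Q)"
proof -
  have G: "topgroup G" using f by (rule quot_homD)
  have k: "kernel G Q f = {\<one>\<^bsub>G\<^esub>}" "kernel G G (\<lambda>x. x) = {\<one>\<^bsub>G\<^esub>}"
    using quot_hom_inj_iff[OF f] inj group.is_monoid[of G] G by (auto simp: kernel_def topgroup_def monoid.one_closed)
  obtain h where h: "quot_hom h Q G" "\<And>x. x \<in> carrier G \<Longrightarrow> h (f x) = x"
    using quot_hom_factor[OF f quot_hom_id[OF G]] k by (metis subset_refl)
  have "inj_on h (carrier Q)"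
    unfolding quot_homD(4)[OF f, symmetric] using h(2) by (simp add: inj_on_def)
  then show ?thesis using that h by blast
qed

lemma tg_iso_imp_quot_hom:
  assumes "tg_iso G H" "topgroup G" "topgroup H"
  shows "\<exists>f. quot_hom f G H \<and> inj_on f (carrier G)"
  using assms unfolding tg_iso_def quot_hom_def
  by (metis bij_betw_def homeomorphic_imp_continuous_map homeomorphic_imp_open_map)

lemma quot_hom_imp_tg_iso:
  assumes "quot_hom f G H" "inj_on f (carrier G)"
  shows "tg_iso G H"
proof -
  interpret G: topgroup G by (rule quot_homD[OF assms(1)])
  interpret H: topgroup H by (rule quot_homD[OF assms(1)])
  have "homeomorphic_map (tp G) (tp H) f"
    using quot_homD(4,6,7)[OF assms(1)] assms(2) by (intro bijective_open_imp_homeomorphic_map) auto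
  then show ?thesis
    unfolding tg_iso_def bij_betw_def using quot_homD(3,4)[OF assms(1)] assms(2) by blast
qed

section \<open>Coset groups\<close>

lemma openin_quot_top:
  assumes C: "\<And>A B. A \<in> C \<Longrightarrow> B \<in> C \<Longrightarrow> A \<noteq> B \<Longrightarrow> A \<inter> B = {}"
  shows "openin (quot_top T C) S \<longleftrightarrow> S \<subseteq> C \<and> openin T (\<Union>S)"
proof -
  have "istopology (\<lambda>S. S \<subseteq> C \<and> openin T (\<Union>S))"
    unfolding istopology_def
  proof (intro conjI allI impI)
    fix S S' assume S: "S \<subseteq> C \<and> openin T (\<Union>S)" "S' \<subseteq> C \<and> openin T (\<Union>S')"
    have "\<Union>S \<inter> \<Union>S' \<subseteq> \<Union>(S \<inter> S')"
    proof
      fix x assume "x \<in> \<Union>S \<inter> \<Union>S'"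
      then obtain A B where AB: "A \<in> S" "B \<in> S'" "x \<in> A" "x \<in> B" by blast
      then have "A = B" using C[of A B] S by blast
      then show "x \<in> \<Union>(S \<inter> S')" using AB by blast
    qed
    then have "\<Union>(S \<inter> S') = \<Union>S \<inter> \<Union>S'" by blast
    then show "openin T (\<Union>(S \<inter> S'))" using S by auto
  next
    fix S S' assume S: "S \<subseteq> C \<and> openin T (\<Union>S)" "S' \<subseteq> C \<and> openin T (\<Union>S')"
    then show "S \<inter> S' \<subseteq> C" by blast
  next
    fix K assume K: "\<forall>S\<in>K. S \<subseteq> C \<and> openin T (\<Union>S)"
    have "\<Union>(\<Union>K) = \<Union>(Union ` K)" by auto
    then show "openin T (\<Union>(\<Union>K))" using K by (metis imageE openin_Union)
  qed auto
  then show ?thesis by (simp add: quot_top_def topology_inverse')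
qed

lemma quot_hom_quottg:
  fixes G (structure)
  assumes "topgroup G" and N: "N \<lhd> G"
  shows "quot_hom (\<lambda>x. N #> x) G (quottg G N)" "kernel G (quottg G N) (\<lambda>x. N #> x) = N"
proof -
  interpret topgroup G by fact
  interpret N: normal N G by fact
  have disj: "A \<inter> B = {}" if "A \<in> rcosets N" "B \<in> rcosets N" "A \<noteq> B" for A B
    using rcos_disjoint[OF N.subgroup_axioms] that by (auto simp: pairwise_def disjnt_def)
  \<comment> \<open>The union in \<open>quot_top\<close> is the preimage under the projection,
    because a coset in \<open>S\<close> is the coset of each of its elements.\<close>
  have un: "\<Union>S = {x \<in> carrier G. N #> x \<in> S}" if "S \<subseteq> rcosets N" for S
  proof safe
    fix x A assume "x \<in> A" "A \<in> S"
    then have "A \<in> rcosets N" using that by blast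
    then obtain a where a: "a \<in> carrier G" "A = N #> a" by (auto simp: RCOSETS_def)
    then show x: "x \<in> carrier G" using \<open>x \<in> A\<close> r_coset_subset_G[OF N.subset] by blast
    show "N #> x \<in> S" using repr_independence[of x N a] a \<open>x \<in> A\<close> \<open>A \<in> S\<close> N.subgroup_axioms by simp
  next
    fix x assume "x \<in> carrier G" "N #> x \<in> S"
    then show "x \<in> \<Union>S" using rcos_self[OF _ N.subgroup_axioms, of x] by blast
  qed
  have op: "openin (tp (quottg G N)) S \<longleftrightarrow> S \<subseteq> rcosets N \<and> openin (tp G) (\<Union>S)" for S
    using openin_quot_top[of "rcosets N"] disj by simp
  have ts: "topspace (tp (quottg G N)) = rcosets N"
  proof -
    have "openin (tp (quottg G N)) (rcosets N)"
      using un[of "rcosets N"] op openin_topspace[of "tp G"] by (simp add: RCOSETS_def cong: conj_cong)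
         (metis (mono_tags, lifting) Collect_cong Collect_mem_eq UN_I singletonI)
    moreover have "topspace (tp (quottg G N)) \<subseteq> rcosets N"
      using op openin_topspace by blast
    ultimately show ?thesis using openin_subset by blast
  qed
  have grp: "group (quottg G N)"
    by (rule group_cong[OF N.factorgroup_is_group]) (auto simp: FactGroup_def)
  have hom: "(\<lambda>x. N #> x) \<in> hom G (quottg G N)"
    using N.r_coset_hom_Mod by (simp add: hom_def FactGroup_def)
  have im: "(\<lambda>x. N #> x) ` carrier G = carrier (quottg G N)" by (auto simp: RCOSETS_def)
  have cont: "continuous_map (tp G) (tp (quottg G N)) (\<lambda>x. N #> x)"
    unfolding continuous_map ts
  proof (intro conjI allI impI)
    show "(\<lambda>x. N #> x) ` topspace (tp G) \<subseteq> rcosets N" by (auto simp: RCOSETS_def)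
    fix S assume "openin (tp (quottg G N)) S"
    then show "openin (tp G) {x \<in> topspace (tp G). N #> x \<in> S}" using op un by auto
  qed
  have opn: "open_map (tp G) (tp (quottg G N)) (\<lambda>x. N #> x)"
    unfolding open_map_def
  proof (intro allI impI)
    fix W assume W: "openin (tp G) W"
    have Wc: "W \<subseteq> carrier G" using openin_subset[OF W] by simp
    \<comment> \<open>The saturation \<open>N W\<close> is the union of the open translates
      \<open>n W\<close>.\<close>
    have "\<Union>((\<lambda>x. N #> x) ` W) = (\<Union>n\<in>N. {x \<in> carrier G. inv n \<otimes> x \<in> W})"
    proof safe
      fix x w assume "x \<in> N #> w" "w \<in> W"
      then obtain n where n: "n \<in> N" "x = n \<otimes> w" by (auto simp: r_coset_def)
      then have "x \<in> {x \<in> carrier G. inv n \<otimes> x \<in> W}" using \<open>w \<in> W\<close> Wc N.mem_carrier[of n] by auto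
      then show "x \<in> (\<Union>n\<in>N. {x \<in> carrier G. inv n \<otimes> x \<in> W})" using n(1) by blast
    next
      fix x n assume *: "n \<in> N" "x \<in> carrier G" "inv n \<otimes> x \<in> W"
      then have "x \<in> N #> (inv n \<otimes> x)" using N.mem_carrier[of n] cancel_left(2)[of n x] by (force simp: r_coset_def)
      then show "x \<in> \<Union>((\<lambda>x. N #> x) ` W)" using * by blast
    qed
    moreover have "openin (tp G) {x \<in> carrier G. inv n \<otimes> x \<in> W}" if "n \<in> N" for n
      by (rule open_preimage[OF _ W], intro cintros) (use that N.mem_carrier in auto)
    ultimately have "openin (tp G) (\<Union>((\<lambda>x. N #> x) ` W))" by auto
    then show "openin (tp (quottg G N)) ((\<lambda>x. N #> x) ` W)"
      using op Wc by (auto simp: RCOSETS_def)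
  qed
  have tg: "topgroup (quottg G N)"
    by (rule topgroup_image[OF assms(1) grp _ hom im cont opn]) (use ts in simp)
  show "quot_hom (\<lambda>x. N #> x) G (quottg G N)"
    using tg hom im cont opn assms(1) by (simp only: quot_hom_def)
  show "kernel G (quottg G N) (\<lambda>x. N #> x) = N"
    using coset_join1[OF _ _ N.subgroup_axioms] coset_join2[OF _ N.subgroup_axioms] N.subset
    by (auto simp: kernel_def)
qed

lemma quottg_iso:
  assumes f: "quot_hom f G Q"
  obtains h where "quot_hom h (quottg G (kernel G Q f)) Q" "inj_on h (carrier (quottg G (kernel G Q f)))"
proof -
  have G: "topgroup G" by (rule quot_homD[OF f])
  note q = quot_hom_quottg[OF G kernel_normal[OF f]]
  obtain h where h: "quot_hom h (quottg G (kernel G Q f)) Q"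
    "kernel (quottg G (kernel G Q f)) Q h = (\<lambda>x. kernel G Q f #>\<^bsub>G\<^esub> x) ` kernel G Q f"
    using quot_hom_factor[OF q(1) f] q(2) by (metis subset_refl)
  have "kernel (quottg G (kernel G Q f)) Q h = {\<one>\<^bsub>quottg G (kernel G Q f)\<^esub>}"
  proof -
    have "(\<lambda>x. kernel G Q f #>\<^bsub>G\<^esub> x) ` kernel G Q f = {kernel G Q f}"
    proof -
      have "kernel G Q f #>\<^bsub>G\<^esub> x = kernel G Q f" if "x \<in> kernel G Q f" for x
        using q(2) that unfolding kernel_def[of G "quottg G (kernel G Q f)"] by auto
      then show ?thesis using subgroup.one_closed[OF kernel_subgroup[OF f]] by blast
    qed
    then show ?thesis unfolding h(2) by simp
  qed
  then show ?thesis using that h quot_hom_inj_iff[OF h(1)] by blast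
qed

section \<open>Topological properties inherited by quotients and subgroups\<close>

lemma kernel_closed:
  assumes f: "quot_hom f G Q" and H: "Hausdorff_space (tp Q)"
  shows "closedin (tp G) (kernel G Q f)"
proof -
  interpret Q: topgroup Q by (rule quot_homD[OF f])
  have "closedin (tp Q) {\<one>\<^bsub>Q\<^esub>}"
    using Hausdorff_imp_t1_space[OF H] by (simp add: t1_space_closedin_singleton)
  from quot_hom_preimage_closed[OF f this] show ?thesis by (simp add: kernel_def)
qed

text \<open>The diagonal is the preimage of the identity under division.\<close>

lemma (in topgroup) Hausdorff_if_closed_one:
  assumes "closedin (tp G) {\<one>}" shows "Hausdorff_space (tp G)"
proof -
  have "continuous_map (prod_topology (tp G) (tp G)) (tp G) (\<lambda>z. fst z \<otimes> inv (snd z))"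
    by (intro cmult cinv continuous_map_fst continuous_map_snd)
  from closedin_continuous_map_preimage[OF this assms]
  have "closedin (prod_topology (tp G) (tp G)) {z \<in> carrier G \<times> carrier G. fst z \<otimes> inv (snd z) = \<one>}"
    by simp
  moreover have "{z \<in> carrier G \<times> carrier G. fst z \<otimes> inv (snd z) = \<one>} = (\<lambda>x. (x, x)) ` topspace (tp G)"
    by (auto simp: image_iff) (metis inv_equality inv_inv inv_closed)
  ultimately show ?thesis by (simp add: Hausdorff_space_closedin_diagonal)
qed

text \<open>The open map \<open>f\<close> sends the complement of the closed kernel onto the
  complement of the identity, so \<open>Q\<close> is Hausdorff; the images of compact open subgroups
  of \<open>G\<close> form the base required by \<open>tdgroup\<close>.\<close>

lemma quot_hom_tdlcsc:
  assumes f: "quot_hom f G Q" and G: "tdlcsc G" and k: "closedin (tp G) (kernel G Q f)"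
  shows "tdlcsc Q"
proof -
  interpret G: tdgroup G using G by (rule tdlcsc_tdgroup)
  interpret Q: topgroup Q by (rule quot_homD[OF f])
  interpret f: group_hom G Q f by (rule quot_homD[OF f])
  have "f ` (carrier G - kernel G Q f) = carrier Q - {\<one>\<^bsub>Q\<^esub>}"
    using quot_homD(4)[OF f] by (auto simp: kernel_def)
  moreover have "openin (tp G) (carrier G - kernel G Q f)" using k openin_diff[OF openin_topspace[of "tp G"]] by simp
  ultimately have "openin (tp Q) (carrier Q - {\<one>\<^bsub>Q\<^esub>})" using quot_homD(7)[OF f] unfolding open_map_def by metis
  then have "closedin (tp Q) {\<one>\<^bsub>Q\<^esub>}" by (simp add: closedin_def)
  then have H: "Hausdorff_space (tp Q)" by (rule Q.Hausdorff_if_closed_one)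
  interpret Q: tdgroup Q
  proof
    show "Hausdorff_space (tp Q)" by fact
    fix W assume W: "openin (tp Q) W" "\<one>\<^bsub>Q\<^esub> \<in> W"
    obtain V where V: "open_subgroup V G" "compactin (tp G) V" "V \<subseteq> {x \<in> carrier G. f x \<in> W}"
      using G.base[OF quot_hom_preimage_open[OF f W(1)]] W by auto
    have "open_subgroup (f ` V) Q" using V(1) quot_homD(7)[OF f] f.subgroup_img_is_subgroup
      unfolding open_subgroup_def open_map_def by blast
    moreover have "compactin (tp Q) (f ` V)" using image_compactin[OF V(2) quot_homD(6)[OF f]] .
    ultimately show "\<exists>V. open_subgroup V Q \<and> compactin (tp Q) V \<and> V \<subseteq> W" using V(3) by blast
  qed
  have "second_countable (tp Q)"
    by (rule second_countable_open_map_image[of "tp G" "tp Q" f])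
       (use f G in \<open>auto simp: quot_hom_def tdlcsc_def topgroup.topspace_tp\<close>)
  then show ?thesis by (rule Q.tdlcscI)
qed

lemma tdlcsc_topgroup: "tdlcsc G \<Longrightarrow> topgroup G"
  by (simp add: tdlcsc_def topological_group_iff)

lemma tdlcsc_iso:
  assumes f: "quot_hom f G Q" and inj: "inj_on f (carrier G)" and G: "tdlcsc G"
  shows "tdlcsc Q"
proof (rule quot_hom_tdlcsc[OF f G])
  have "kernel G Q f = {\<one>\<^bsub>G\<^esub>}" using quot_hom_inj_iff[OF f] inj by simp
  moreover have "\<one>\<^bsub>G\<^esub> \<in> carrier G" using tdlcsc_topgroup[OF G] by (simp add: topgroup_def group.is_monoid monoid.one_closed)
  ultimately show "closedin (tp G) (kernel G Q f)"
    using G Hausdorff_imp_t1_space[of "tp G"] topgroup.topspace_tp[OF tdlcsc_topgroup[OF G]]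
    by (simp add: tdlcsc_def t1_space_closedin_singleton)
qed

lemma tdlcsc_quottg:
  assumes "tdlcsc G" "closed_normal N G" shows "tdlcsc (quottg G N)"
  using assms quot_hom_quottg[OF tdlcsc_topgroup[OF assms(1)], of N] quot_hom_tdlcsc[OF _ assms(1)]
  unfolding closed_normal_def by metis

lemma totally_disconnected_subtopology:
  "totally_disconnected_space T \<Longrightarrow> totally_disconnected_space (subtopology T S)"
  by (auto simp: totally_disconnected_space_def connectedin_subtopology)

lemma tdlcsc_subtg:
  assumes G: "tdlcsc G" and H: "subgroup H G" "closedin (tp G) H"
  shows "tdlcsc (subtg G H)"
proof -
  interpret topgroup G using G by (rule tdlcsc_topgroup)
  have "locally_compact_space (subtopology (tp G) H)"
    by (rule locally_compact_space_closed_subset) (use G H(2) in \<open>simp_all add: tdlcsc_def\<close>)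
  then show ?thesis
    using G subtg_topgroup[OF H(1)]
    by (simp add: tdlcsc_def topological_group_iff Hausdorff_space_subtopology second_countable_subtopology
        totally_disconnected_subtopology)
qed

lemma profinite_image:
  assumes f: "quot_hom f G Q" and "profinite G" "tdlcsc Q" shows "profinite Q"
proof -
  interpret G: topgroup G by (rule quot_homD[OF f])
  interpret Q: topgroup Q by (rule quot_homD[OF f])
  show ?thesis using assms(2,3) image_compactin[of "tp G" "carrier G" "tp Q" f] quot_homD(4,6)[OF f]
    by (simp add: profinite_def compact_space_def)
qed

lemma discrete_image:
  assumes f: "quot_hom f G Q" and "discrete_tg G" "tdlcsc Q" shows "discrete_tg Q"
proof -
  interpret G: topgroup G by (rule quot_homD[OF f])
  interpret Q: topgroup Q by (rule quot_homD[OF f])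
  have "openin (tp Q) S" if "S \<subseteq> carrier Q" for S
  proof -
    have "S = f ` {x \<in> carrier G. f x \<in> S}" using that quot_homD(4)[OF f] by auto
    moreover have "openin (tp G) {x \<in> carrier G. f x \<in> S}" using assms(2) by (auto simp: discrete_tg_def)
    ultimately show ?thesis using quot_homD(7)[OF f] unfolding open_map_def by metis
  qed
  then have "tp Q = discrete_topology (carrier Q)"
    unfolding topology_eq using openin_subset[of "tp Q"] by auto
  moreover have "countable (carrier Q)" using assms(2) quot_homD(4)[OF f] unfolding discrete_tg_def by (metis countable_image)
  ultimately show ?thesis using assms(3) by (simp add: discrete_tg_def)
qed

section \<open>Extensions of elementary groups\<close>

lemma elem_univ_tdlcsc: "elem_univ G \<Longrightarrow> tdlcsc G"
  by (induction rule: elem_univ.induct) (auto simp: profinite_def discrete_tg_def)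

lemma kernel_closed_normal:
  assumes "quot_hom f G Q" "tdlcsc Q" shows "closed_normal (kernel G Q f) G"
  using kernel_normal[OF assms(1)] kernel_closed[OF assms(1)] assms(2) by (simp add: closed_normal_def tdlcsc_def)

lemma closed_normalD:
  assumes "closed_normal N G" shows "subgroup N G" "closedin (tp G) N" "N \<lhd> G"
  using assms normal_imp_subgroup by (auto simp: closed_normal_def)

text \<open>Induction on the elementary quotient \<open>Q\<close>, with \<open>G\<close> and
  \<open>f\<close> arbitrary, pulling the construction of \<open>Q\<close> back along
  \<open>f\<close>. In the extension case \<open>f\<close> restricts to the preimage of
  \<open>H\<close> with the same kernel, so that preimage is elementary by induction, and the
  quotient of \<open>G\<close> by it is an image of \<open>Q/H\<close>. In the union case the
  preimages of the \<open>Os i\<close> exhaust \<open>G\<close>.\<close>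

theorem elem_univ_extension:
  fixes G :: "nat set tgroup"
  assumes "elem_univ Q" "tdlcsc G" "quot_hom f G Q" "elem_univ (subtg G (kernel G Q f))"
  shows "elem_univ G"
  using assms
proof (induction arbitrary: G f rule: elem_univ.induct)
  case (base_profinite Q)
  note f = \<open>quot_hom f G Q\<close>
  have Q: "tdlcsc Q" using base_profinite by (simp add: profinite_def)
  have cn: "closed_normal (kernel G Q f) G" by (rule kernel_closed_normal[OF f Q])
  note q = quot_hom_quottg[OF quot_homD(1)[OF f] closed_normalD(3)[OF cn]]
  obtain h where "quot_hom h Q (quottg G (kernel G Q f))"
    using quot_hom_factor[OF f q(1)] q(2) by (metis subset_refl)
  then have "profinite (quottg G (kernel G Q f))"
    using profinite_image base_profinite tdlcsc_quottg[OF _ cn] by blast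
  then show ?case using elem_univ.extension base_profinite cn by blast
next
  case (base_discrete Q)
  note f = \<open>quot_hom f G Q\<close>
  have Q: "tdlcsc Q" using base_discrete by (simp add: discrete_tg_def)
  have cn: "closed_normal (kernel G Q f) G" by (rule kernel_closed_normal[OF f Q])
  note q = quot_hom_quottg[OF quot_homD(1)[OF f] closed_normalD(3)[OF cn]]
  obtain h where "quot_hom h Q (quottg G (kernel G Q f))"
    using quot_hom_factor[OF f q(1)] q(2) by (metis subset_refl)
  then have "discrete_tg (quottg G (kernel G Q f))"
    using discrete_image base_discrete tdlcsc_quottg[OF _ cn] by blast
  then show ?case using elem_univ.extension base_discrete cn by blast
next
  case (extension Q H)
  note f = \<open>quot_hom f G Q\<close>
  note H = closed_normalD[OF \<open>closed_normal H Q\<close>]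
  let ?K = "{x \<in> carrier G. f x \<in> H}"
  have K: "subgroup ?K G" "closedin (tp G) ?K" "?K \<lhd> G"
    using quot_hom_preimage_subgroup[OF f H(1)] quot_hom_preimage_closed[OF f H(2)] quot_hom_preimage_normal[OF f H(3)] by simp_all
  have cn: "closed_normal ?K G" using K by (simp add: closed_normal_def)
  have "subtg (subtg G ?K) (kernel (subtg G ?K) (subtg Q H) f) = subtg G (kernel G Q f)"
    unfolding kernel_restrict[OF H(1)] by (rule subtg_subtg) (use subgroup.one_closed[OF H(1)] in \<open>auto simp: kernel_def\<close>)
  then have eK: "elem_univ (subtg G ?K)"
    using extension.IH[OF tdlcsc_subtg[OF \<open>tdlcsc G\<close> K(1,2)] quot_hom_restrict[OF f H(1)]] extension.prems(3) by simp
  note qG = quot_hom_quottg[OF quot_homD(1)[OF f] K(3)]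
  note qQ = quot_hom_quottg[OF quot_homD(2)[OF f] H(3)]
  note qf = quot_hom_comp[OF f qQ(1)]
  have "kernel G (quottg Q H) (\<lambda>x. H #>\<^bsub>Q\<^esub> f x) = ?K"
    using qQ(2) quot_homD(8)[OF f] by (auto simp: kernel_def)
  then obtain h where h: "quot_hom h (quottg Q H) (quottg G ?K)"
    using quot_hom_factor[OF qf qG(1)] qG(2) by (metis subset_refl)
  have "profinite (quottg G ?K) \<or> discrete_tg (quottg G ?K)"
    using extension.hyps profinite_image[OF h] discrete_image[OF h] tdlcsc_quottg[OF \<open>tdlcsc G\<close> cn] by blast
  then show ?case using elem_univ.extension[OF \<open>tdlcsc G\<close> cn eK] by blast
next
  case (union Q Os)
  note f = \<open>quot_hom f G Q\<close>
  let ?K = "\<lambda>i. {x \<in> carrier G. f x \<in> Os i}"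
  have Os: "subgroup (Os i) Q" "openin (tp Q) (Os i)" for i using union.hyps(2)[of i] by (simp_all add: open_subgroup_def)
  have K: "open_subgroup (?K i) G" for i
    unfolding open_subgroup_def using quot_hom_preimage_subgroup[OF f Os(1)] quot_hom_preimage_open[OF f Os(2)] by simp
  show ?case
  proof (rule elem_univ.union[OF \<open>tdlcsc G\<close> K])
    fix i
    show "elem_univ (subtg G (?K i))"
    proof -
      have "subtg (subtg G (?K i)) (kernel (subtg G (?K i)) (subtg Q (Os i)) f) = subtg G (kernel G Q f)"
        unfolding kernel_restrict[OF Os(1)] by (rule subtg_subtg) (use subgroup.one_closed[OF Os(1)] in \<open>auto simp: kernel_def\<close>)
      moreover have "tdlcsc (subtg G (?K i))"
        using tdlcsc_subtg[OF \<open>tdlcsc G\<close>] topgroup.osub_closed[OF quot_homD(1)[OF f] K] K unfolding open_subgroup_def by blast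
      ultimately show ?thesis using union.IH[OF _ quot_hom_restrict[OF f Os(1)]] union.prems(3) by simp
    qed
    show "?K i \<subseteq> ?K (Suc i)" using union.hyps(4)[of i] by blast
  next
    show "carrier G = (\<Union>i. ?K i)" using union.hyps(5) quot_homD(8)[OF f] by blast
  qed
qed

section \<open>Transport to the fixed carrier type\<close>

definition copytg :: "('a \<Rightarrow> 'b) \<Rightarrow> 'a tgroup \<Rightarrow> 'b tgroup" where
  "copytg e G = \<lparr>carrier = e ` carrier G,
     mult = (\<lambda>x y. e (inv_into (carrier G) e x \<otimes>\<^bsub>G\<^esub> inv_into (carrier G) e y)), one = e \<one>\<^bsub>G\<^esub>,
     tp = topology (\<lambda>S. S \<subseteq> e ` carrier G \<and> openin (tp G) {x \<in> carrier G. e x \<in> S})\<rparr>"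

lemma quot_hom_copytg:
  assumes "topgroup G" and e: "inj_on e (carrier G)"
  shows "quot_hom e G (copytg e G)"
proof -
  interpret topgroup G by fact
  let ?C = "copytg e G"
  have C: "carrier ?C = e ` carrier G" "one ?C = e \<one>\<^bsub>G\<^esub>" by (simp_all add: copytg_def)
  have m: "e x \<otimes>\<^bsub>?C\<^esub> e y = e (x \<otimes>\<^bsub>G\<^esub> y)" if "x \<in> carrier G" "y \<in> carrier G" for x y
    using that e by (simp add: copytg_def)
  have "istopology (\<lambda>S. S \<subseteq> e ` carrier G \<and> openin (tp G) {x \<in> carrier G. e x \<in> S})"
    unfolding istopology_def
  proof (intro conjI allI impI)
    fix S S' assume "S \<subseteq> e ` carrier G \<and> openin (tp G) {x \<in> carrier G. e x \<in> S}"
       "S' \<subseteq> e ` carrier G \<and> openin (tp G) {x \<in> carrier G. e x \<in> S'}"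
    moreover have "{x \<in> carrier G. e x \<in> S \<inter> S'} = {x \<in> carrier G. e x \<in> S} \<inter> {x \<in> carrier G. e x \<in> S'}" by auto
    ultimately show "openin (tp G) {x \<in> carrier G. e x \<in> S \<inter> S'}" by auto
  next
    fix K assume K: "\<forall>S\<in>K. S \<subseteq> e ` carrier G \<and> openin (tp G) {x \<in> carrier G. e x \<in> S}"
    have "{x \<in> carrier G. e x \<in> \<Union>K} = \<Union>((\<lambda>S. {x \<in> carrier G. e x \<in> S}) ` K)" by auto
    also have "openin (tp G) \<dots>" by (rule openin_Union) (use K in auto)
    finally show "openin (tp G) {x \<in> carrier G. e x \<in> \<Union>K}" .
  qed auto
  then have op: "openin (tp ?C) S \<longleftrightarrow> S \<subseteq> e ` carrier G \<and> openin (tp G) {x \<in> carrier G. e x \<in> S}" for S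
    by (simp add: copytg_def topology_inverse')
  have "{x \<in> carrier G. e x \<in> e ` carrier G} = carrier G" by auto
  then have "openin (tp ?C) (e ` carrier G)"
    using op openin_topspace[of "tp G"] by simp
  then have ts: "topspace (tp ?C) = carrier ?C"
    using op[of "topspace (tp ?C)"] openin_subset[of "tp ?C" "e ` carrier G"] C(1) openin_topspace[of "tp ?C"] by auto
  have pre: "{x \<in> carrier G. e x \<in> e ` W} = W" if "W \<subseteq> carrier G" for W
    using e that by (auto simp: inj_on_def)
  have "group ?C"
  proof (rule groupI)
    fix x assume "x \<in> carrier ?C"
    then obtain a where a: "a \<in> carrier G" "x = e a" using C by auto
    then show "\<exists>y\<in>carrier ?C. y \<otimes>\<^bsub>?C\<^esub> x = \<one>\<^bsub>?C\<^esub>"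
      using m[of "inv\<^bsub>G\<^esub> a" a] C by (auto intro!: bexI[of _ "e (inv\<^bsub>G\<^esub> a)"])
  qed (use C m in \<open>auto simp: m_assoc\<close>)
  then have g: "group ?C" .
  have h: "e \<in> hom G ?C" using C m by (auto simp: hom_def)
  have c: "continuous_map (tp G) (tp ?C) e"
    unfolding continuous_map using ts op C by simp
  have o: "open_map (tp G) (tp ?C) e"
    unfolding open_map_def
  proof (intro allI impI)
    fix U assume U: "openin (tp G) U"
    then have "U \<subseteq> carrier G" using openin_subset[OF U] by simp
    then show "openin (tp ?C) (e ` U)" using op pre U by (simp add: image_mono)
  qed
  have im: "e ` carrier G = carrier ?C" by (simp only: C)
  show ?thesis
    unfolding quot_hom_def
    by (intro conjI topgroup_axioms topgroup_image[OF topgroup_axioms g ts h im c o] h im c o)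
qed

text \<open>A point is coded by the set of numbers of the basic open sets that contain it; in a
  Hausdorff space distinct points have distinct codes.\<close>

lemma embedding_nat_set:
  assumes "second_countable T" "Hausdorff_space T"
  obtains e :: "'a \<Rightarrow> nat set" where "inj_on e (topspace (T :: 'a topology))"
proof -
  obtain B where B: "countable B" "\<And>V. V \<in> B \<Longrightarrow> openin T V"
    "\<And>U x. openin T U \<Longrightarrow> x \<in> U \<Longrightarrow> \<exists>V\<in>B. x \<in> V \<and> V \<subseteq> U"
    using assms(1) unfolding second_countable_def by metis
  define e where "e x = {n. n \<in> to_nat_on B ` {V \<in> B. x \<in> V}}" for x
  have "inj_on e (topspace T)"
  proof (rule inj_onI, rule ccontr)
    fix x y assume xy: "x \<in> topspace T" "y \<in> topspace T" "e x = e y" "x \<noteq> y"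
    then obtain U where U: "openin T U" "x \<in> U" "y \<notin> U"
      using assms(2) unfolding Hausdorff_space_def disjnt_iff by metis
    then obtain V where V: "V \<in> B" "x \<in> V" "V \<subseteq> U" using B(3) by blast
    then have "to_nat_on B V \<in> e y" using xy(3) by (auto simp: e_def)
    then obtain W where W: "W \<in> B" "y \<in> W" "to_nat_on B V = to_nat_on B W" by (auto simp: e_def)
    then have "V = W" using V(1) B(1) by (metis inj_on_eq_iff inj_on_to_nat_on)
    then show False using W V U by blast
  qed
  then show ?thesis using that by blast
qed

lemma tdlcsc_copy:
  assumes "tdlcsc (G :: 'a tgroup)"
  obtains e and K :: "nat set tgroup" where "quot_hom e G K" "inj_on e (carrier G)" "tdlcsc K"
proof -
  interpret topgroup G using assms by (rule tdlcsc_topgroup)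
  obtain e :: "'a \<Rightarrow> nat set" where e: "inj_on e (carrier G)"
    using embedding_nat_set[of "tp G"] assms by (auto simp: tdlcsc_def)
  have "quot_hom e G (copytg e G)" using quot_hom_copytg[OF topgroup_axioms e] .
  then show ?thesis using that e tdlcsc_iso[OF _ e assms] by blast
qed

text \<open>\<open>elementary\<close> asks only for some isomorphic member of
  \<open>elem_univ\<close>. An isomorphism is a quotient map with trivial, hence profinite, kernel,
  so \<open>elem_univ_extension\<close> carries membership over to \<open>K\<close> itself.\<close>

lemma elementary_imp_elem_univ:
  fixes K :: "nat set tgroup"
  assumes "elementary K" and K: "tdlcsc K" shows "elem_univ K"
proof -
  interpret topgroup K using K by (rule tdlcsc_topgroup)
  obtain H :: "nat set tgroup" where H: "elem_univ H" "tg_iso K H" using assms(1) unfolding elementary_def by blast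
  obtain f where f: "quot_hom f K H" "inj_on f (carrier K)"
    using tg_iso_imp_quot_hom[OF H(2) tdlcsc_topgroup[OF K] tdlcsc_topgroup[OF elem_univ_tdlcsc[OF H(1)]]] by blast
  have k: "kernel K H f = {\<one>\<^bsub>K\<^esub>}" using quot_hom_inj_iff[OF f(1)] f(2) by simp
  have "tdlcsc (subtg K {\<one>\<^bsub>K\<^esub>})"
    using tdlcsc_subtg[OF K kernel_subgroup[OF f(1)] kernel_closed[OF f(1)]] elem_univ_tdlcsc[OF H(1)] k by (simp add: tdlcsc_def)
  then have "profinite (subtg K {\<one>\<^bsub>K\<^esub>})"
    by (simp add: profinite_def compact_space_subtopology finite_imp_compactin)
  then show ?thesis using elem_univ_extension[OF H(1) K f(1)] k elem_univ.base_profinite by simp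
qed

lemma elem_univ_imp_elementary:
  assumes "quot_hom e G K" "inj_on e (carrier G)" "elem_univ K" shows "elementary G"
  using assms quot_hom_imp_tg_iso unfolding elementary_def by blast

lemma elementary_iso:
  assumes "elementary G" "tdlcsc G" "quot_hom f G Q" "inj_on f (carrier G)" shows "elementary Q"
proof -
  obtain H :: "nat set tgroup" where H: "elem_univ H" "tg_iso G H" using assms(1) unfolding elementary_def by blast
  obtain g where g: "quot_hom g G H" "inj_on g (carrier G)"
    using tg_iso_imp_quot_hom[OF H(2) tdlcsc_topgroup[OF assms(2)] tdlcsc_topgroup[OF elem_univ_tdlcsc[OF H(1)]]] by blast
  obtain h where h: "quot_hom h Q G" "inj_on h (carrier Q)"
    using quot_hom_inverse[OF assms(3,4)] by metis
  have "inj_on (\<lambda>x. g (h x)) (carrier Q)"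
    using h g(2) quot_homD(8)[OF h(1)] by (auto simp: inj_on_def)
  then show ?thesis using elem_univ_imp_elementary quot_hom_comp[OF h(1) g(1)] H(1) by blast
qed

lemma profinite_elementary: assumes "profinite G" shows "elementary G"
proof -
  obtain e and K :: "nat set tgroup" where e: "quot_hom e G K" "inj_on e (carrier G)" "tdlcsc K"
    using tdlcsc_copy assms unfolding profinite_def by metis
  then have "profinite K" using profinite_image assms by blast
  then show ?thesis using elem_univ_imp_elementary[OF e(1,2)] elem_univ.base_profinite by blast
qed

lemma discrete_elementary: assumes "discrete_tg G" shows "elementary G"
proof -
  obtain e and K :: "nat set tgroup" where e: "quot_hom e G K" "inj_on e (carrier G)" "tdlcsc K"
    using tdlcsc_copy assms unfolding discrete_tg_def by metis
  then have "discrete_tg K" using discrete_image assms by blast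
  then show ?thesis using elem_univ_imp_elementary[OF e(1,2)] elem_univ.base_discrete by blast
qed

lemma quot_hom_restrict_sub:
  assumes f: "quot_hom f G Q" and inj: "inj_on f (carrier G)" and S: "subgroup S G"
  shows "subgroup (f ` S) Q" "quot_hom f (subtg G S) (subtg Q (f ` S))"
proof -
  show *: "subgroup (f ` S) Q" using group_hom.subgroup_img_is_subgroup[OF quot_homD(5)[OF f] S] .
  have "{x \<in> carrier G. f x \<in> f ` S} = S"
    using inj subgroup.subset[OF S] by (auto simp: inj_on_def)
  then show "quot_hom f (subtg G S) (subtg Q (f ` S))" using quot_hom_restrict[OF f *] by simp
qed

theorem elementary_extension:
  assumes G: "tdlcsc G" and f: "quot_hom f G Q" and k: "elementary (subtg G (kernel G Q f))" and Q: "elementary Q" "tdlcsc Q"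
  shows "elementary G"
proof -
  obtain e and K :: "nat set tgroup" where e: "quot_hom e G K" "inj_on e (carrier G)" "tdlcsc K"
    using tdlcsc_copy[OF G] by metis
  obtain h where h: "quot_hom h K G" "\<And>x. x \<in> carrier G \<Longrightarrow> h (e x) = x" "inj_on h (carrier K)"
    using quot_hom_inverse[OF e(1,2)] by metis
  obtain d and P :: "nat set tgroup" where d: "quot_hom d Q P" "inj_on d (carrier Q)" "tdlcsc P"
    using tdlcsc_copy[OF Q(2)] by metis
  have P: "elem_univ P" using elementary_imp_elem_univ elementary_iso[OF Q d(1,2)] d(3) by blast
  \<comment> \<open>\<open>h\<close> inverts the copy map \<open>e\<close>, so \<open>?g\<close> is
    \<open>f\<close> read between the two copies, and its kernel is the \<open>e\<close>-image of
    the kernel of \<open>f\<close>.\<close>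
  let ?g = "\<lambda>x. d (f (h x))"
  have g: "quot_hom ?g K P" using quot_hom_comp[OF h(1) quot_hom_comp[OF f d(1)]] .
  have dk: "kernel Q P d = {\<one>\<^bsub>Q\<^esub>}" using quot_hom_inj_iff[OF d(1)] d(2) by simp
  have "kernel K P ?g = e ` kernel G Q f"
  proof
    show "kernel K P ?g \<subseteq> e ` kernel G Q f"
    proof
      fix y assume y: "y \<in> kernel K P ?g"
      then have "y \<in> e ` carrier G" using quot_homD(4)[OF e(1)] by (simp add: kernel_def)
      then obtain x where x: "x \<in> carrier G" "y = e x" by blast
      have "f x \<in> kernel Q P d" using x y h(2) quot_homD(8)[OF f] by (simp add: kernel_def)
      then have "f x = \<one>\<^bsub>Q\<^esub>" using dk by blast
      then show "y \<in> e ` kernel G Q f" using x by (simp add: kernel_def)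
    qed
    show "e ` kernel G Q f \<subseteq> kernel K P ?g"
      using h(2) quot_homD(8)[OF e(1)] quot_homD(10)[OF d(1)] by (auto simp: kernel_def)
  qed
  moreover note r = quot_hom_restrict_sub[OF e(1,2) kernel_subgroup[OF f]]
  have tk: "tdlcsc (subtg G (kernel G Q f))"
    using tdlcsc_subtg[OF G kernel_subgroup[OF f] kernel_closed[OF f]] Q(2) by (simp add: tdlcsc_def)
  have inj: "inj_on e (carrier (subtg G (kernel G Q f)))" using e(2) by (auto simp: kernel_def inj_on_def)
  have "elem_univ (subtg K (e ` kernel G Q f))"
    by (rule elementary_imp_elem_univ[OF elementary_iso[OF k tk r(2) inj] tdlcsc_iso[OF r(2) inj tk]])
  ultimately have "elem_univ K" using elem_univ_extension[OF P e(3) g] by simp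
  then show ?thesis using elem_univ_imp_elementary[OF e(1,2)] by blast
qed

lemma elementary_union:
  assumes G: "tdlcsc G" and Os: "\<And>i::nat. open_subgroup (Os i) G" "\<And>i. elementary (subtg G (Os i))"
    "\<And>i. Os i \<subseteq> Os (Suc i)" "carrier G = (\<Union>i. Os i)"
  shows "elementary G"
proof -
  interpret G: topgroup G using G by (rule tdlcsc_topgroup)
  obtain e and K :: "nat set tgroup" where e: "quot_hom e G K" "inj_on e (carrier G)" "tdlcsc K"
    using tdlcsc_copy[OF G] by metis
  have "elem_univ K"
  proof (rule elem_univ.union[OF e(3)])
    fix i
    note r = quot_hom_restrict_sub[OF e(1,2) G.osubD(1)[OF Os(1)[of i]]]
    show "open_subgroup (e ` Os i) K"
      using r(1) quot_homD(7)[OF e(1)] Os(1)[of i] by (simp add: open_subgroup_def open_map_def)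
    have t: "tdlcsc (subtg G (Os i))" using tdlcsc_subtg[OF G G.osubD(1)[OF Os(1)] G.osub_closed[OF Os(1)]] .
    have inj: "inj_on e (carrier (subtg G (Os i)))" using e(2) G.osubD(3)[OF Os(1)[of i]] by (auto intro: inj_on_subset)
    show "elem_univ (subtg K (e ` Os i))"
      by (rule elementary_imp_elem_univ[OF elementary_iso[OF Os(2) t r(2) inj] tdlcsc_iso[OF r(2) inj t]])
    show "e ` Os i \<subseteq> e ` Os (Suc i)" using Os(3)[of i] by blast
  next
    show "carrier K = (\<Union>i. e ` Os i)" using Os(4) quot_homD(4)[OF e(1)] image_UN[of e Os UNIV] by simp
  qed
  then show ?thesis using elem_univ_imp_elementary[OF e(1,2)] by blast
qed

section \<open>The quasi-center\<close>

text \<open>Unions of cosets of an open kernel are open, so every subset of \<open>Q\<close> is.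
  Countability is what second countability means for a discrete space.\<close>

lemma discrete_if_kernel_open:
  assumes f: "quot_hom f G Q" and G: "tdlcsc G" and k: "openin (tp G) (kernel G Q f)"
  shows "discrete_tg Q"
proof -
  interpret G: topgroup G by (rule quot_homD[OF f])
  interpret Q: topgroup Q by (rule quot_homD[OF f])
  have ok: "open_subgroup (kernel G Q f) G" using k kernel_subgroup[OF f] by (simp add: open_subgroup_def)
  have "openin (tp Q) S" if "S \<subseteq> carrier Q" for S
  proof -
    have "openin (tp G) {x \<in> carrier G. f x \<in> S}"
      by (rule G.open_if_coset_stable[OF ok]) (use quot_homD(9)[OF f] quot_homD(8)[OF f] in \<open>auto simp: kernel_def\<close>)
    moreover have "S = f ` {x \<in> carrier G. f x \<in> S}" using that quot_homD(4)[OF f] by auto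
    ultimately show ?thesis using quot_homD(7)[OF f] unfolding open_map_def by metis
  qed
  then have d: "tp Q = discrete_topology (carrier Q)"
    unfolding topology_eq using openin_subset[of "tp Q"] by auto
  have Q: "tdlcsc Q" by (rule quot_hom_tdlcsc[OF f G G.osub_closed[OF ok]])
  then have "countable (carrier Q)"
    using second_countable_discrete_topology[of "carrier Q"] by (simp add: tdlcsc_def d)
  then show ?thesis using Q d by (simp add: discrete_tg_def)
qed

text \<open>Such a group is profinite by discrete.\<close>

lemma elementary_if_compact_open_normal:
  assumes G: "tdlcsc G" and M: "M \<lhd> G" "openin (tp G) M" "compactin (tp G) M"
  shows "elementary G"
proof -
  interpret G: topgroup G using G by (rule tdlcsc_topgroup)
  have M': "open_subgroup M G" using M normal_imp_subgroup by (auto simp: open_subgroup_def)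
  note q = quot_hom_quottg[OF G.topgroup_axioms M(1)]
  have d: "discrete_tg (quottg G M)" using discrete_if_kernel_open[OF q(1) G] q(2) M by simp
  have "profinite (subtg G M)"
    using tdlcsc_subtg[OF G G.osubD(1)[OF M'] G.osub_closed[OF M']] M(3) by (simp add: profinite_def compact_space_subtopology)
  then have "elementary (subtg G M)" by (rule profinite_elementary)
  then show ?thesis
    using elementary_extension[OF G q(1)] q(2) discrete_elementary[OF d] d by (simp add: discrete_tg_def)
qed

context tdgroup begin

text \<open>The cosets \<open>x V\<close> form a neighbourhood base at \<open>x\<close>, so points
  of the closure can be tested on open subgroups, which suits algebraic manipulation.\<close>

lemma in_closure_iff:
  assumes "S \<subseteq> carrier G"
  shows "x \<in> tp G closure_of S \<longleftrightarrow> x \<in> carrier G \<and> (\<forall>V. open_subgroup V G \<longrightarrow> (\<exists>v\<in>V. x \<otimes> v \<in> S))"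
proof (cases "x \<in> carrier G")
  case x: True
  have "(\<forall>T. x \<in> T \<and> openin (tp G) T \<longrightarrow> (\<exists>y\<in>S. y \<in> T)) \<longleftrightarrow> (\<forall>V. open_subgroup V G \<longrightarrow> (\<exists>v\<in>V. x \<otimes> v \<in> S))"
  proof safe
    fix V assume *: "\<forall>T. x \<in> T \<and> openin (tp G) T \<longrightarrow> (\<exists>y\<in>S. y \<in> T)" and V: "open_subgroup V G"
    have "openin (tp G) {y \<in> carrier G. inv x \<otimes> y \<in> V}"
      by (rule open_preimage[OF _ osubD(2)[OF V]], intro cintros) (use x in auto)
    then obtain y where y: "y \<in> S" "y \<in> carrier G" "inv x \<otimes> y \<in> V"
      using *[rule_format, of "{y \<in> carrier G. inv x \<otimes> y \<in> V}"] x osubD(4)[OF V] by auto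
    then show "\<exists>v\<in>V. x \<otimes> v \<in> S" using x by (intro bexI[of _ "inv x \<otimes> y"]) simp_all
  next
    fix T assume *: "\<forall>V. open_subgroup V G \<longrightarrow> (\<exists>v\<in>V. x \<otimes> v \<in> S)" and T: "x \<in> T" "openin (tp G) T"
    have "openin (tp G) {y \<in> carrier G. x \<otimes> y \<in> T}"
      by (rule open_preimage[OF _ T(2)], intro cintros) (use x in auto)
    then obtain V where V: "open_subgroup V G" "V \<subseteq> {y \<in> carrier G. x \<otimes> y \<in> T}"
      using base[of "{y \<in> carrier G. x \<otimes> y \<in> T}"] x T by auto
    then obtain v where "v \<in> V" "x \<otimes> v \<in> S" using * by blast
    then show "\<exists>y\<in>S. y \<in> T" using V(2) by blast
  qed
  then show ?thesis using x unfolding in_closure_of Bex_def by simp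
qed (simp add: in_closure_of)

lemma closure_subgroup:
  assumes S: "subgroup S G" shows "subgroup (tp G closure_of S) G"
proof -
  have Sc: "S \<subseteq> carrier G" using S by (rule subgroup.subset)
  note iff = in_closure_iff[OF Sc]
  show ?thesis
  proof (rule subgroupI)
    show "tp G closure_of S \<subseteq> carrier G" using closure_of_subset_topspace[of "tp G" S] by simp
    show "tp G closure_of S \<noteq> {}" using closure_of_subset[of S "tp G"] Sc subgroup.one_closed[OF S] by auto
  next
    fix x assume x: "x \<in> tp G closure_of S"
    then have xc: "x \<in> carrier G" using iff by blast
    have "\<exists>v\<in>V. inv x \<otimes> v \<in> S" if V: "open_subgroup V G" for V
    proof -
      \<comment> \<open>The inverse of \<open>x v\<close> is \<open>inv x\<close> times the inverse
        of \<open>x v inv x\<close>; so it is the \<open>x\<close>-conjugate of \<open>v\<close>,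
        not \<open>v\<close>, that must lie in \<open>V\<close>. Products below are treated the same
        way.\<close>
      obtain v where v: "v \<in> carrier G" "x \<otimes> v \<otimes> inv x \<in> V" "x \<otimes> v \<in> S"
        using x osub_conj[OF V xc] iff by blast
      have "inv (x \<otimes> v) \<in> S" using subgroup.m_inv_closed[OF S v(3)] .
      then have "inv x \<otimes> inv (x \<otimes> v \<otimes> inv x) \<in> S" using xc v(1) by (simp add: word_simps)
      then show ?thesis using osubD(6)[OF V v(2)] by blast
    qed
    then show "inv x \<in> tp G closure_of S" using xc iff by simp
  next
    fix x y assume x: "x \<in> tp G closure_of S" and y: "y \<in> tp G closure_of S"
    then have c: "x \<in> carrier G" "y \<in> carrier G" using iff by blast+
    have "\<exists>v\<in>V. x \<otimes> y \<otimes> v \<in> S" if V: "open_subgroup V G" for V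
    proof -
      obtain w where w: "w \<in> V" "y \<otimes> w \<in> S" using y V iff by blast
      have wc: "w \<in> carrier G" using w(1) osubD(7)[OF V] by blast
      have yw: "inv (y \<otimes> w) \<in> carrier G" using c wc by simp
      obtain v where v: "v \<in> carrier G" "inv (y \<otimes> w) \<otimes> v \<otimes> inv (inv (y \<otimes> w)) \<in> V" "x \<otimes> v \<in> S"
        using x osub_conj[OF V yw] iff by blast
      have "(x \<otimes> v) \<otimes> (y \<otimes> w) \<in> S" using subgroup.m_closed[OF S v(3) w(2)] .
      moreover have "(x \<otimes> v) \<otimes> (y \<otimes> w) = x \<otimes> y \<otimes> (w \<otimes> (inv (y \<otimes> w) \<otimes> v \<otimes> inv (inv (y \<otimes> w))))"
        using c wc v(1) by (simp add: word_simps)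
      ultimately show ?thesis using osubD(5)[OF V w(1) v(2)] by auto
    qed
    then show "x \<otimes> y \<in> tp G closure_of S" using c iff by simp
  qed
qed

lemma closure_normal:
  assumes S: "S \<lhd> G" shows "closed_normal (tp G closure_of S) G"
proof -
  have S': "subgroup S G" using S by (rule normal_imp_subgroup)
  note iff = in_closure_iff[OF subgroup.subset[OF S']]
  have "g \<otimes> x \<otimes> inv g \<in> tp G closure_of S" if g: "g \<in> carrier G" and x: "x \<in> tp G closure_of S" for g x
  proof -
    have xc: "x \<in> carrier G" using x iff by blast
    have "\<exists>v\<in>V. g \<otimes> x \<otimes> inv g \<otimes> v \<in> S" if V: "open_subgroup V G" for V
    proof -
      obtain v where v: "v \<in> carrier G" "g \<otimes> v \<otimes> inv g \<in> V" "x \<otimes> v \<in> S"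
        using x osub_conj[OF V g] iff by blast
      have "g \<otimes> (x \<otimes> v) \<otimes> inv g \<in> S" using S v(3) g by (simp add: normal_iff)
      moreover have "g \<otimes> (x \<otimes> v) \<otimes> inv g = g \<otimes> x \<otimes> inv g \<otimes> (g \<otimes> v \<otimes> inv g)"
        using g xc v(1) by (simp add: word_simps)
      ultimately show ?thesis using v(2) by auto
    qed
    then show ?thesis using g xc iff by simp
  qed
  then show ?thesis using closure_subgroup[OF S'] by (simp add: closed_normal_def normal_iff)
qed

end

definition quasi_center :: "'a tgroup \<Rightarrow> 'a set" where
  "quasi_center G = {x \<in> carrier G. \<exists>V. open_subgroup V G \<and> (\<forall>v\<in>V. v \<otimes>\<^bsub>G\<^esub> x = x \<otimes>\<^bsub>G\<^esub> v)}"

lemma (in group) commute_mult: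
  "a \<in> carrier G \<Longrightarrow> x \<in> carrier G \<Longrightarrow> y \<in> carrier G \<Longrightarrow> a \<otimes> x = x \<otimes> a \<Longrightarrow> a \<otimes> y = y \<otimes> a \<Longrightarrow> a \<otimes> (x \<otimes> y) = (x \<otimes> y) \<otimes> a"
  by (metis m_assoc)

lemma (in group) commute_inv:
  assumes "a \<in> carrier G" "x \<in> carrier G" "a \<otimes> x = x \<otimes> a" shows "a \<otimes> inv x = inv x \<otimes> a"
proof -
  have "inv x \<otimes> (a \<otimes> x) \<otimes> inv x = inv x \<otimes> (x \<otimes> a) \<otimes> inv x" using assms by simp
  then show ?thesis using assms(1,2) by (simp add: m_assoc)
qed

lemma (in topgroup) quasi_center_normal: "quasi_center G \<lhd> G"
  unfolding normal_iff
proof (intro conjI ballI)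
  show "subgroup (quasi_center G) G"
  proof (rule subgroupI)
    show "quasi_center G \<noteq> {}" using osub_carrier by (auto simp: quasi_center_def intro!: exI[of _ "\<one>"])
  next
    fix x assume "x \<in> quasi_center G"
    then obtain V where V: "open_subgroup V G" "\<forall>v\<in>V. v \<otimes> x = x \<otimes> v" "x \<in> carrier G" by (auto simp: quasi_center_def)
    then have "\<forall>v\<in>V. v \<otimes> inv x = inv x \<otimes> v" using commute_inv osubD(7)[OF V(1)] by simp
    then show "inv x \<in> quasi_center G" using V by (auto simp: quasi_center_def)
  next
    fix x y assume "x \<in> quasi_center G" "y \<in> quasi_center G"
    then obtain V W where V: "open_subgroup V G" "\<forall>v\<in>V. v \<otimes> x = x \<otimes> v" "x \<in> carrier G"
      and W: "open_subgroup W G" "\<forall>v\<in>W. v \<otimes> y = y \<otimes> v" "y \<in> carrier G" by (auto simp: quasi_center_def)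
    then have "\<forall>v\<in>V \<inter> W. v \<otimes> (x \<otimes> y) = (x \<otimes> y) \<otimes> v" using commute_mult osubD(7)[OF V(1)] by simp
    then show "x \<otimes> y \<in> quasi_center G" using V W osub_Int[OF V(1) W(1)] unfolding quasi_center_def by blast
  qed (auto simp: quasi_center_def)
next
  fix g x assume g: "g \<in> carrier G" and "x \<in> quasi_center G"
  then obtain V where V: "open_subgroup V G" "\<forall>v\<in>V. v \<otimes> x = x \<otimes> v" "x \<in> carrier G" by (auto simp: quasi_center_def)
  have "v \<otimes> (g \<otimes> x \<otimes> inv g) = (g \<otimes> x \<otimes> inv g) \<otimes> v" if v: "v \<in> carrier G" "inv g \<otimes> v \<otimes> inv (inv g) \<in> V" for v
  proof -
    have "g \<otimes> ((inv g \<otimes> v \<otimes> inv (inv g)) \<otimes> x) \<otimes> inv g = g \<otimes> (x \<otimes> (inv g \<otimes> v \<otimes> inv (inv g))) \<otimes> inv g"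
      using V(2) v(2) by simp
    then show ?thesis using g v(1) V(3) by (simp add: word_simps)
  qed
  then show "g \<otimes> x \<otimes> inv g \<in> quasi_center G"
    using osub_conj[OF V(1), of "inv g"] g V(3) unfolding quasi_center_def by blast
qed

text \<open>If finitely many elements with open centralizers generate an open subgroup together with a
  compact open subgroup \<open>W\<close>, then a small enough open normal subgroup of \<open>W\<close> is normal in all of it.\<close>
lemma closure_quasi_center_elementary:
  fixes G (structure)
  assumes G: "tdlcsc G"
  shows "closed_normal (tp G closure_of quasi_center G) G"
    "elementary (subtg G (tp G closure_of quasi_center G))"
proof -
  interpret tdgroup G using G by (rule tdlcsc_tdgroup)
  let ?Q = "quasi_center G"
  define N where "N = tp G closure_of ?Q"
  have Qs: "subgroup ?Q G" using quasi_center_normal by (rule normal_imp_subgroup)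
  have Qc: "?Q \<subseteq> carrier G" using Qs by (rule subgroup.subset)
  show cn: "closed_normal (tp G closure_of ?Q) G" using closure_normal[OF quasi_center_normal] .
  have N: "subgroup N G" "closedin (tp G) N" using closed_normalD[OF cn] by (simp_all add: N_def)
  have Nc: "N \<subseteq> carrier G" using N(1) by (rule subgroup.subset)
  have QN: "?Q \<subseteq> N" unfolding N_def by (rule closure_of_subset) (use Qc in simp)
  let ?N = "subtg G N"
  have tN: "tdlcsc ?N" by (rule tdlcsc_subtg[OF G N])
  interpret N: tdgroup ?N using tN by (rule tdlcsc_tdgroup)
  obtain W0 where W0: "open_subgroup W0 G" "compactin (tp G) W0"
    using base[of "carrier G"] osubD(2)[OF osub_carrier] by auto
  define W where "W = N \<inter> W0"
  have W: "subgroup W G" "W \<subseteq> N" "W \<subseteq> W0" unfolding W_def using subgroups_Inter_pair[OF N(1) osubD(1)[OF W0(1)]] by auto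
  have sub_open: "open_subgroup (N \<inter> V) ?N" if "open_subgroup V G" for V
    using that N(1) subgroups_Inter_pair[OF N(1) osubD(1)[OF that]] subgroup_subtg_iff[OF N(1)]
    by (auto simp: open_subgroup_def openin_subtopology)
  \<comment> \<open>Second countability passes to the quasi-center and provides countably many
    quasi-central elements that are dense in it, hence in \<open>N\<close>.\<close>
  obtain C where C: "countable C" "C \<subseteq> ?Q" "?Q \<subseteq> tp G closure_of C"
  proof -
    have "second_countable (subtopology (tp G) ?Q)" using G by (simp add: tdlcsc_def second_countable_subtopology)
    then have "separable_space (subtopology (tp G) ?Q)" by (rule second_countable_imp_separable_space)
    then obtain C where C: "countable C" "C \<subseteq> topspace (subtopology (tp G) ?Q)"
      "subtopology (tp G) ?Q closure_of C = topspace (subtopology (tp G) ?Q)"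
      unfolding separable_space_def by blast
    have "?Q \<subseteq> tp G closure_of C"
      using C(3) Qc closure_of_subtopology_subset[of "tp G" ?Q C] by auto
    then show ?thesis using that C by auto
  qed
  have Cc: "C \<subseteq> carrier G" using C(2) Qc by blast
  have "N \<subseteq> tp G closure_of C" unfolding N_def
    using closure_of_mono[OF C(3), of "tp G"] by simp
  then have Ncov: "\<exists>w\<in>W0. x \<otimes> w \<in> C" if "x \<in> N" for x
    using that W0(1) in_closure_iff[OF Cc] by blast
  have Cne: "C \<noteq> {}" using Ncov subgroup.one_closed[OF N(1)] by blast
  define c where "c = from_nat_into C"
  have cC: "c n \<in> C" for n using from_nat_into[OF Cne] by (simp add: c_def)
  have cN: "c n \<in> N" for n using cC[of n] C(2) QN by blast
  have cr: "range c = C" unfolding c_def using range_from_nat_into[OF Cne C(1)] .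
  \<comment> \<open>Each stage contains \<open>W\<close>, so it is open in \<open>N\<close>; beyond
    \<open>W\<close> it has finitely many generators, so a single open subgroup centralizes them
    all.\<close>
  define Os where "Os n = generate G (W \<union> c ` {..n})" for n
  have genc: "W \<union> c ` {..n} \<subseteq> carrier G" for n using W Nc cC Cc by blast
  have Os: "subgroup (Os n) G" for n unfolding Os_def by (rule generate_is_subgroup[OF genc])
  have WOs: "W \<subseteq> Os n" "c ` {..n} \<subseteq> Os n" for n unfolding Os_def by (auto intro: generate.incl)
  have OsN: "Os n \<subseteq> N" for n
    unfolding Os_def by (rule generate_subgroup_incl[OF _ N(1)]) (use W cN in auto)
  have OsO: "open_subgroup (Os n) ?N" for n
  proof (rule N.osubI[OF _ sub_open[OF W0(1)]])
    show "subgroup (Os n) ?N" using Os OsN subgroup_subtg_iff[OF N(1)] by simp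
    show "N \<inter> W0 \<subseteq> Os n" using WOs(1)[of n] by (simp add: W_def)
  qed
  have "elementary ?N"
  proof (rule elementary_union[OF tN OsO])
    show "Os i \<subseteq> Os (Suc i)" for i unfolding Os_def by (rule mono_generate) auto
    show "carrier ?N = (\<Union>i. Os i)"
    proof
      show "(\<Union>i. Os i) \<subseteq> carrier ?N" using OsN by auto
      show "carrier ?N \<subseteq> (\<Union>i. Os i)"
      proof
        fix x assume "x \<in> carrier ?N"
        then have x: "x \<in> N" "x \<in> carrier G" using Nc by auto
        \<comment> \<open>Since \<open>x\<close> and \<open>x w\<close> both lie in
          \<open>N\<close>, so does \<open>w\<close>; thus \<open>w \<in> W\<close>, and
          \<open>x = (x w) inv w\<close> belongs to a stage.\<close>
        then obtain w where w: "w \<in> W0" "x \<otimes> w \<in> C" using Ncov by blast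
        then obtain n where n: "x \<otimes> w = c n" using cr by (metis imageE)
        have wc: "w \<in> carrier G" using w(1) osubD(7)[OF W0(1)] by blast
        have "w = inv x \<otimes> c n" using n x wc by (metis cancel_left(1))
        moreover have "c n \<in> N" using cC C(2) QN by blast
        ultimately have "w \<in> W" using w(1) subgroup.m_closed[OF N(1) subgroup.m_inv_closed[OF N(1) x(1)]] by (simp add: W_def)
        then have "w \<in> Os n" "c n \<in> Os n" using WOs[of n] by auto
        then have "c n \<otimes> inv w \<in> Os n"
          using subgroup.m_closed[OF Os] subgroup.m_inv_closed[OF Os] by simp
        moreover have "c n \<otimes> inv w = x" using n[symmetric] x wc by (simp add: m_assoc)
        ultimately show "x \<in> (\<Union>i. Os i)" by auto
      qed
    qed
    fix n
    have "\<exists>V. open_subgroup V G \<and> (\<forall>v\<in>V. \<forall>i\<le>n. v \<otimes> c i = c i \<otimes> v)"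
    proof (induction n)
      case 0
      have "c 0 \<in> ?Q" using cC C(2) by blast
      then show ?case by (auto simp: quasi_center_def)
    next
      case (Suc n)
      then obtain V where V: "open_subgroup V G" "\<forall>v\<in>V. \<forall>i\<le>n. v \<otimes> c i = c i \<otimes> v" by blast
      have "c (Suc n) \<in> ?Q" using cC C(2) by blast
      then obtain V' where V': "open_subgroup V' G" "\<forall>v\<in>V'. v \<otimes> c (Suc n) = c (Suc n) \<otimes> v" by (auto simp: quasi_center_def)
      show ?case using osub_Int[OF V(1) V'(1)] V(2) V'(2)
        by (intro exI[of _ "V \<inter> V'"]) (auto simp: le_Suc_eq)
    qed
    then obtain V where V: "open_subgroup V G" "\<And>v i. v \<in> V \<Longrightarrow> i \<le> n \<Longrightarrow> v \<otimes> c i = c i \<otimes> v" by blast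
    obtain M0 where M0: "open_subgroup M0 G" "M0 \<subseteq> V" "M0 \<subseteq> W0" "\<And>u x. u \<in> W0 \<Longrightarrow> x \<in> M0 \<Longrightarrow> u \<otimes> x \<otimes> inv u \<in> M0"
      using normal_core[OF W0 V(1)] by blast
    \<comment> \<open>\<open>W\<close> normalizes \<open>M\<close> because \<open>M0\<close> is
      normal in \<open>W0\<close> and \<open>N\<close> is a subgroup; the generators
      \<open>c i\<close> with \<open>i \<le> n\<close> centralize \<open>M\<close> because
      \<open>M0\<close> lies in \<open>V\<close>.\<close>
    define M where "M = N \<inter> M0"
    have M: "open_subgroup M ?N" unfolding M_def by (rule sub_open[OF M0(1)])
    have Ms: "subgroup M G" unfolding M_def by (rule subgroups_Inter_pair[OF N(1) osubD(1)[OF M0(1)]])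
    have MO: "M \<subseteq> Os n" using WOs(1)[of n] M0(3) by (auto simp: M_def W_def)
    have Mc: "M \<subseteq> carrier G" using Ms by (rule subgroup.subset)
    have conjW: "u \<otimes> x \<otimes> inv u \<in> M" if u: "u \<in> W" and x: "x \<in> M" for u x
    proof -
      have "u \<in> N" "x \<in> N" using u x W M_def by auto
      then have "u \<otimes> x \<otimes> inv u \<in> N" by (intro subgroup.m_closed[OF N(1)] subgroup.m_inv_closed[OF N(1)])
      then show ?thesis using M0(4)[of u x] u x W by (auto simp: M_def)
    qed
    have conjc: "c i \<otimes> x \<otimes> inv (c i) = x" "inv (c i) \<otimes> x \<otimes> c i = x" if "i \<le> n" "x \<in> M" for i x
    proof -
      have xc: "x \<in> carrier G" "c i \<in> carrier G" using that Mc cC Cc by auto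
      have e: "x \<otimes> c i = c i \<otimes> x" using V(2) that M0(2) by (auto simp: M_def)
      show "c i \<otimes> x \<otimes> inv (c i) = x" using xc e[symmetric] by (simp add: m_assoc)
      show "inv (c i) \<otimes> x \<otimes> c i = x" using xc e by (simp add: m_assoc)
    qed
    \<comment> \<open>The normalizer of \<open>M\<close>; asking for both conjugations makes closure
      under inverses immediate.\<close>
    define K where "K = {g \<in> carrier G. (\<forall>x\<in>M. g \<otimes> x \<otimes> inv g \<in> M) \<and> (\<forall>x\<in>M. inv g \<otimes> x \<otimes> g \<in> M)}"
    have "subgroup K G"
    proof (rule subgroupI)
      show "K \<noteq> {}" using Mc by (auto simp: K_def intro!: exI[of _ "\<one>"])
      fix g h assume gh: "g \<in> K" "h \<in> K"
      then have c: "g \<in> carrier G" "h \<in> carrier G" by (auto simp: K_def)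
      have "g \<otimes> h \<otimes> x \<otimes> inv (g \<otimes> h) \<in> M" "inv (g \<otimes> h) \<otimes> x \<otimes> (g \<otimes> h) \<in> M" if x: "x \<in> M" for x
      proof -
        have xc: "x \<in> carrier G" using x Mc by blast
        have "h \<otimes> x \<otimes> inv h \<in> M" "inv g \<otimes> x \<otimes> g \<in> M" using gh x by (auto simp: K_def)
        then have "g \<otimes> (h \<otimes> x \<otimes> inv h) \<otimes> inv g \<in> M" "inv h \<otimes> (inv g \<otimes> x \<otimes> g) \<otimes> h \<in> M" using gh by (auto simp: K_def)
        then show "g \<otimes> h \<otimes> x \<otimes> inv (g \<otimes> h) \<in> M" "inv (g \<otimes> h) \<otimes> x \<otimes> (g \<otimes> h) \<in> M"
          using c xc by (simp_all add: word_simps)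
      qed
      then show "g \<otimes> h \<in> K" using c by (simp add: K_def)
    qed (auto simp: K_def)
    moreover have "W \<union> c ` {..n} \<subseteq> K"
    proof
      fix g assume g: "g \<in> W \<union> c ` {..n}"
      then have gc: "g \<in> carrier G" using genc by blast
      show "g \<in> K"
      proof (cases "g \<in> W")
        case True
        have "inv g \<in> W" using subgroup.m_inv_closed[OF W(1) True] .
        then show ?thesis using conjW[OF True] conjW[of "inv g"] gc by (simp add: K_def)
      next
        case False
        then obtain i where i: "i \<le> n" "g = c i" using g by auto
        show ?thesis using conjc[OF i(1)] gc i(2) by (simp add: K_def)
      qed
    qed
    ultimately have "Os n \<subseteq> K" unfolding Os_def using generate_subgroup_incl by blast
    let ?O = "subtg G (Os n)"
    interpret O: topgroup ?O by (rule subtg_topgroup[OF Os])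
    have "M \<lhd> ?O"
      using Ms MO \<open>Os n \<subseteq> K\<close> subgroup_subtg_iff[OF Os] inv_subtg[OF Os] by (auto simp: O.normal_iff K_def)
    moreover have eO: "subtg ?N (Os n) = ?O" using OsN by (rule subtg_subtg)
    moreover have tO: "tdlcsc ?O" using tdlcsc_subtg[OF tN N.osubD(1)[OF OsO[of n]] N.osub_closed[OF OsO[of n]]] eO by simp
    moreover have "openin (tp ?O) M"
    proof -
      have "M = Os n \<inter> M0" using MO OsN M_def by auto
      then show ?thesis using osubD(2)[OF M0(1)] by (auto simp: openin_subtopology)
    qed
    moreover have "compactin (tp ?O) M"
    proof -
      have "closedin (tp G) M" unfolding M_def using N(2) osub_closed[OF M0(1)] by blast
      then have "compactin (tp G) M" using closed_compactin[OF W0(2), of M] M0(3) by (auto simp: M_def)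
      then show ?thesis using MO by (simp add: compactin_subtopology)
    qed
    ultimately show "elementary (subtg ?N (Os n))"
      using elementary_if_compact_open_normal by metis
  qed
  then show "elementary (subtg G (tp G closure_of ?Q))" by (simp add: N_def)
qed

section \<open>Torsion in nilpotent groups\<close>

context group begin

abbreviation comm :: "'a \<Rightarrow> 'a \<Rightarrow> 'a" where "comm x y \<equiv> x \<otimes> y \<otimes> inv x \<otimes> inv y"

lemma lower_central_subgroup: "subgroup (lower_central G n) G"
proof (induction n)
  case 0 then show ?case by (simp add: subgroup_self)
next
  case (Suc n)
  show ?case unfolding lower_central.simps
    by (rule generate_is_subgroup) (use subgroup.mem_carrier[OF Suc] in auto)
qed

lemma comm_lower_central: "x \<in> lower_central G n \<Longrightarrow> y \<in> carrier G \<Longrightarrow> comm x y \<in> lower_central G (Suc n)"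
  by (auto intro: generate.incl)

lemma lower_central_conj:
  "x \<in> lower_central G n \<Longrightarrow> g \<in> carrier G \<Longrightarrow> g \<otimes> x \<otimes> inv g \<in> lower_central G n"
  "lower_central G (Suc n) \<subseteq> lower_central G n"
proof -
  \<comment> \<open>The two claims are interlocked: normality of term \<open>Suc n\<close> uses that
    it lies in term \<open>n\<close>, and its containing the next term uses its normality.\<close>
  have *: "(\<forall>x\<in>lower_central G n. \<forall>g\<in>carrier G. g \<otimes> x \<otimes> inv g \<in> lower_central G n) \<and> lower_central G (Suc n) \<subseteq> lower_central G n"
  proof (induction n)
    case 0
    have "lower_central G (Suc 0) \<subseteq> carrier G" using subgroup.subset[OF lower_central_subgroup] .
    then show ?case by simp
  next
    case (Suc n)
    have 1: "g \<otimes> x \<otimes> inv g \<in> lower_central G (Suc n)" if x: "x \<in> lower_central G (Suc n)" and g: "g \<in> carrier G" for x g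
    proof -
      have xc: "x \<in> carrier G" using subgroup.mem_carrier[OF lower_central_subgroup x] .
      have "comm x g \<in> lower_central G (Suc n)" using comm_lower_central[of x n g] x g Suc by blast
      then have "inv (comm x g) \<otimes> x \<in> lower_central G (Suc n)"
        using subgroup.m_closed[OF lower_central_subgroup] subgroup.m_inv_closed[OF lower_central_subgroup] x by blast
      moreover have "inv (comm x g) \<otimes> x = g \<otimes> x \<otimes> inv g" using xc g by (simp add: word_simps)
      ultimately show ?thesis by (simp only:)
    qed
    have "lower_central G (Suc (Suc n)) \<subseteq> lower_central G (Suc n)"
      unfolding lower_central.simps(2)[of G "Suc n"]
    proof (rule generate_subgroup_incl[OF _ lower_central_subgroup], safe)
      fix x y assume x: "x \<in> lower_central G (Suc n)" and y: "y \<in> carrier G"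
      have xc: "x \<in> carrier G" using subgroup.mem_carrier[OF lower_central_subgroup x] .
      have "x \<otimes> (y \<otimes> inv x \<otimes> inv y) \<in> lower_central G (Suc n)"
        using subgroup.m_closed[OF lower_central_subgroup x] 1[OF subgroup.m_inv_closed[OF lower_central_subgroup x] y] by blast
      then show "comm x y \<in> lower_central G (Suc n)" using xc y by (simp add: m_assoc del: lower_central.simps)
    qed
    then show ?case using 1 by blast
  qed
  show "x \<in> lower_central G n \<Longrightarrow> g \<in> carrier G \<Longrightarrow> g \<otimes> x \<otimes> inv g \<in> lower_central G n"
    "lower_central G (Suc n) \<subseteq> lower_central G n" using * by blast+
qed

lemma lower_central_normal: "lower_central G n \<lhd> G"
  using lower_central_subgroup lower_central_conj(1) normal_inv_iff by blast

lemma comm_eq_one_iff: "x \<in> carrier G \<Longrightarrow> y \<in> carrier G \<Longrightarrow> comm x y = \<one> \<longleftrightarrow> x \<otimes> y = y \<otimes> x"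
proof
  assume c: "x \<in> carrier G" "y \<in> carrier G"
  { assume "comm x y = \<one>"
    then have "comm x y \<otimes> y \<otimes> x = y \<otimes> x" using c by simp
    then show "x \<otimes> y = y \<otimes> x" using c by (simp add: m_assoc) }
  { assume "x \<otimes> y = y \<otimes> x"
    then have "comm x y = y \<otimes> x \<otimes> inv x \<otimes> inv y" by simp
    then show "comm x y = \<one>" using c by (simp add: m_assoc) }
qed

lemma conj_pow:
  assumes "g \<in> carrier G" "x \<in> carrier G"
  shows "(g \<otimes> x \<otimes> inv g) [^] (n::nat) = g \<otimes> x [^] n \<otimes> inv g"
proof (induction n)
  case (Suc n) then show ?case using assms by (simp add: word_simps)
qed (use assms in simp)

lemma subgroup_pow: "subgroup V G \<Longrightarrow> x \<in> V \<Longrightarrow> x [^] (n::nat) \<in> V"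
  by (induction n) (simp_all add: subgroup.one_closed subgroup.m_closed)

text \<open>Bezout's identity in natural numbers, \<open>m * a = k * b + gcd m k\<close>, avoids
  negative exponents; it needs \<open>m\<close> nonzero.\<close>

lemma subgroup_pow_gcd:
  assumes V: "subgroup V G" and x: "x \<in> carrier G" and m: "x [^] (m::nat) \<in> V" and k: "x [^] (k::nat) \<in> V"
  shows "x [^] gcd m k \<in> V"
proof (cases "m = 0")
  case False
  then obtain a b where ab: "m * a = k * b + gcd m k" using bezout_nat by blast
  have 1: "x [^] (m * a) \<in> V" "x [^] (k * b) \<in> V"
    using subgroup_pow[OF V m, of a] subgroup_pow[OF V k, of b] x by (simp_all add: nat_pow_pow)
  have "x [^] (m * a) = x [^] (k * b) \<otimes> x [^] gcd m k" using x ab by (simp add: nat_pow_mult)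
  then have "x [^] gcd m k = inv (x [^] (k * b)) \<otimes> x [^] (m * a)" using x by simp
  then show ?thesis using subgroup.m_closed[OF V subgroup.m_inv_closed[OF V 1(2)] 1(1)] by simp
qed (use k in simp)

text \<open>Let \<open>z = comm x y\<close>. Then \<open>z y\<close> is a conjugate of
  \<open>y\<close>, and as \<open>z\<close> commutes with \<open>y\<close>, taking
  \<open>k\<close>-th powers gives \<open>z [^] k = \<one>\<close>. Likewise \<open>inv x z\<close>
  is a conjugate of \<open>inv x\<close>, which gives \<open>z [^] m = \<one>\<close>.\<close>

lemma comm_trivial_if_central:
  assumes x: "x \<in> carrier G" "x [^] (m::nat) = \<one>" and y: "y \<in> carrier G" "y [^] (k::nat) = \<one>"
    and mk: "coprime m k" and z: "comm x y \<otimes> x = x \<otimes> comm x y" "comm x y \<otimes> y = y \<otimes> comm x y"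
  shows "comm x y = \<one>"
proof -
  let ?z = "comm x y"
  have zc: "?z \<in> carrier G" using x y by simp
  have "?z [^] k = ?z [^] k \<otimes> y [^] k" using y zc by simp
  also have "\<dots> = (?z \<otimes> y) [^] k" using pow_mult_distrib[OF z(2) zc y(1)] by simp
  also have "?z \<otimes> y = x \<otimes> y \<otimes> inv x" using x y by (simp add: m_assoc)
  also have "\<dots> [^] k = \<one>" using conj_pow[OF x(1) y(1)] x y by simp
  finally have k: "?z [^] k = \<one>" .
  have "?z \<otimes> inv x = inv x \<otimes> ?z" using commute_inv[OF zc x(1) z(1)] .
  then have "(inv x \<otimes> ?z) [^] m = (inv x) [^] m \<otimes> ?z [^] m" using pow_mult_distrib[of "inv x" ?z m] x(1) zc by simp
  also have "\<dots> = ?z [^] m" using x zc by (simp add: nat_pow_inv)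
  also have "inv x \<otimes> ?z = y \<otimes> inv x \<otimes> inv y" using x y by (simp add: m_assoc)
  also have "\<dots> [^] m = \<one>" using conj_pow[OF y(1), of "inv x"] x y by (simp add: nat_pow_inv)
  finally have m: "?z [^] m = \<one>" by simp
  have "?z [^] gcd m k \<in> {\<one>}" by (rule subgroup_pow_gcd[OF triv_subgroup zc]) (use m k in auto)
  then show ?thesis using mk zc by simp
qed

text \<open>If \<open>comm x y\<close> lies in the \<open>n\<close>-th term of the lower central
  series, it is central modulo the next term, hence trivial there by
  \<open>comm_trivial_if_central\<close>. So it descends through the whole series.\<close>

lemma nilpotent_coprime_commute:
  assumes nil: "lower_central G c = {\<one>}"
    and x: "x \<in> carrier G" "x [^] (m::nat) = \<one>" and y: "y \<in> carrier G" "y [^] (k::nat) = \<one>"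
    and mk: "coprime m k"
  shows "x \<otimes> y = y \<otimes> x"
proof -
  have zc: "comm x y \<in> carrier G" using x y by simp
  have "comm x y \<in> lower_central G n" for n
  proof (induction n)
    case (Suc n)
    define L where "L = lower_central G (Suc n)"
    have L: "L \<lhd> G" unfolding L_def by (rule lower_central_normal)
    interpret L: normal L G by (rule L)
    define h where "h = (\<lambda>x. L #> x)"
    interpret Q: group "G Mod L" by (rule L.factorgroup_is_group)
    interpret h: group_hom G "G Mod L" h
      unfolding h_def by unfold_locales (use L.r_coset_hom_Mod in blast)
    have hL: "h a = \<one>\<^bsub>G Mod L\<^esub> \<longleftrightarrow> a \<in> L" if "a \<in> carrier G" for a
      unfolding h_def using coset_join1[OF _ that L.subgroup_axioms] coset_join2[OF that L.subgroup_axioms] by auto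
    have com: "Q.comm (h (comm x y)) (h w) = \<one>\<^bsub>G Mod L\<^esub>" if w: "w \<in> carrier G" for w
    proof -
      \<comment> \<open>This is centrality of the image of \<open>comm x y\<close> in the quotient
        by \<open>L\<close>.\<close>
      have "comm (comm x y) w \<in> L" unfolding L_def by (rule comm_lower_central[OF Suc w])
      then have "h (comm (comm x y) w) = \<one>\<^bsub>G Mod L\<^esub>"
        using hL[of "comm (comm x y) w"] subgroup.mem_carrier[OF L.subgroup_axioms] by blast
      then show ?thesis using zc w x y by (simp only: h.hom_mult h.hom_inv m_closed inv_closed)
    qed
    have e: "h (comm x y) = Q.comm (h x) (h y)" using x y by (simp only: h.hom_mult h.hom_inv m_closed inv_closed)
    have "Q.comm (h x) (h y) = \<one>\<^bsub>G Mod L\<^esub>"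
    proof (rule Q.comm_trivial_if_central[OF _ _ _ _ mk])
      show "h x [^]\<^bsub>G Mod L\<^esub> m = \<one>\<^bsub>G Mod L\<^esub>" "h y [^]\<^bsub>G Mod L\<^esub> k = \<one>\<^bsub>G Mod L\<^esub>"
        using h.hom_nat_pow[OF x(1), of m] h.hom_nat_pow[OF y(1), of k] x y h.hom_one by simp_all
      show "Q.comm (h x) (h y) \<otimes>\<^bsub>G Mod L\<^esub> h x = h x \<otimes>\<^bsub>G Mod L\<^esub> Q.comm (h x) (h y)"
        "Q.comm (h x) (h y) \<otimes>\<^bsub>G Mod L\<^esub> h y = h y \<otimes>\<^bsub>G Mod L\<^esub> Q.comm (h x) (h y)"
        using com[OF x(1)] com[OF y(1)] x y zc Q.comm_eq_one_iff[of "h (comm x y)"] unfolding e[symmetric]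
        by (metis h.hom_closed)+
    qed (use x y in auto)
    then have "comm x y \<in> L" using hL[OF zc] e by simp
    then show ?case by (simp only: L_def)
  qed (use x y in simp)
  then have "comm x y = \<one>" using nil by blast
  then show ?thesis using comm_eq_one_iff x y by simp
qed

text \<open>Every cyclic subgroup of a nilpotent group is subnormal, via the products with the terms of the
  lower central series; the radical generated by normal torsion subgroups grows along this chain.\<close>

definition normal_torsion :: "nat set \<Rightarrow> 'a set \<Rightarrow> 'a set \<Rightarrow> bool" where
  "normal_torsion S H T \<longleftrightarrow> subgroup T G \<and> T \<subseteq> H \<and> (\<forall>h\<in>H. \<forall>t\<in>T. h \<otimes> t \<otimes> inv h \<in> T)
     \<and> (\<forall>t\<in>T. \<exists>m\<in>S. t [^] m = \<one>)"

definition torsion_radical :: "nat set \<Rightarrow> 'a set \<Rightarrow> 'a set" where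
  "torsion_radical S H = \<Union>{T. normal_torsion S H T}"

context
  fixes S :: "nat set"
  assumes S1: "1 \<in> S" and Sm: "\<And>a b. a \<in> S \<Longrightarrow> b \<in> S \<Longrightarrow> a * b \<in> S"
begin

text \<open>Modulo \<open>T'\<close> the power \<open>(t t') [^] m\<close> agrees with
  \<open>t [^] m\<close>, so for a suitable \<open>m\<close> in \<open>S\<close> it falls into
  \<open>T'\<close>, where another exponent from \<open>S\<close> kills it; \<open>S\<close> is
  closed under products.\<close>

lemma normal_torsion_mult:
  assumes H: "subgroup H G" and T: "normal_torsion S H T" and T': "normal_torsion S H T'"
  shows "normal_torsion S H (T <#> T')"
proof -
  have Hc: "h \<in> carrier G" if "h \<in> H" for h using subgroup.mem_carrier[OF H that] .
  have s: "subgroup T G" "subgroup T' G" "T \<subseteq> H" "T' \<subseteq> H" using T T' by (simp_all add: normal_torsion_def)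
  have c: "t \<in> carrier G" if "t \<in> T \<or> t \<in> T'" for t using that s Hc by blast
  have swap: "t' \<otimes> t \<in> T <#> T'" if t: "t \<in> T" "t' \<in> T'" for t t'
  proof -
    have "t' \<otimes> t \<otimes> inv t' \<in> T" using T t s by (auto simp: normal_torsion_def)
    then have "(t' \<otimes> t \<otimes> inv t') \<otimes> t' \<in> T <#> T'" using t by (auto simp: set_mult_def)
    then show ?thesis using t c by (simp add: m_assoc)
  qed
  have "subgroup (T <#> T') G"
  proof (rule subgroupI)
    show "T <#> T' \<subseteq> carrier G" using c by (auto simp: set_mult_def)
    show "T <#> T' \<noteq> {}" using subgroup.one_closed[OF s(1)] subgroup.one_closed[OF s(2)] by (auto simp: set_mult_def)
    fix a assume "a \<in> T <#> T'"
    then obtain t t' where a: "a = t \<otimes> t'" "t \<in> T" "t' \<in> T'" by (auto simp: set_mult_def)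
    have "inv t' \<otimes> inv t \<in> T <#> T'" using swap subgroup.m_inv_closed[OF s(1) a(2)] subgroup.m_inv_closed[OF s(2) a(3)] by blast
    then show "inv a \<in> T <#> T'" using a c by (simp add: inv_mult_group)
    fix b assume "b \<in> T <#> T'"
    then obtain r r' where b: "b = r \<otimes> r'" "r \<in> T" "r' \<in> T'" by (auto simp: set_mult_def)
    obtain q q' where q: "t' \<otimes> r = q \<otimes> q'" "q \<in> T" "q' \<in> T'" using swap[OF b(2) a(3)] by (auto simp: set_mult_def)
    have "a \<otimes> b = t \<otimes> (t' \<otimes> r) \<otimes> r'" using a b c by (simp add: m_assoc)
    also have "\<dots> = (t \<otimes> q) \<otimes> (q' \<otimes> r')" unfolding q(1) using a b c q by (simp add: m_assoc)
    finally show "a \<otimes> b \<in> T <#> T'"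
      using subgroup.m_closed[OF s(1) a(2) q(2)] subgroup.m_closed[OF s(2) q(3) b(3)] by (auto simp: set_mult_def)
  qed
  moreover have "T <#> T' \<subseteq> H" using s subgroup.m_closed[OF H] by (auto simp: set_mult_def)
  moreover have "h \<otimes> a \<otimes> inv h \<in> T <#> T'" if h: "h \<in> H" and a: "a \<in> T <#> T'" for h a
  proof -
    obtain t t' where a: "a = t \<otimes> t'" "t \<in> T" "t' \<in> T'" using a by (auto simp: set_mult_def)
    have "h \<otimes> t \<otimes> inv h \<in> T" "h \<otimes> t' \<otimes> inv h \<in> T'"
      using T T' h a by (simp_all add: normal_torsion_def)
    then have "(h \<otimes> t \<otimes> inv h) \<otimes> (h \<otimes> t' \<otimes> inv h) \<in> T <#> T'"
      unfolding set_mult_def by blast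
    then show ?thesis using a c Hc[OF h] by (simp add: m_assoc)
  qed
  moreover have "\<exists>m\<in>S. a [^] m = \<one>" if a: "a \<in> T <#> T'" for a
  proof -
    obtain t t' where a: "a = t \<otimes> t'" "t \<in> T" "t' \<in> T'" using a by (auto simp: set_mult_def)
    obtain m where m: "m \<in> S" "t [^] m = \<one>" using T a by (auto simp: normal_torsion_def)
    \<comment> \<open>The factors \<open>t\<close> are collected on the left; moving one past the
      remainder \<open>r\<close> conjugates \<open>r\<close>, which stays in
      \<open>T'\<close>.\<close>
    have "\<exists>r\<in>T'. (t \<otimes> t') [^] n = t [^] n \<otimes> r" for n :: nat
    proof (induction n)
      case (Suc n)
      then obtain r where r: "r \<in> T'" "(t \<otimes> t') [^] n = t [^] n \<otimes> r" by blast
      have "inv t \<otimes> r \<otimes> inv (inv t) \<in> T'"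
        using T' r s a subgroup.m_inv_closed[OF s(1) a(2)] unfolding normal_torsion_def by blast
      then have "(inv t \<otimes> r \<otimes> t) \<otimes> t' \<in> T'" using subgroup.m_closed[OF s(2) _ a(3)] a c by simp
      moreover have "(t \<otimes> t') [^] Suc n = t [^] Suc n \<otimes> ((inv t \<otimes> r \<otimes> t) \<otimes> t')"
        using r a c by (simp add: m_assoc)
      ultimately show ?case by blast
    qed (use subgroup.one_closed[OF s(2)] in \<open>auto intro!: bexI[of _ \<one>]\<close>)
    then obtain r where r: "r \<in> T'" "a [^] m = t [^] m \<otimes> r" using a by blast
    then have ar: "a [^] m = r" using m c by simp
    obtain k where k: "k \<in> S" "r [^] k = \<one>" using T' r by (auto simp: normal_torsion_def)
    have "a [^] (m * k) = \<one>" using ar k a c by (metis m_closed nat_pow_pow)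
    then show ?thesis using Sm[OF m(1) k(1)] by blast
  qed
  ultimately show ?thesis by (simp add: normal_torsion_def)
qed

text \<open>The family of normal torsion subgroups is directed by
  \<open>normal_torsion_mult\<close>, so its union is a subgroup of the same kind.\<close>

lemma normal_torsion_radical:
  assumes H: "subgroup H G" shows "normal_torsion S H (torsion_radical S H)"
proof -
  have Hc: "H \<subseteq> carrier G" using H by (rule subgroup.subset)
  have triv: "normal_torsion S H {\<one>}"
    using subgroup.one_closed[OF H] triv_subgroup Hc S1 by (auto simp: normal_torsion_def intro!: bexI[of _ 1])
  have s: "subgroup T G" if "normal_torsion S H T" for T using that by (simp add: normal_torsion_def)
  have "subgroup (torsion_radical S H) G"
  proof (rule subgroupI)
    show "torsion_radical S H \<subseteq> carrier G" using s subgroup.subset by (fastforce simp: torsion_radical_def)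
    show "torsion_radical S H \<noteq> {}" using triv by (auto simp: torsion_radical_def)
    fix a assume "a \<in> torsion_radical S H"
    then obtain T where T: "a \<in> T" "normal_torsion S H T" by (auto simp: torsion_radical_def)
    then show "inv a \<in> torsion_radical S H" using subgroup.m_inv_closed[OF s[OF T(2)] T(1)] by (auto simp: torsion_radical_def)
    fix b assume "b \<in> torsion_radical S H"
    then obtain T' where T': "b \<in> T'" "normal_torsion S H T'" by (auto simp: torsion_radical_def)
    have "a \<otimes> b \<in> T <#> T'" using T T' by (auto simp: set_mult_def)
    then show "a \<otimes> b \<in> torsion_radical S H" using normal_torsion_mult[OF H T(2) T'(2)] by (auto simp: torsion_radical_def)
  qed
  then show ?thesis unfolding normal_torsion_def torsion_radical_def by blast
qed

text \<open>Conjugation by \<open>H\<close> permutes the normal torsion subgroups of the normal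
  subgroup \<open>K\<close>. So the radical of \<open>K\<close> is normal in \<open>H\<close>, and
  the radical of \<open>H\<close> contains it.\<close>

lemma torsion_radical_mono:
  assumes H: "subgroup H G" and K: "subgroup K G" "K \<subseteq> H" and n: "\<And>h k. h \<in> H \<Longrightarrow> k \<in> K \<Longrightarrow> h \<otimes> k \<otimes> inv h \<in> K"
  shows "torsion_radical S K \<subseteq> torsion_radical S H"
proof -
  note R = normal_torsion_radical[OF K(1)]
  have Hc: "h \<in> carrier G" if "h \<in> H" for h using subgroup.mem_carrier[OF H that] .
  have "h \<otimes> t \<otimes> inv h \<in> torsion_radical S K" if h: "h \<in> H" and t: "t \<in> torsion_radical S K" for h t
  proof -
    obtain T where T: "t \<in> T" "normal_torsion S K T" using t by (auto simp: torsion_radical_def)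
    have Ts: "subgroup T G" "T \<subseteq> K" using T by (simp_all add: normal_torsion_def)
    have Tc: "x \<in> carrier G" if "x \<in> T" for x using subgroup.mem_carrier[OF Ts(1) that] .
    let ?T = "(\<lambda>x. h \<otimes> x \<otimes> inv h) ` T"
    have "normal_torsion S K ?T"
      unfolding normal_torsion_def
    proof (intro conjI ballI)
      show "subgroup ?T G"
      proof (rule subgroupI)
        show "?T \<subseteq> carrier G" using Tc Hc[OF h] by auto
        show "?T \<noteq> {}" using T by auto
        fix a assume "a \<in> ?T"
        then obtain x where x: "x \<in> T" "a = h \<otimes> x \<otimes> inv h" by auto
        then have "inv a = h \<otimes> inv x \<otimes> inv h" using Tc Hc[OF h] by (simp add: word_simps)
        then show "inv a \<in> ?T" using subgroup.m_inv_closed[OF Ts(1) x(1)] by blast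
        fix b assume "b \<in> ?T"
        then obtain y where y: "y \<in> T" "b = h \<otimes> y \<otimes> inv h" by auto
        then have "a \<otimes> b = h \<otimes> (x \<otimes> y) \<otimes> inv h" using x Tc Hc[OF h] by (simp add: word_simps)
        then show "a \<otimes> b \<in> ?T" using subgroup.m_closed[OF Ts(1) x(1) y(1)] by blast
      qed
      show "?T \<subseteq> K" using n[OF h] Ts(2) by auto
      fix a assume "a \<in> ?T"
      then obtain x where x: "x \<in> T" "a = h \<otimes> x \<otimes> inv h" by auto
      show "\<exists>m\<in>S. a [^] m = \<one>"
      proof -
        obtain m where "m \<in> S" "x [^] m = \<one>" using T x by (auto simp: normal_torsion_def)
        then show ?thesis using x conj_pow[OF Hc[OF h] Tc[OF x(1)], of m] Hc[OF h] by auto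
      qed
    next
      fix k a assume k: "k \<in> K" and "a \<in> ?T"
      then obtain x where x: "x \<in> T" "a = h \<otimes> x \<otimes> inv h" by auto
      have kc: "k \<in> carrier G" using k K Hc by blast
      have ih: "inv h \<in> H" using subgroup.m_inv_closed[OF H h] .
      have k': "inv h \<otimes> k \<otimes> inv (inv h) \<in> K" using n[OF ih k] .
      then have "(inv h \<otimes> k \<otimes> inv (inv h)) \<otimes> x \<otimes> inv (inv h \<otimes> k \<otimes> inv (inv h)) \<in> T"
        using T(2) x(1) unfolding normal_torsion_def by blast
      then have "h \<otimes> ((inv h \<otimes> k \<otimes> inv (inv h)) \<otimes> x \<otimes> inv (inv h \<otimes> k \<otimes> inv (inv h))) \<otimes> inv h \<in> ?T" by blast
      then show "k \<otimes> a \<otimes> inv k \<in> ?T" using x kc Hc[OF h] Tc[OF x(1)] by (simp add: word_simps)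
    qed
    then show ?thesis using T(1) unfolding torsion_radical_def by blast
  qed
  then have "normal_torsion S H (torsion_radical S K)"
    using R K(2) by (auto simp: normal_torsion_def)
  then show ?thesis by (auto simp: torsion_radical_def)
qed

lemma nilpotent_torsion_in_radical:
  assumes nil: "lower_central G c = {\<one>}" and x: "x \<in> carrier G" "m \<in> S" "x [^] m = \<one>"
  shows "x \<in> torsion_radical S (carrier G)"
proof -
  let ?C = "generate G {x}"
  have C: "subgroup ?C G" by (rule generate_is_subgroup) (use x in simp)
  have xC: "x \<in> ?C" by (rule generate.incl) simp
  have Cc: "a \<in> carrier G" if "a \<in> ?C" for a using subgroup.mem_carrier[OF C that] .
  have comC: "a \<otimes> b = b \<otimes> a" if "a \<in> ?C" "b \<in> ?C" for a b
  proof -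
    obtain i j :: int where "a = x [^] i" "b = x [^] j" using \<open>a \<in> ?C\<close> \<open>b \<in> ?C\<close> x(1) by (auto simp: generate_pow)
    then show ?thesis using int_pow_mult[OF x(1), of i j] int_pow_mult[OF x(1), of j i] by (simp add: add.commute)
  qed
  have tors: "a [^] m = \<one>" if "a \<in> ?C" for a
    using that
  proof (induction rule: generate.induct)
    case (eng a b)
    then show ?case using pow_mult_distrib[of a b m] comC[of a b] Cc by simp
  qed (use x in \<open>auto simp: nat_pow_inv\<close>)
  define H where "H k = lower_central G k <#> ?C" for k
  have H: "subgroup (H k) G" for k unfolding H_def by (rule mult_norm_subgroup[OF lower_central_normal C])
  have Lc: "a \<in> carrier G" if "a \<in> lower_central G k" for a k using subgroup.mem_carrier[OF lower_central_subgroup that] .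
  have Hsub: "H (Suc k) \<subseteq> H k" for k
    unfolding H_def set_mult_def using lower_central_conj(2)[of k] by blast
  have norm: "h \<otimes> a \<otimes> inv h \<in> H (Suc k)" if hk: "h \<in> H k" and ak: "a \<in> H (Suc k)" for h a k
  proof -
    obtain z r where h: "h = z \<otimes> r" "z \<in> lower_central G k" "r \<in> ?C" using hk by (auto simp: H_def set_mult_def)
    obtain w b where a: "a = w \<otimes> b" "w \<in> lower_central G (Suc k)" "b \<in> ?C"
      using ak unfolding H_def set_mult_def by blast
    have c: "z \<in> carrier G" "r \<in> carrier G" "w \<in> carrier G" "b \<in> carrier G" using h a Lc Cc by blast+
    then have hc: "h \<in> carrier G" using h by simp
    have rb: "r \<otimes> b \<otimes> inv r = b" using comC[OF h(3) a(3)] c by (simp add: m_assoc)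
    \<comment> \<open>\<open>r\<close> and \<open>b\<close> lie in the abelian group
      \<open>?C\<close>, so conjugating \<open>b\<close> by \<open>h = z r\<close> costs only the
      commutator of \<open>z\<close> and \<open>b\<close>, which lies one step further down the
      series.\<close>
    have "h \<otimes> a \<otimes> inv h = (h \<otimes> w \<otimes> inv h) \<otimes> (z \<otimes> (r \<otimes> b \<otimes> inv r) \<otimes> inv z)" using h(1) a(1) c by (simp add: word_simps)
    also have "\<dots> = ((h \<otimes> w \<otimes> inv h) \<otimes> comm z b) \<otimes> b" unfolding rb using c hc by (simp add: m_assoc)
    finally have e: "h \<otimes> a \<otimes> inv h = ((h \<otimes> w \<otimes> inv h) \<otimes> comm z b) \<otimes> b" .
    have "(h \<otimes> w \<otimes> inv h) \<otimes> comm z b \<in> lower_central G (Suc k)"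
      using subgroup.m_closed[OF lower_central_subgroup lower_central_conj(1)[OF a(2) hc] comm_lower_central[OF h(2) c(4)]] .
    then show ?thesis unfolding e H_def set_mult_def using a(3) by blast
  qed
  have Hcx: "H c = ?C" unfolding H_def nil using Cc by (auto simp: set_mult_def)
  have "normal_torsion S (H c) (H c)"
    unfolding Hcx normal_torsion_def
    using C tors x(2) subgroup.m_closed[OF C] subgroup.m_inv_closed[OF C] by blast
  then have base: "x \<in> torsion_radical S (H c)" using xC Hcx by (auto simp: torsion_radical_def)
  have "k \<le> c \<Longrightarrow> x \<in> torsion_radical S (H (c - k))" for k
  proof (induction k)
    case (Suc k)
    then have e: "Suc (c - Suc k) = c - k" by simp
    show ?case using Suc torsion_radical_mono[OF H H Hsub norm, of "c - Suc k"] unfolding e by (meson Suc_leD subsetD)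
  qed (use base in simp)
  from this[of c] have "x \<in> torsion_radical S (H 0)" by simp
  moreover have "H 0 = carrier G" unfolding H_def using Cc subgroup.one_closed[OF C] by (force simp: set_mult_def)
  ultimately show ?thesis by simp
qed

lemma nilpotent_torsion_mult:
  assumes nil: "lower_central G c = {\<one>}" and x: "x \<in> carrier G" "m \<in> S" "x [^] m = \<one>"
    and y: "y \<in> carrier G" "k \<in> S" "y [^] k = \<one>"
  shows "\<exists>n\<in>S. (x \<otimes> y) [^] n = \<one>"
proof -
  have R: "normal_torsion S (carrier G) (torsion_radical S (carrier G))"
    by (rule normal_torsion_radical[OF subgroup_self])
  then have "subgroup (torsion_radical S (carrier G)) G" by (simp add: normal_torsion_def)
  then have "x \<otimes> y \<in> torsion_radical S (carrier G)"
    using nilpotent_torsion_in_radical[OF nil x] nilpotent_torsion_in_radical[OF nil y] by (rule subgroup.m_closed)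
  then show ?thesis using R by (simp add: normal_torsion_def)
qed

end

end

lemma (in group_hom) lower_central_image:
  assumes "h ` carrier G = carrier H"
  shows "lower_central H n = h ` lower_central G n"
proof (induction n)
  case (Suc n)
  let ?A = "{x \<otimes> y \<otimes> inv x \<otimes> inv y |x y. x \<in> lower_central G n \<and> y \<in> carrier G}"
  have Lc: "x \<in> carrier G" if "x \<in> lower_central G n" for x
    using subgroup.mem_carrier[OF G.lower_central_subgroup that] .
  have *: "{x \<otimes>\<^bsub>H\<^esub> y \<otimes>\<^bsub>H\<^esub> inv\<^bsub>H\<^esub> x \<otimes>\<^bsub>H\<^esub> inv\<^bsub>H\<^esub> y |x y. x \<in> lower_central H n \<and> y \<in> carrier H} = h ` ?A"
  proof safe
    fix x y assume "x \<in> lower_central H n" "y \<in> carrier H"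
    then have "x \<in> h ` lower_central G n" "y \<in> h ` carrier G" using Suc assms by simp_all
    then obtain a b where ab: "a \<in> lower_central G n" "x = h a" "b \<in> carrier G" "y = h b"
      by (elim imageE) simp
    then have "x \<otimes>\<^bsub>H\<^esub> y \<otimes>\<^bsub>H\<^esub> inv\<^bsub>H\<^esub> x \<otimes>\<^bsub>H\<^esub> inv\<^bsub>H\<^esub> y = h (a \<otimes> b \<otimes> inv a \<otimes> inv b)"
      using Lc by simp
    then show "x \<otimes>\<^bsub>H\<^esub> y \<otimes>\<^bsub>H\<^esub> inv\<^bsub>H\<^esub> x \<otimes>\<^bsub>H\<^esub> inv\<^bsub>H\<^esub> y \<in> h ` ?A" using ab by blast
  next
    fix a b assume ab: "a \<in> lower_central G n" "b \<in> carrier G"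
    then have "h (a \<otimes> b \<otimes> inv a \<otimes> inv b) = h a \<otimes>\<^bsub>H\<^esub> h b \<otimes>\<^bsub>H\<^esub> inv\<^bsub>H\<^esub> h a \<otimes>\<^bsub>H\<^esub> inv\<^bsub>H\<^esub> h b"
      using Lc by simp
    then show "\<exists>x y. h (a \<otimes> b \<otimes> inv a \<otimes> inv b) = x \<otimes>\<^bsub>H\<^esub> y \<otimes>\<^bsub>H\<^esub> inv\<^bsub>H\<^esub> x \<otimes>\<^bsub>H\<^esub> inv\<^bsub>H\<^esub> y \<and> x \<in> lower_central H n \<and> y \<in> carrier H"
      using ab Suc by (intro exI[of _ "h a"] exI[of _ "h b"]) simp
  qed
  have "?A \<subseteq> carrier G" using Lc by auto
  then show ?case unfolding lower_central.simps * by (rule generate_img)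
qed (use assms in simp)

section \<open>Sylow decomposition of pro-nilpotent groups\<close>

text \<open>The finite intersection property for a downward directed family: a single member bounds
  each finite intersection. It assembles compatible choices modulo all open normal subgroups into
  one element.\<close>

lemma compact_directed:
  assumes C: "compactin T C" and I: "I \<noteq> {}"
    and K: "\<And>i. i \<in> I \<Longrightarrow> closedin T (K i)" "\<And>i. i \<in> I \<Longrightarrow> C \<inter> K i \<noteq> {}"
    and dir: "\<And>i j. i \<in> I \<Longrightarrow> j \<in> I \<Longrightarrow> \<exists>k\<in>I. K k \<subseteq> K i \<inter> K j"
  shows "\<exists>x\<in>C. \<forall>i\<in>I. x \<in> K i"
proof -
  have fin: "\<exists>k\<in>I. K k \<subseteq> \<Inter>F" if "finite F" "F \<subseteq> K ` I" for F
    using that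
  proof (induction F rule: finite_induct)
    case empty then show ?case using I by auto
  next
    case (insert A F)
    then obtain k where k: "k \<in> I" "K k \<subseteq> \<Inter>F" by auto
    obtain j where j: "j \<in> I" "A = K j" using insert.prems by auto
    obtain l where "l \<in> I" "K l \<subseteq> K k \<inter> K j" using dir[OF k(1) j(1)] by blast
    then show ?case using k j by (intro bexI[of _ l]) auto
  qed
  have fip: "\<forall>F. finite F \<and> F \<subseteq> K ` I \<longrightarrow> C \<inter> \<Inter>F \<noteq> {}"
  proof (intro allI impI)
    fix F assume "finite F \<and> F \<subseteq> K ` I"
    then obtain k where "k \<in> I" "K k \<subseteq> \<Inter>F" using fin[of F] by blast
    then show "C \<inter> \<Inter>F \<noteq> {}" using K(2)[of k] by blast
  qed
  have "\<forall>D\<in>K ` I. closedin T D" using K(1) by blast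
  then have "C \<inter> \<Inter>(K ` I) \<noteq> {}" using C fip unfolding compactin_fip by blast
  then show ?thesis by blast
qed

context topgroup begin

text \<open>With \<open>S\<close> the powers of \<open>p\<close> these are the \<open>x\<close> with \<open>x [^] (p ^ n) \<longlonglongrightarrow> \<one>\<close>, with \<open>S\<close> the numbers prime to \<open>p\<close>
  the elements that are \<open>p'\<close>-elements modulo each open normal subgroup of a compact open subgroup. The
  definition is invariant under conjugation in the whole group, so Sylow subgroups are commensurated.\<close>

definition tor :: "nat set \<Rightarrow> 'a set" where
  "tor S = {x \<in> carrier G. \<forall>V. open_subgroup V G \<longrightarrow> (\<exists>m\<in>S. x [^] m \<in> V)}"

lemma tor_mono: "S \<subseteq> S' \<Longrightarrow> tor S \<subseteq> tor S'"
  unfolding tor_def by blast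

lemma tor_conj:
  assumes g: "g \<in> carrier G" and x: "x \<in> tor S"
  shows "g \<otimes> x \<otimes> inv g \<in> tor S"
proof -
  have xc: "x \<in> carrier G" using x by (simp add: tor_def)
  have "\<exists>m\<in>S. (g \<otimes> x \<otimes> inv g) [^] m \<in> V" if V: "open_subgroup V G" for V
  proof -
    obtain m where "m \<in> S" "x [^] m \<in> {y \<in> carrier G. g \<otimes> y \<otimes> inv g \<in> V}"
      using x osub_conj[OF V g] unfolding tor_def by blast
    then show ?thesis using conj_pow[OF g xc, of m] by (intro bexI[of _ m]) auto
  qed
  then show ?thesis using g xc by (simp add: tor_def)
qed

lemma tor_inv:
  assumes x: "x \<in> tor S" shows "inv x \<in> tor S"
proof -
  have xc: "x \<in> carrier G" using x by (simp add: tor_def)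
  have "\<exists>m\<in>S. inv x [^] m \<in> V" if V: "open_subgroup V G" for V
  proof -
    obtain m where "m \<in> S" "x [^] m \<in> V" using x V unfolding tor_def by blast
    then show ?thesis using nat_pow_inv[OF xc, of m] osubD(6)[OF V] by (intro bexI[of _ m]) auto
  qed
  then show ?thesis using xc by (simp add: tor_def)
qed

lemma tor_one: "S \<noteq> {} \<Longrightarrow> \<one> \<in> tor S"
  using osubD(4) by (auto simp: tor_def)

end

text \<open>For prime \<open>p\<close> neither set of exponents contains zero, which would make
  every element torsion.\<close>

abbreviation "pows p \<equiv> range (\<lambda>k. (p::nat) ^ k)"
abbreviation "cops p \<equiv> {m::nat. coprime m p}"

locale pronil_group = tdgroup +
  fixes U
  assumes U: "open_subgroup U G" "compactin (tp G) U" "pro_nilpotent (subtg G U)"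
begin

text \<open>The open normal subgroups of \<open>U\<close>. They index its finite quotients and, by
  \<open>nrm_base\<close>, are cofinal among the open subgroups of the ambient group.\<close>

definition nrm :: "'a set \<Rightarrow> bool" where
  "nrm N \<longleftrightarrow> open_subgroup N G \<and> N \<subseteq> U \<and> (\<forall>u\<in>U. \<forall>x\<in>N. u \<otimes> x \<otimes> inv u \<in> N)"

lemma nrmD: assumes "nrm N" shows "open_subgroup N G" "N \<subseteq> U" "\<And>u x. u \<in> U \<Longrightarrow> x \<in> N \<Longrightarrow> u \<otimes> x \<otimes> inv u \<in> N"
  using assms by (auto simp: nrm_def)

lemma nrm_base: "open_subgroup V G \<Longrightarrow> \<exists>N. nrm N \<and> N \<subseteq> V"
  using normal_core[OF U(1,2), of V] unfolding nrm_def by blast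

lemma nrm_Int: "nrm N \<Longrightarrow> nrm N' \<Longrightarrow> nrm (N \<inter> N')"
  using osub_Int unfolding nrm_def by blast

lemma nrm_U: "nrm U"
proof -
  have "u \<otimes> x \<otimes> inv u \<in> U" if "u \<in> U" "x \<in> U" for u x
    using osubD(5)[OF U(1)] osubD(6)[OF U(1)] that by blast
  then show ?thesis using U(1) unfolding nrm_def by blast
qed

lemma U_carrier: "x \<in> U \<Longrightarrow> x \<in> carrier G" using osubD(7)[OF U(1)] by blast

text \<open>Presents \<open>U/N\<close> as an abstract group with a homomorphism, so that later
  arguments need no cosets. It is finite because it is both compact and discrete.\<close>

lemma nrm_quotient:
  assumes "nrm N"
  obtains Q :: "'a set monoid" and h where "group_hom (subtg G U) Q h" "\<And>x. x \<in> U \<Longrightarrow> h x = \<one>\<^bsub>Q\<^esub> \<longleftrightarrow> x \<in> N"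
    "\<exists>c. lower_central Q c = {\<one>\<^bsub>Q\<^esub>}" "finite (carrier Q)"
proof -
  note N = nrmD[OF assms]
  let ?U = "subtg G U"
  interpret U: topgroup ?U by (rule subtg_topgroup[OF osubD(1)[OF U(1)]])
  have Nn: "N \<lhd> ?U"
    using N osubD(1)[OF N(1)] subgroup_subtg_iff[OF osubD(1)[OF U(1)]] inv_subtg[OF osubD(1)[OF U(1)]] by (simp add: U.normal_iff)
  interpret N: normal N ?U by (rule Nn)
  let ?Q = "?U Mod N"
  interpret Q: group ?Q by (rule N.factorgroup_is_group)
  have h: "group_hom ?U ?Q (\<lambda>x. N #>\<^bsub>?U\<^esub> x)"
    by unfold_locales (use N.r_coset_hom_Mod in blast)
  have Nop: "openin (tp ?U) N" using osubD(2)[OF N(1)] N(2) by (auto simp: openin_subtopology)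
  have nil: "nilpotent ?Q" using U(3) Nn Nop by (simp add: pro_nilpotent_def del: subtg_simps)
  have tU: "tdlcsc ?U" "compact_space (tp ?U)" using U(3) by (simp_all add: pro_nilpotent_def profinite_def)
  note q = quot_hom_quottg[OF U.topgroup_axioms Nn]
  have d: "discrete_tg (quottg ?U N)" using discrete_if_kernel_open[OF q(1) tU(1)] q(2) Nop by simp
  have "profinite (quottg ?U N)"
    by (rule profinite_image[OF q(1)]) (use tU d in \<open>simp_all add: profinite_def discrete_tg_def\<close>)
  then have "finite (carrier (quottg ?U N))"
    using d by (simp add: profinite_def discrete_tg_def compact_space_discrete_topology)
  then have fin: "finite (carrier ?Q)" by (simp add: FactGroup_def)
  have "N #>\<^bsub>?U\<^esub> x = \<one>\<^bsub>?Q\<^esub> \<longleftrightarrow> x \<in> N" if "x \<in> U" for x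
    using U.coset_join1[OF _ _ N.subgroup_axioms, of x] U.coset_join2[OF _ N.subgroup_axioms, of x] that by auto
  then show ?thesis using that[OF h] nil fin by (simp add: nilpotent_def)
qed

lemma nrm_pow_mult:
  fixes S :: "nat set"
  assumes N: "nrm N" and S: "1 \<in> S" "\<And>a b. a \<in> S \<Longrightarrow> b \<in> S \<Longrightarrow> a * b \<in> S"
    and x: "x \<in> U" "m \<in> S" "x [^] m \<in> N" and y: "y \<in> U" "k \<in> S" "y [^] k \<in> N"
  shows "\<exists>n\<in>S. (x \<otimes> y) [^] n \<in> N"
proof -
  obtain Q :: "'a set monoid" and h where h: "group_hom (subtg G U) Q h" "\<And>x. x \<in> U \<Longrightarrow> h x = \<one>\<^bsub>Q\<^esub> \<longleftrightarrow> x \<in> N"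
    and c: "\<exists>c. lower_central Q c = {\<one>\<^bsub>Q\<^esub>}" using nrm_quotient[OF N] by metis
  interpret h: group_hom "subtg G U" Q h by (rule h(1))
  have pw: "h (a [^] n) = h a [^]\<^bsub>Q\<^esub> n" if "a \<in> U" for a and n :: nat using h.hom_nat_pow[of a n] that by (simp add: pow_subtg)
  have pU: "a [^] (n::nat) \<in> U" if "a \<in> U" for a n using subgroup_pow[OF osubD(1)[OF U(1)] that] .
  obtain c where c: "lower_central Q c = {\<one>\<^bsub>Q\<^esub>}" using c by blast
  have xy: "x \<otimes> y \<in> U" using osubD(5)[OF U(1) x(1) y(1)] .
  have "\<exists>n\<in>S. (h x \<otimes>\<^bsub>Q\<^esub> h y) [^]\<^bsub>Q\<^esub> n = \<one>\<^bsub>Q\<^esub>"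
    by (rule h.H.nilpotent_torsion_mult[OF S c _ x(2) _ _ y(2)])
       (use x y h.hom_closed h(2)[OF pU[OF x(1)]] h(2)[OF pU[OF y(1)]] pw in auto)
  then obtain n where n: "n \<in> S" "h (x \<otimes> y) [^]\<^bsub>Q\<^esub> n = \<one>\<^bsub>Q\<^esub>" using h.hom_mult[of x y] x y by auto
  then have "h ((x \<otimes> y) [^] n) = \<one>\<^bsub>Q\<^esub>" using pw[OF xy] by simp
  then show ?thesis using h(2)[OF pU[OF xy]] n(1) by blast
qed

lemma nrm_comm:
  assumes N: "nrm N" and x: "x \<in> U" "x [^] (m::nat) \<in> N" and y: "y \<in> U" "y [^] (k::nat) \<in> N" and mk: "coprime m k"
  shows "comm x y \<in> N"
proof -
  obtain Q :: "'a set monoid" and h where h: "group_hom (subtg G U) Q h" "\<And>x. x \<in> U \<Longrightarrow> h x = \<one>\<^bsub>Q\<^esub> \<longleftrightarrow> x \<in> N"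
    and c: "\<exists>c. lower_central Q c = {\<one>\<^bsub>Q\<^esub>}" using nrm_quotient[OF N] by metis
  interpret h: group_hom "subtg G U" Q h by (rule h(1))
  have pw: "h (a [^] n) = h a [^]\<^bsub>Q\<^esub> n" if "a \<in> U" for a and n :: nat using h.hom_nat_pow[of a n] that by (simp add: pow_subtg)
  have pU: "a [^] (n::nat) \<in> U" if "a \<in> U" for a n using subgroup_pow[OF osubD(1)[OF U(1)] that] .
  obtain c where c: "lower_central Q c = {\<one>\<^bsub>Q\<^esub>}" using c by blast
  have hc: "h x \<in> carrier Q" "h y \<in> carrier Q" using x y h.hom_closed by auto
  have "h x \<otimes>\<^bsub>Q\<^esub> h y = h y \<otimes>\<^bsub>Q\<^esub> h x"
    by (rule h.H.nilpotent_coprime_commute[OF c hc(1) _ hc(2) _ mk])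
       (use x y h(2)[OF pU[OF x(1)]] h(2)[OF pU[OF y(1)]] pw in auto)
  then have "h.H.comm (h x) (h y) = \<one>\<^bsub>Q\<^esub>" using h.H.comm_eq_one_iff[OF hc] by simp
  moreover have "h (comm x y) = h.H.comm (h x) (h y)"
    using x(1) y(1) h.hom_mult h.hom_inv osubD(5,6)[OF U(1)] inv_subtg[OF osubD(1)[OF U(1)]] by simp
  moreover have "comm x y \<in> U" using x(1) y(1) osubD(5,6)[OF U(1)] by simp
  ultimately show ?thesis using h(2) by simp
qed

lemma nrm_exponent:
  assumes N: "nrm N" shows "\<exists>r>0. \<forall>x\<in>U. x [^] (r::nat) \<in> N"
proof -
  obtain Q :: "'a set monoid" and h where h: "group_hom (subtg G U) Q h" "\<And>x. x \<in> U \<Longrightarrow> h x = \<one>\<^bsub>Q\<^esub> \<longleftrightarrow> x \<in> N"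
    and fin: "finite (carrier Q)" using nrm_quotient[OF N] by metis
  interpret h: group_hom "subtg G U" Q h by (rule h(1))
  have pU: "a [^] (n::nat) \<in> U" if "a \<in> U" for a n using subgroup_pow[OF osubD(1)[OF U(1)] that] .
  have "x [^] order Q \<in> N" if x: "x \<in> U" for x
  proof -
    have "h (x [^] order Q) = h x [^]\<^bsub>Q\<^esub> order Q" using h.hom_nat_pow[of x "order Q"] x by (simp add: pow_subtg)
    also have "\<dots> = \<one>\<^bsub>Q\<^esub>" using h.H.pow_order_eq_1[of "h x"] h.hom_closed[of x] x by simp
    finally show ?thesis using h(2)[OF pU[OF x]] by blast
  qed
  moreover have "order Q > 0" using fin h.H.order_gt_0_iff_finite by blast
  ultimately show ?thesis by blast
qed

text \<open>Whether \<open>x [^] m\<close> lies in \<open>N\<close> depends only on the coset of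
  \<open>x\<close>. The sets cut out by such conditions are therefore closed, as the compactness
  arguments require.\<close>

lemma nrm_pow_cong:
  assumes N: "nrm N" and x: "x \<in> U" "n \<in> N" "x [^] (m::nat) \<in> N"
  shows "(x \<otimes> n) [^] m \<in> N" "(n \<otimes> x) [^] m \<in> N"
proof -
  obtain Q :: "'a set monoid" and h where h: "group_hom (subtg G U) Q h" "\<And>x. x \<in> U \<Longrightarrow> h x = \<one>\<^bsub>Q\<^esub> \<longleftrightarrow> x \<in> N"
    using nrm_quotient[OF N] by metis
  interpret h: group_hom "subtg G U" Q h by (rule h(1))
  have pw: "h (a [^] n) = h a [^]\<^bsub>Q\<^esub> n" if "a \<in> U" for a and n :: nat using h.hom_nat_pow[of a n] that by (simp add: pow_subtg)
  have pU: "a [^] (n::nat) \<in> U" if "a \<in> U" for a n using subgroup_pow[OF osubD(1)[OF U(1)] that] .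
  have nU: "n \<in> U" using nrmD(2)[OF N] x by blast
  have xn: "x \<otimes> n \<in> U" "n \<otimes> x \<in> U" using osubD(5)[OF U(1)] x(1) nU by blast+
  have "h (x \<otimes> n) = h x" "h (n \<otimes> x) = h x" using h.hom_mult[of x n] h.hom_mult[of n x] h(2)[OF nU] x nU h.hom_closed[of x] by simp_all
  then have "h ((x \<otimes> n) [^] m) = \<one>\<^bsub>Q\<^esub>" "h ((n \<otimes> x) [^] m) = \<one>\<^bsub>Q\<^esub>"
    using pw[OF xn(1)] pw[OF xn(2)] pw[OF x(1)] h(2)[OF pU[OF x(1)]] x(3) by simp_all
  then show "(x \<otimes> n) [^] m \<in> N" "(n \<otimes> x) [^] m \<in> N" using h(2)[OF pU[OF xn(1)]] h(2)[OF pU[OF xn(2)]] by blast+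
qed

section \<open>Torsion parts of the pro-nilpotent subgroup\<close>

lemma tor_U_iff: "x \<in> U \<Longrightarrow> x \<in> tor S \<longleftrightarrow> (\<forall>N. nrm N \<longrightarrow> (\<exists>m\<in>S. x [^] m \<in> N))"
proof
  assume x: "x \<in> U"
  show "\<forall>N. nrm N \<longrightarrow> (\<exists>m\<in>S. x [^] m \<in> N)" if "x \<in> tor S" using that nrmD(1) unfolding tor_def by blast
  assume *: "\<forall>N. nrm N \<longrightarrow> (\<exists>m\<in>S. x [^] m \<in> N)"
  have "\<exists>m\<in>S. x [^] m \<in> V" if "open_subgroup V G" for V
    using nrm_base[OF that] * by blast
  then show "x \<in> tor S" using U_carrier[OF x] by (simp add: tor_def)
qed

lemma tor_subgroup:
  assumes S: "1 \<in> S" "\<And>a b. a \<in> S \<Longrightarrow> b \<in> S \<Longrightarrow> a * b \<in> S"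
  shows "subgroup (U \<inter> tor S) G"
proof (rule subgroupI)
  show "U \<inter> tor S \<subseteq> carrier G" using U_carrier by blast
  show "U \<inter> tor S \<noteq> {}" using tor_one S(1) osubD(4)[OF U(1)] by blast
  fix x assume x: "x \<in> U \<inter> tor S"
  then show "inv x \<in> U \<inter> tor S" using tor_inv osubD(6)[OF U(1)] by blast
  fix y assume y: "y \<in> U \<inter> tor S"
  have xy: "x \<otimes> y \<in> U" using osubD(5)[OF U(1)] x y by blast
  have "\<exists>n\<in>S. (x \<otimes> y) [^] n \<in> N" if N: "nrm N" for N
  proof -
    obtain m k where "m \<in> S" "x [^] m \<in> N" "k \<in> S" "y [^] k \<in> N"
      using x y tor_U_iff N by (metis IntE)
    then show ?thesis using nrm_pow_mult[OF N S] x y by blast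
  qed
  then show "x \<otimes> y \<in> U \<inter> tor S" using xy tor_U_iff by blast
qed

lemma nrm_tor_closed:
  assumes N: "nrm N"
  shows "closedin (tp G) {x \<in> U. \<exists>m\<in>S. x [^] (m::nat) \<in> N}"
proof (rule closed_if_coset_stable[OF nrmD(1)[OF N]])
  fix s v assume s: "s \<in> {x \<in> U. \<exists>m\<in>S. x [^] m \<in> N}" and v: "v \<in> N"
  have "s \<otimes> v \<in> U" using osubD(5)[OF U(1)] s v nrmD(2)[OF N] by blast
  then show "s \<otimes> v \<in> {x \<in> U. \<exists>m\<in>S. x [^] m \<in> N}" using nrm_pow_cong(1)[OF N _ v] s by blast
qed (use U_carrier in blast)

lemma tor_closed: "closedin (tp G) (U \<inter> tor S)"
proof -
  have "U \<inter> tor S = (\<Inter>N\<in>Collect nrm. {x \<in> U. \<exists>m\<in>S. x [^] m \<in> N})"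
    using tor_U_iff nrm_U by auto
  moreover have "closedin (tp G) (\<Inter>N\<in>Collect nrm. {x \<in> U. \<exists>m\<in>S. x [^] m \<in> N})"
    by (rule closedin_Inter) (use nrm_tor_closed nrm_U in auto)
  ultimately show ?thesis by simp
qed

text \<open>The commutator dies in every finite nilpotent quotient of \<open>U\<close> by
  \<open>nrm_comm\<close>, so it lies in every open subgroup and is trivial.\<close>

lemma tor_commute:
  assumes co: "\<And>m k. m \<in> S \<Longrightarrow> k \<in> S' \<Longrightarrow> coprime m k"
    and x: "x \<in> U" "x \<in> tor S" and y: "y \<in> U" "y \<in> tor S'"
  shows "x \<otimes> y = y \<otimes> x"
proof -
  have c: "x \<in> carrier G" "y \<in> carrier G" using x y U_carrier by auto
  have "comm x y \<in> V" if V: "open_subgroup V G" for V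
  proof -
    obtain N where N: "nrm N" "N \<subseteq> V" using nrm_base[OF V] by blast
    obtain m k where "m \<in> S" "x [^] m \<in> N" "k \<in> S'" "y [^] k \<in> N"
      using x y tor_U_iff N(1) by metis
    then show ?thesis using nrm_comm[OF N(1) x(1) _ y(1)] co N(2) by blast
  qed
  then have "comm x y = \<one>" using separate[of "comm x y"] c by (metis inv_closed m_closed)
  then show ?thesis using comm_eq_one_iff c by simp
qed

text \<open>Modulo one open normal subgroup, suitable powers of \<open>u\<close> already give the
  two parts, and powers of \<open>u\<close> stay in \<open>R\<close>. Compactness of
  \<open>U\<close> then yields one \<open>a\<close> that works modulo all of them.\<close>

lemma tor_decomposition:
  assumes p: "Factorial_Ring.prime (p::nat)" and R: "subgroup R G" "closedin (tp G) R" and u: "u \<in> R" "u \<in> U"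
  obtains a b where "a \<in> R" "a \<in> U" "a \<in> tor (pows p)" "b \<in> R" "b \<in> U" "b \<in> tor (cops p)" "u = a \<otimes> b"
proof -
  have uc: "u \<in> carrier G" using u U_carrier by blast
  \<comment> \<open>The candidates for the \<open>p\<close>-part of \<open>u\<close> modulo
    \<open>N\<close>; the complementary part is forced to be \<open>inv a u\<close>.\<close>
  define K where "K N = R \<inter> ({a \<in> U. \<exists>m\<in>pows p. a [^] m \<in> N} \<inter> {a \<in> U. \<exists>m\<in>cops p. (inv a \<otimes> u) [^] m \<in> N})" for N
  have "\<exists>a\<in>U. \<forall>N\<in>Collect nrm. a \<in> K N"
  proof (rule compact_directed[OF U(2)])
    show "Collect nrm \<noteq> {}" using nrm_U by blast
    show "closedin (tp G) (K N)" if "N \<in> Collect nrm" for N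
    proof -
      have N: "nrm N" using that by simp
      have "closedin (tp G) {a \<in> U. \<exists>m\<in>cops p. (inv a \<otimes> u) [^] m \<in> N}"
      proof (rule closed_if_coset_stable[OF nrmD(1)[OF N]])
        fix a v assume a: "a \<in> {a \<in> U. \<exists>m\<in>cops p. (inv a \<otimes> u) [^] m \<in> N}" and v: "v \<in> N"
        have av: "a \<otimes> v \<in> U" using osubD(5)[OF U(1)] a v nrmD(2)[OF N] by blast
        obtain m where m: "m \<in> cops p" "(inv a \<otimes> u) [^] m \<in> N" using a by blast
        have "inv a \<otimes> u \<in> U" using osubD(5,6)[OF U(1)] a u by blast
        from nrm_pow_cong(2)[OF N this osubD(6)[OF nrmD(1)[OF N] v] m(2)]
        have "(inv v \<otimes> (inv a \<otimes> u)) [^] m \<in> N" .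
        moreover have "inv v \<otimes> (inv a \<otimes> u) = inv (a \<otimes> v) \<otimes> u"
          using a v uc U_carrier osubD(7)[OF nrmD(1)[OF N]] by (simp add: word_simps)
        ultimately show "a \<otimes> v \<in> {a \<in> U. \<exists>m\<in>cops p. (inv a \<otimes> u) [^] m \<in> N}" using av m(1) by auto
      qed (use U_carrier in blast)
      then show ?thesis unfolding K_def using nrm_tor_closed[OF N] R(2) by blast
    qed
    show "U \<inter> K N \<noteq> {}" if "N \<in> Collect nrm" for N
    proof -
      have N: "nrm N" using that by simp
      obtain r where r: "r > 0" "\<And>x. x \<in> U \<Longrightarrow> x [^] (r::nat) \<in> N" using nrm_exponent[OF N] by blast
      define k where "k = multiplicity p r"
      define m where "m = r div p ^ k"
      have rm: "r = p ^ k * m" unfolding m_def k_def by (simp add: multiplicity_dvd)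
      have pm: "\<not> p dvd m" unfolding m_def k_def
        using multiplicity_decompose[of r p] r(1) p by (metis not_prime_unit not_gr_zero)
      have cm: "coprime m p" using pm p prime_imp_coprime coprime_commute by blast
      have "m \<noteq> 0" using rm r(1) by auto
      \<comment> \<open>With \<open>r = p ^ k * m\<close> an exponent of \<open>U\<close> modulo
        \<open>N\<close>, the power \<open>u [^] (m * i)\<close> is killed by \<open>p ^ k\<close>
        and \<open>u [^] (p ^ k * j)\<close> by \<open>m\<close>. These exponents differ by one, so
        \<open>u\<close> is the first power times the inverse of the second.\<close>
      then obtain i j where ij: "m * i = p ^ k * j + gcd m (p ^ k)" using bezout_nat by blast
      have "gcd m (p ^ k) = 1" using cm by simp
      then have ij: "m * i = p ^ k * j + 1" using ij by simp
      define a where "a = u [^] (m * i)"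
      define b where "b = u [^] (p ^ k * j)"
      have abU: "a \<in> U" "b \<in> U" "a \<in> R" unfolding a_def b_def using subgroup_pow[OF osubD(1)[OF U(1)] u(2)] subgroup_pow[OF R(1) u(1)] by auto
      have c: "a \<in> carrier G" "b \<in> carrier G" using abU U_carrier by auto
      have "a = b \<otimes> u" unfolding a_def b_def ij using uc by (simp add: nat_pow_mult[symmetric])
      then have "inv a \<otimes> u = inv u \<otimes> inv b \<otimes> u" using c uc by (simp add: word_simps)
      also have "\<dots> = inv b"
      proof -
        have "b \<otimes> u = u \<otimes> b" unfolding b_def using uc nat_pow_comm[of u "p ^ k * j" 1] by simp
        then have "inv b \<otimes> u = u \<otimes> inv b" using commute_inv[OF uc c(2)] by simp
        then show ?thesis using uc c by (simp add: m_assoc)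
      qed
      finally have iau: "inv a \<otimes> u = inv b" .
      have "a [^] (p ^ k) = (u [^] r) [^] i" unfolding a_def rm using uc by (simp add: nat_pow_pow ac_simps)
      then have 1: "a [^] (p ^ k) \<in> N" using subgroup_pow[OF osubD(1)[OF nrmD(1)[OF N]] r(2)[OF u(2)]] by simp
      have "inv b [^] m = inv ((u [^] r) [^] j)" unfolding rm using uc c by (simp add: nat_pow_inv b_def nat_pow_pow ac_simps)
      then have 2: "inv b [^] m \<in> N"
        using osubD(6)[OF nrmD(1)[OF N]] subgroup_pow[OF osubD(1)[OF nrmD(1)[OF N]] r(2)[OF u(2)]] by simp
      have "a \<in> K N" unfolding K_def iau[symmetric] using abU 1 2 cm iau by auto
      then show ?thesis using abU by blast
    qed
    show "\<exists>N''\<in>Collect nrm. K N'' \<subseteq> K N \<inter> K N'" if "N \<in> Collect nrm" "N' \<in> Collect nrm" for N N'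
      using nrm_Int[of N N'] that by (intro bexI[of _ "N \<inter> N'"]) (auto simp: K_def)
  qed
  then obtain a where a: "a \<in> U" "\<And>N. nrm N \<Longrightarrow> a \<in> K N" by blast
  have aR: "a \<in> R" using a(2)[OF nrm_U] by (simp add: K_def)
  have b: "inv a \<otimes> u \<in> U" "inv a \<otimes> u \<in> R"
    using osubD(5,6)[OF U(1)] a u subgroup.m_closed[OF R(1)] subgroup.m_inv_closed[OF R(1)] aR by auto
  have "a \<in> tor (pows p)" using tor_U_iff[OF a(1), of "pows p"] a(2) unfolding K_def by blast
  moreover have "inv a \<otimes> u \<in> tor (cops p)" using tor_U_iff[OF b(1), of "cops p"] a(2) unfolding K_def by blast
  moreover have "u = a \<otimes> (inv a \<otimes> u)" using a(1) uc U_carrier by simp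
  ultimately show ?thesis using that a(1) aR b by blast
qed

end

section \<open>Centralizers of Sylow complements\<close>

context topgroup begin

definition cent :: "'a set \<Rightarrow> 'a set" where
  "cent A = {x \<in> carrier G. \<forall>a\<in>A. a \<otimes> x = x \<otimes> a}"

lemma cent_subgroup:
  assumes A: "A \<subseteq> carrier G" shows "subgroup (cent A) G"
proof (rule subgroupI)
  show "cent A \<noteq> {}" using A by (auto simp: cent_def intro!: exI[of _ \<one>])
  fix x assume x: "x \<in> cent A"
  have "a \<otimes> inv x = inv x \<otimes> a" if "a \<in> A" for a using commute_inv[of a x] x that A by (auto simp: cent_def)
  then show "inv x \<in> cent A" using x by (simp add: cent_def)
  fix y assume y: "y \<in> cent A"
  have "a \<otimes> (x \<otimes> y) = (x \<otimes> y) \<otimes> a" if "a \<in> A" for a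
    by (rule commute_mult) (use x y that A in \<open>auto simp: cent_def\<close>)
  then show "x \<otimes> y \<in> cent A" using x y by (simp add: cent_def)
qed (auto simp: cent_def)

lemma centD: "x \<in> cent A \<Longrightarrow> a \<in> A \<Longrightarrow> a \<otimes> x = x \<otimes> a" "x \<in> cent A \<Longrightarrow> x \<in> carrier G"
  by (auto simp: cent_def)

lemma cent_closed:
  assumes H: "Hausdorff_space (tp G)" and A: "A \<subseteq> carrier G" shows "closedin (tp G) (cent A)"
\<comment> \<open>The centralizer is an intersection over \<open>A\<close>, which over the empty set
  would be the whole type.\<close>
proof (cases "A = {}")
  case True then show ?thesis using closedin_topspace[of "tp G"] by (simp add: cent_def)
next
  case False
  have "cent A = (\<Inter>a\<in>A. {x \<in> carrier G. comm x a \<in> {\<one>}})"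
    using A False comm_eq_one_iff by (fastforce simp: cent_def)
  moreover have "closedin (tp G) {x \<in> carrier G. comm x a \<in> {\<one>}}" if "a \<in> A" for a
  proof (rule closed_preimage)
    show "continuous_map (tp G) (tp G) (\<lambda>x. comm x a)" using that A by (intro cintros) auto
    show "closedin (tp G) {\<one>}" using Hausdorff_imp_t1_space[OF H] by (simp add: t1_space_closedin_singleton)
  qed
  ultimately show ?thesis using False by (auto intro!: closedin_Inter)
qed

end

lemma coprime_pows_cops:
  fixes m k p :: nat
  shows "m \<in> pows p \<Longrightarrow> k \<in> cops p \<Longrightarrow> coprime m k"
  by (auto simp: coprime_commute)

lemma pows_mult: "1 \<in> pows p" "a \<in> pows p \<Longrightarrow> b \<in> pows p \<Longrightarrow> a * b \<in> pows p"
proof -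
  show "1 \<in> pows p" by (rule range_eqI[of _ _ 0]) simp
  show "a \<in> pows p \<Longrightarrow> b \<in> pows p \<Longrightarrow> a * b \<in> pows p" by (auto simp flip: power_add)
qed

lemma cops_mult: "1 \<in> cops p" "a \<in> cops p \<Longrightarrow> b \<in> cops p \<Longrightarrow> a * b \<in> cops p"
  by simp_all

locale qz_free_pronil_group = pronil_group +
  assumes QZ: "quasi_center G = {\<one>}"
begin

lemma QZ_D: "x \<in> carrier G \<Longrightarrow> open_subgroup V G \<Longrightarrow> (\<And>v. v \<in> V \<Longrightarrow> v \<otimes> x = x \<otimes> v) \<Longrightarrow> x = \<one>"
  using QZ unfolding quasi_center_def by blast

definition Up :: "nat \<Rightarrow> 'a set" where "Up p = U \<inter> tor (pows p)"
definition Vp :: "nat \<Rightarrow> 'a set" where "Vp p = U \<inter> tor (cops p)"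
definition Cp :: "nat \<Rightarrow> 'a set" where "Cp p = cent (Vp p)"

lemma Up_subgroup: "subgroup (Up p) G" unfolding Up_def by (rule tor_subgroup[OF pows_mult])
lemma Vp_subgroup: "subgroup (Vp p) G" unfolding Vp_def by (rule tor_subgroup[OF cops_mult])
lemma UpVp_carrier: "x \<in> Up p \<Longrightarrow> x \<in> carrier G" "x \<in> Vp p \<Longrightarrow> x \<in> carrier G"
  unfolding Up_def Vp_def using U_carrier by blast+
lemma UpVp_U: "x \<in> Up p \<Longrightarrow> x \<in> U" "x \<in> Vp p \<Longrightarrow> x \<in> U" unfolding Up_def Vp_def by blast+

lemma Up_Vp_commute: "a \<in> Up p \<Longrightarrow> b \<in> Vp p \<Longrightarrow> a \<otimes> b = b \<otimes> a"
  unfolding Up_def Vp_def using tor_commute[of "pows p" "cops p" a b] coprime_pows_cops by blast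

lemma Up_sub_Vp:
  assumes "Factorial_Ring.prime p" "Factorial_Ring.prime q" "p \<noteq> q" shows "Up q \<subseteq> Vp p"
proof -
  have "coprime (q ^ k) p" for k using primes_coprime[OF assms(2,1)] assms(3) by simp
  then have "pows q \<subseteq> cops p" by auto
  then show ?thesis unfolding Up_def Vp_def using tor_mono by blast
qed

lemma Up_Vp_decomposition:
  assumes "Factorial_Ring.prime p" "subgroup H G" "closedin (tp G) H" "u \<in> H" "u \<in> U"
  obtains a b where "a \<in> H" "a \<in> Up p" "b \<in> H" "b \<in> Vp p" "u = a \<otimes> b" "a \<otimes> b = b \<otimes> a"
proof -
  obtain a b where ab: "a \<in> H" "a \<in> U" "a \<in> tor (pows p)" "b \<in> H" "b \<in> U" "b \<in> tor (cops p)" "u = a \<otimes> b"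
    by (rule tor_decomposition[OF assms])
  then have "a \<in> Up p" "b \<in> Vp p" by (simp_all add: Up_def Vp_def)
  then show ?thesis using that[OF ab(1) _ ab(4) _ ab(7) Up_Vp_commute] by blast
qed

text \<open>Every \<open>v\<close> in \<open>V \<inter> U\<close> is a product of an element of
  \<open>Up p\<close> and one of \<open>Vp p\<close> that both lie in \<open>V\<close>, since
  \<open>V\<close> is closed. So \<open>x\<close> commutes with an open subgroup. This is the usual
  way of proving an element trivial from here on.\<close>

lemma commute_open:
  assumes p: "Factorial_Ring.prime p" and V: "open_subgroup V G" and x: "x \<in> carrier G"
    and a: "\<And>a. a \<in> V \<Longrightarrow> a \<in> Up p \<Longrightarrow> a \<otimes> x = x \<otimes> a" and b: "\<And>b. b \<in> V \<Longrightarrow> b \<in> Vp p \<Longrightarrow> b \<otimes> x = x \<otimes> b"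
  shows "x = \<one>"
proof (rule QZ_D[OF x osub_Int[OF V U(1)]])
  fix v assume v: "v \<in> V \<inter> U"
  then obtain c d where cd: "c \<in> V" "c \<in> Up p" "d \<in> V" "d \<in> Vp p" "v = c \<otimes> d"
    using Up_Vp_decomposition[OF p osubD(1)[OF V] osub_closed[OF V], of v] by blast
  have "x \<otimes> v = v \<otimes> x" unfolding cd(5)
    using commute_mult[OF x, of c d] a[OF cd(1,2)] b[OF cd(3,4)] cd UpVp_carrier by simp
  then show "v \<otimes> x = x \<otimes> v" by simp
qed

text \<open>An element commuting with a neighbourhood of the identity in \<open>Vp p\<close> commutes with \<open>Vp p\<close>: the commutator
  defect turns out to lie in the quasi-center.\<close>
lemma local_centralizer:
  assumes p: "Factorial_Ring.prime p" and x: "x \<in> carrier G" and V: "open_subgroup V G"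
    and com: "\<And>v. v \<in> Vp p \<Longrightarrow> v \<in> V \<Longrightarrow> v \<otimes> x = x \<otimes> v"
  shows "x \<in> Cp p"
proof -
  obtain N where N: "nrm N" "N \<subseteq> V" using nrm_base[OF V] by blast
  note NO = nrmD(1)[OF N(1)]
  define K where "K = Vp p"
  define K1 where "K1 = K \<inter> N"
  have Ks: "subgroup K G" unfolding K_def by (rule Vp_subgroup)
  have K1s: "subgroup K1 G" unfolding K1_def by (rule subgroups_Inter_pair[OF Ks osubD(1)[OF NO]])
  have Kc: "k \<in> carrier G" if "k \<in> K" for k using that UpVp_carrier K_def by blast
  have K1c: "k \<in> carrier G" if "k \<in> K1" for k using that Kc K1_def by blast
  have KU: "u \<otimes> k \<otimes> inv u \<in> K" if "u \<in> U" "k \<in> K" for u k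
    using that nrmD(3)[OF nrm_U] tor_conj[OF U_carrier] unfolding K_def Vp_def by blast
  have K1U: "u \<otimes> k \<otimes> inv u \<in> K1" if "u \<in> U" "k \<in> K1" for u k
    using that nrmD(3)[OF N(1)] KU unfolding K1_def by blast
  have xk: "k \<otimes> x = x \<otimes> k" if "k \<in> K1" for k using that com N(2) unfolding K1_def K_def by blast
  have "y \<otimes> x = x \<otimes> y" if y: "y \<in> K" for y
  proof -
    have yU: "y \<in> U" using y UpVp_U K_def by blast
    have yc: "y \<in> carrier G" using yU U_carrier by blast
    have iyU: "inv y \<in> U" using osubD(6)[OF U(1) yU] .
    \<comment> \<open>\<open>z\<close> below is the commutator of \<open>x\<close> and
      \<open>y\<close>; the aim is to show that an open subgroup centralizes it.\<close>
    define y' where "y' = x \<otimes> y \<otimes> inv x"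
    define z where "z = y' \<otimes> inv y"
    have y'c: "y' \<in> carrier G" and zc: "z \<in> carrier G" using x yc by (simp_all add: y'_def z_def)
    have xkx: "x \<otimes> k \<otimes> inv x = k" "inv x \<otimes> k \<otimes> x = k" if "k \<in> K1" for k
    proof -
      have kc: "k \<in> carrier G" using K1c[OF that] .
      show "x \<otimes> k \<otimes> inv x = k" unfolding xk[OF that, symmetric] using x kc by (simp add: m_assoc)
      have "inv x \<otimes> k \<otimes> x = inv x \<otimes> (x \<otimes> k)" unfolding xk[OF that, symmetric] using x kc by (simp add: m_assoc)
      then show "inv x \<otimes> k \<otimes> x = k" using x kc by simp
    qed
    \<comment> \<open>\<open>x\<close> centralizes \<open>K1\<close> and \<open>y\<close> normalizes
      it, so \<open>y\<close> and \<open>y' = x y inv x\<close> conjugate \<open>K1\<close> in the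
      same way and \<open>z = y' inv y\<close> centralizes it.\<close>
    have zk: "k \<otimes> z = z \<otimes> k" if k: "k \<in> K1" for k
    proof -
      define k0 where "k0 = inv y \<otimes> k \<otimes> y"
      have kc: "k \<in> carrier G" using K1c[OF k] .
      have k0: "k0 \<in> K1" using K1U[OF iyU k] yc by (simp add: k0_def)
      have k0c: "k0 \<in> carrier G" using K1c[OF k0] .
      have "y' \<otimes> k0 \<otimes> inv y' = x \<otimes> (y \<otimes> (inv x \<otimes> k0 \<otimes> x) \<otimes> inv y) \<otimes> inv x"
        unfolding y'_def using x yc k0c by (simp add: word_simps)
      also have "\<dots> = x \<otimes> k \<otimes> inv x" unfolding xkx(2)[OF k0] using kc yc by (simp add: k0_def m_assoc)
      also have "\<dots> = k" by (rule xkx(1)[OF k])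
      finally have "y' \<otimes> k0 \<otimes> inv y' \<otimes> y' \<otimes> inv y = k \<otimes> y' \<otimes> inv y" by simp
      moreover have "y' \<otimes> k0 \<otimes> inv y' \<otimes> y' \<otimes> inv y = y' \<otimes> k0 \<otimes> inv y" using y'c k0c yc by (simp add: m_assoc)
      moreover have "y' \<otimes> k0 \<otimes> inv y = z \<otimes> k" unfolding z_def k0_def using y'c yc kc by (simp add: m_assoc)
      ultimately show ?thesis unfolding z_def using kc y'c yc by (simp add: m_assoc)
    qed
    \<comment> \<open>The neighbourhood is chosen so that, for \<open>v\<close> in it, the
      commutators of \<open>v\<close> with \<open>y\<close> and with \<open>y'\<close> both land in
      \<open>K1\<close>.\<close>
    define W' where "W' = {v \<in> carrier G. v \<in> U} \<inter> {v \<in> carrier G. inv x \<otimes> v \<otimes> x \<in> U}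
      \<inter> {v \<in> carrier G. comm v y \<in> N} \<inter> {v \<in> carrier G. comm v y' \<in> N}"
    have "openin (tp G) W'"
      unfolding W'_def
      by (intro openin_Int open_preimage[OF _ osubD(2)[OF U(1)]] open_preimage[OF _ osubD(2)[OF NO]] cintros x yc y'c inv_closed m_closed)
    moreover have "\<one> \<in> W'" using osubD(4)[OF U(1)] osubD(4)[OF NO] x yc y'c by (simp add: W'_def)
    ultimately obtain W where W: "open_subgroup W G" "W \<subseteq> W'" using base by blast
    have "v \<otimes> z = z \<otimes> v" if "v \<in> W" for v
    proof -
      have v: "v \<in> carrier G" "v \<in> U" "inv x \<otimes> v \<otimes> x \<in> U" "comm v y \<in> N" "comm v y' \<in> N"
        using that W(2) unfolding W'_def by auto
      define k where "k = comm v y"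
      define w where "w = comm v y'"
      have k: "k \<in> K1" unfolding k_def K1_def using subgroup.m_closed[OF Ks KU[OF v(2) y] subgroup.m_inv_closed[OF Ks y]] v(4) by blast
      have "comm (inv x \<otimes> v \<otimes> x) y \<in> K" using subgroup.m_closed[OF Ks KU[OF v(3) y] subgroup.m_inv_closed[OF Ks y]] .
      \<comment> \<open>\<open>y'\<close> need not lie in \<open>U\<close>, so \<open>w\<close> is
        seen to be a \<open>p'\<close>-element as an \<open>x\<close>-conjugate of a commutator
        inside \<open>Vp p\<close>; here the conjugation invariance of \<open>tor\<close> is
        essential.\<close>
      then have "x \<otimes> comm (inv x \<otimes> v \<otimes> x) y \<otimes> inv x \<in> tor (cops p)" using tor_conj[OF x] unfolding K_def Vp_def by blast
      moreover have "x \<otimes> comm (inv x \<otimes> v \<otimes> x) y \<otimes> inv x = w" unfolding w_def y'_def using x v(1) yc by (simp add: word_simps)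
      ultimately have w: "w \<in> K1" using v(5) nrmD(2)[OF N(1)] unfolding K1_def K_def Vp_def w_def by auto
      have kc: "k \<in> carrier G" and wc: "w \<in> carrier G" using k w K1c by auto
      define c where "c = w \<otimes> inv k"
      have c1: "c \<in> K1" unfolding c_def using subgroup.m_closed[OF K1s w subgroup.m_inv_closed[OF K1s k]] .
      have cc: "c \<in> carrier G" using K1c[OF c1] .
      \<comment> \<open>Conjugation by \<open>v\<close> multiplies \<open>y'\<close> by
        \<open>w\<close> and \<open>y\<close> by \<open>k\<close>. As \<open>z\<close> commutes with
        \<open>k\<close>, the effect on \<open>z\<close> is multiplication by
        \<open>c = w inv k\<close> in \<open>K1\<close>.\<close>
      have "v \<otimes> z \<otimes> inv v = (w \<otimes> y') \<otimes> inv (k \<otimes> y)" unfolding w_def k_def z_def using v(1) yc y'c by (simp add: word_simps)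
      also have "\<dots> = w \<otimes> (z \<otimes> inv k)" unfolding z_def using wc kc yc y'c by (simp add: word_simps)
      also have "z \<otimes> inv k = inv k \<otimes> z" using zk[OF subgroup.m_inv_closed[OF K1s k]] by simp
      finally have vz: "v \<otimes> z \<otimes> inv v = c \<otimes> z" unfolding c_def using wc kc zc by (simp add: m_assoc)
      \<comment> \<open>\<open>z\<close> and its conjugate \<open>c z\<close> both centralize
        \<open>K1\<close>, the latter because \<open>v\<close> normalizes \<open>K1\<close>; hence
        so does \<open>c\<close>. It commutes with \<open>Up p\<close> as an element of
        \<open>Vp p\<close>, so \<open>commute_open\<close> gives \<open>c = \<one>\<close>, and
        \<open>v\<close> commutes with \<open>z\<close>.\<close>
      have "b \<otimes> c = c \<otimes> b" if b: "b \<in> N" "b \<in> Vp p" for b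
      proof -
        have b1: "b \<in> K1" using b by (simp add: K1_def K_def)
        have bc: "b \<in> carrier G" using K1c[OF b1] .
        define b0 where "b0 = inv v \<otimes> b \<otimes> v"
        have b0: "b0 \<in> K1" using K1U[OF osubD(6)[OF U(1) v(2)] b1] v(1) by (simp add: b0_def)
        have b0c: "b0 \<in> carrier G" using K1c[OF b0] .
        have "b \<otimes> (v \<otimes> z \<otimes> inv v) = v \<otimes> (b0 \<otimes> z) \<otimes> inv v" unfolding b0_def using bc v(1) zc by (simp add: m_assoc)
        also have "\<dots> = v \<otimes> (z \<otimes> b0) \<otimes> inv v" unfolding zk[OF b0] ..
        also have "\<dots> = (v \<otimes> z \<otimes> inv v) \<otimes> b" unfolding b0_def using bc v(1) zc by (simp add: m_assoc)
        finally have "b \<otimes> (c \<otimes> z) = (c \<otimes> z) \<otimes> b" unfolding vz .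
        then have "b \<otimes> ((c \<otimes> z) \<otimes> inv z) = ((c \<otimes> z) \<otimes> inv z) \<otimes> b"
          using commute_mult[OF bc, of "c \<otimes> z" "inv z"] commute_inv[OF bc zc zk[OF b1]] cc zc by simp
        then show ?thesis using cc zc by (simp add: m_assoc)
      qed
      moreover have "a \<otimes> c = c \<otimes> a" if "a \<in> N" "a \<in> Up p" for a
        using Up_Vp_commute[OF that(2)] c1 unfolding K1_def K_def by blast
      ultimately have "c = \<one>" using commute_open[OF p NO cc] by blast
      then have "v \<otimes> z \<otimes> inv v \<otimes> v = z \<otimes> v" using vz zc by simp
      then show ?thesis using v(1) zc by (simp add: m_assoc)
    qed
    then have "z = \<one>" using QZ_D[OF zc W(1)] by blast
    then have "z \<otimes> y \<otimes> x = y \<otimes> x" using yc x by simp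
    then show ?thesis unfolding z_def y'_def using x yc by (simp add: m_assoc)
  qed
  then show ?thesis using x by (simp add: Cp_def cent_def K_def)
qed

section \<open>The closed normal subgroups attached to the primes\<close>

lemma Cp_subgroup: "subgroup (Cp p) G" unfolding Cp_def by (rule cent_subgroup) (use UpVp_carrier in blast)

lemma Cp_closed: "closedin (tp G) (Cp p)" unfolding Cp_def by (rule cent_closed[OF Haus]) (use UpVp_carrier in blast)

lemma Cp_carrier: "x \<in> Cp p \<Longrightarrow> x \<in> carrier G" unfolding Cp_def by (rule centD)

text \<open>If \<open>v\<close> in \<open>Vp p\<close> has its \<open>inv g\<close>-conjugate in
  \<open>U\<close>, that conjugate is again in \<open>Vp p\<close>, so \<open>x\<close> commutes
  with it and \<open>g x inv g\<close> with \<open>v\<close>. Such \<open>v\<close> fill a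
  neighbourhood of the identity in \<open>Vp p\<close>, and \<open>local_centralizer\<close> extends
  this to all of \<open>Vp p\<close>.\<close>

lemma Cp_normal:
  assumes p: "Factorial_Ring.prime p" and g: "g \<in> carrier G" and x: "x \<in> Cp p"
  shows "g \<otimes> x \<otimes> inv g \<in> Cp p"
proof -
  have xc: "x \<in> carrier G" using x Cp_carrier by blast
  have "v \<otimes> (g \<otimes> x \<otimes> inv g) = (g \<otimes> x \<otimes> inv g) \<otimes> v"
    if v: "v \<in> Vp p" "v \<in> {v \<in> carrier G. inv g \<otimes> v \<otimes> inv (inv g) \<in> U}" for v
  proof -
    have vc: "v \<in> carrier G" using v by blast
    have "inv g \<otimes> v \<otimes> inv (inv g) \<in> Vp p" using v tor_conj[OF inv_closed[OF g]] unfolding Vp_def by blast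
    then have "(inv g \<otimes> v \<otimes> inv (inv g)) \<otimes> x = x \<otimes> (inv g \<otimes> v \<otimes> inv (inv g))" using x unfolding Cp_def by (intro centD)
    then have "g \<otimes> ((inv g \<otimes> v \<otimes> inv (inv g)) \<otimes> x) \<otimes> inv g = g \<otimes> (x \<otimes> (inv g \<otimes> v \<otimes> inv (inv g))) \<otimes> inv g" by simp
    then show ?thesis using g vc xc by (simp add: m_assoc)
  qed
  then show ?thesis using local_centralizer[OF p _ osub_conj[OF U(1) inv_closed[OF g]]] g xc by simp
qed

lemma Up_sub_Cp: "Up p \<subseteq> Cp p"
proof
  fix a assume a: "a \<in> Up p"
  then show "a \<in> Cp p" unfolding Cp_def cent_def using Up_Vp_commute[OF a] UpVp_carrier by force
qed

text \<open>Such an \<open>x\<close> commutes with \<open>Vp p\<close> by membership in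
  \<open>Cp p\<close>, and with \<open>Up p\<close> because \<open>Cp p\<close> contains
  \<open>Up p\<close>. This is what makes coordinates unique later.\<close>

lemma Cp_cent_Cp:
  assumes p: "Factorial_Ring.prime p" and x: "x \<in> Cp p" "x \<in> cent (Cp p)" shows "x = \<one>"
  by (rule commute_open[OF p osub_carrier Cp_carrier[OF x(1)]])
     (use x(1) x(2) Up_sub_Cp in \<open>auto simp: Cp_def cent_def\<close>)

text \<open>In the decomposition \<open>u = a b\<close> the factor \<open>b = inv a u\<close> lies
  in \<open>Cp p \<inter> Vp p\<close>, so it commutes with \<open>Vp p\<close> and with
  \<open>Up p\<close> and is trivial.\<close>

lemma Cp_U:
  assumes p: "Factorial_Ring.prime p" and u: "u \<in> Cp p" "u \<in> U" shows "u \<in> Up p"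
proof -
  obtain a b where ab: "a \<in> Up p" "b \<in> Vp p" "u = a \<otimes> b"
    using Up_Vp_decomposition[OF p Cp_subgroup Cp_closed u] by metis
  have c: "a \<in> carrier G" "b \<in> carrier G" using ab UpVp_carrier by auto
  have "b = inv a \<otimes> u" using ab c by simp
  then have "b \<in> Cp p" using subgroup.m_closed[OF Cp_subgroup subgroup.m_inv_closed[OF Cp_subgroup] u(1)] ab(1) Up_sub_Cp by blast
  then have "b = \<one>"
    by (intro commute_open[OF p osub_carrier c(2)]) (use ab(2) Up_Vp_commute in \<open>auto simp: Cp_def cent_def\<close>)
  then show ?thesis using ab c by simp
qed

text \<open>By normality the commutator lies in both subgroups. It then centralizes
  \<open>Vp p\<close> and \<open>Vp q\<close>, and \<open>Vp q\<close> contains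
  \<open>Up p\<close>.\<close>

lemma Cp_Cq_commute:
  assumes p: "Factorial_Ring.prime p" and q: "Factorial_Ring.prime q" "p \<noteq> q" and x: "x \<in> Cp p" and y: "y \<in> Cp q"
  shows "x \<otimes> y = y \<otimes> x"
proof -
  have c: "x \<in> carrier G" "y \<in> carrier G" using x y Cp_carrier by auto
  have "(x \<otimes> y \<otimes> inv x) \<otimes> inv y \<in> Cp q"
    using subgroup.m_closed[OF Cp_subgroup Cp_normal[OF q(1) c(1) y] subgroup.m_inv_closed[OF Cp_subgroup y]] .
  moreover have "x \<otimes> (y \<otimes> inv x \<otimes> inv y) \<in> Cp p"
    using subgroup.m_closed[OF Cp_subgroup x Cp_normal[OF p c(2) subgroup.m_inv_closed[OF Cp_subgroup x]]] .
  ultimately have z: "comm x y \<in> Cp q" "comm x y \<in> Cp p" using c by (simp_all add: m_assoc)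
  have "comm x y = \<one>"
    by (rule commute_open[OF p osub_carrier])
       (use c z Up_sub_Vp[OF q(1) p q(2)[symmetric]] in \<open>auto simp: Cp_def cent_def\<close>)
  then show ?thesis using comm_eq_one_iff c by simp
qed

text \<open>Induction on the exponent: each prime factor is split off with the decomposition \<open>u = a b\<close>.\<close>
lemma Up_dense:
  assumes H: "subgroup H G" "closedin (tp G) H" and N: "nrm N" and u: "u \<in> H" "u \<in> U"
  shows "\<exists>t \<in> generate G (\<Union>p\<in>{p. Factorial_Ring.prime p}. H \<inter> Up p). inv t \<otimes> u \<in> N"
proof -
  let ?T = "generate G (\<Union>p\<in>{p. Factorial_Ring.prime p}. H \<inter> Up p)"
  have Tc: "(\<Union>p\<in>{p. Factorial_Ring.prime p}. H \<inter> Up p) \<subseteq> carrier G" using UpVp_carrier by blast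
  have T: "subgroup ?T G" by (rule generate_is_subgroup[OF Tc])
  note NO = nrmD(1)[OF N]
  have "\<exists>t\<in>?T. inv t \<otimes> u \<in> N" if "m > 0" "u \<in> H" "u \<in> U" "u [^] (m::nat) \<in> N" for m u
    using that
  proof (induction m arbitrary: u rule: less_induct)
    case (less m)
    have uc: "u \<in> carrier G" using less U_carrier by blast
    show ?case
    proof (cases "m = 1")
      case True
      then show ?thesis using less.prems(4) uc subgroup.one_closed[OF T] by (intro bexI[of _ \<one>]) auto
    next
      case False
      then obtain p where p: "Factorial_Ring.prime p" "p dvd m" using prime_factor_nat by blast
      define k where "k = multiplicity p m"
      define m' where "m' = m div p ^ k"
      have mm: "m = p ^ k * m'" unfolding m'_def k_def by (simp add: multiplicity_dvd)
      have pm: "\<not> p dvd m'" unfolding m'_def k_def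
        using multiplicity_decompose[of m p] less.prems(1) p by (metis not_prime_unit not_gr_zero)
      have m'0: "m' > 0" using mm less.prems(1) by (cases "m' = 0") auto
      have "k \<noteq> 0" using mm pm p(2) by (metis mult_1 power_0)
      then have "p ^ k > 1" using prime_gt_1_nat[OF p(1)] by (intro one_less_power) auto
      then have m'm: "m' < m" using mm m'0 by simp
      obtain a b where ab: "a \<in> H" "a \<in> Up p" "b \<in> H" "b \<in> Vp p" "u = a \<otimes> b" "a \<otimes> b = b \<otimes> a"
        using Up_Vp_decomposition[OF p(1) H less.prems(2,3)] by blast
      have c: "a \<in> carrier G" "b \<in> carrier G" using ab UpVp_carrier by auto
      obtain j where j: "a [^] (p ^ j) \<in> N" using ab(2) NO unfolding Up_def tor_def by blast
      obtain s where s: "coprime s p" "b [^] s \<in> N" using ab(4) NO unfolding Vp_def tor_def by blast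
      have Ns: "subgroup N G" using osubD(1)[OF NO] .
      \<comment> \<open>This exponent sends both \<open>u\<close> and \<open>a\<close> into
        \<open>N\<close>, hence also \<open>b\<close>. Its gcd with \<open>s\<close>, which is prime
        to \<open>p\<close>, divides the prime-to-\<open>p\<close> part \<open>m'\<close> of
        \<open>m\<close>, and \<open>m' < m\<close> lets the induction apply to
        \<open>b\<close>.\<close>
      let ?e = "m * p ^ j"
      have "u [^] ?e = a [^] ?e \<otimes> b [^] ?e" unfolding ab(5) by (rule pow_mult_distrib[OF ab(6) c])
      then have "b [^] ?e = inv (a [^] ?e) \<otimes> u [^] ?e" using c uc by simp
      moreover have "a [^] ?e \<in> N" using subgroup_pow[OF Ns j, of m] c by (simp add: nat_pow_pow mult.commute)
      moreover have "u [^] ?e \<in> N" using subgroup_pow[OF Ns less.prems(4), of "p ^ j"] uc by (simp add: nat_pow_pow)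
      ultimately have "b [^] ?e \<in> N" using subgroup.m_closed[OF Ns] subgroup.m_inv_closed[OF Ns] by simp
      then have g: "b [^] gcd ?e s \<in> N" using subgroup_pow_gcd[OF Ns c(2) _ s(2)] by blast
      have "gcd ?e s dvd m'"
      proof -
        have "coprime (gcd ?e s) (p ^ k * p ^ j)"
          using s(1) by (metis coprime_commute coprime_divisors coprime_mult_right_iff coprime_power_right_iff dvd_refl gcd_dvd2)
        moreover have "gcd ?e s dvd (p ^ k * p ^ j) * m'" using gcd_dvd1[of ?e s] unfolding mm by (simp add: ac_simps)
        ultimately show ?thesis using coprime_dvd_mult_right_iff by blast
      qed
      then obtain i where "m' = gcd ?e s * i" by blast
      then have bm: "b [^] m' \<in> N" using subgroup_pow[OF Ns g, of i] c by (simp add: nat_pow_pow)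
      obtain t where t: "t \<in> ?T" "inv t \<otimes> b \<in> N" using less.IH[OF m'm m'0 ab(3) _ bm] ab(4) UpVp_U by blast
      have "a \<in> ?T" using ab p(1) by (intro generate.incl) blast
      then have at: "a \<otimes> t \<in> ?T" using t(1) subgroup.m_closed[OF T] by blast
      have tc: "t \<in> carrier G" using subgroup.mem_carrier[OF T t(1)] .
      have "inv (a \<otimes> t) \<otimes> u = inv t \<otimes> b" unfolding ab(5) using c tc by (simp add: word_simps)
      then have "inv (a \<otimes> t) \<otimes> u \<in> N" using t(2) by simp
      then show ?thesis using at by (rule bexI)
    qed
  qed
  moreover obtain r where "r > 0" "u [^] (r::nat) \<in> N" using nrm_exponent[OF N] u by blast
  ultimately show ?thesis using u by blast
qed

end

section \<open>Coordinates on the residual\<close>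

text \<open>\<open>R_min\<close> is the one consequence of minimality of the residual that the
  argument uses: no proper subgroup of \<open>R\<close> that is closed normal in the group is open
  in \<open>R\<close>. It is derived in \<open>residual_minimal_open\<close>.\<close>

locale residual_pronil_group = qz_free_pronil_group +
  fixes R
  assumes R: "closed_normal R G"
    and R_min: "\<And>M. closed_normal M G \<Longrightarrow> M \<subseteq> R \<Longrightarrow> openin (subtopology (tp G) R) M \<Longrightarrow> M = R"
begin

lemma Rs: "subgroup R G" "closedin (tp G) R" "R \<subseteq> carrier G" "\<And>x. x \<in> R \<Longrightarrow> x \<in> carrier G"
  using closed_normalD[OF R] subgroup.subset by blast+

definition Rp :: "nat \<Rightarrow> 'a set" where "Rp p = R \<inter> Cp p"

definition T :: "'a set" where "T = generate G (\<Union>p\<in>{p. Factorial_Ring.prime p}. Rp p)"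

lemma Rp_subgroup: "subgroup (Rp p) G" unfolding Rp_def by (rule subgroups_Inter_pair[OF Rs(1) Cp_subgroup])

lemma Rp_closed: "closedin (tp G) (Rp p)" unfolding Rp_def using Rs(2) Cp_closed by blast

lemma Rp_carrier: "x \<in> Rp p \<Longrightarrow> x \<in> carrier G" unfolding Rp_def using Rs(4) by blast

lemma R_Up: "R \<inter> Up p \<subseteq> Rp p" unfolding Rp_def using Up_sub_Cp by blast

lemma T_sub: "T \<subseteq> R"
  unfolding T_def by (rule generate_subgroup_incl[OF _ Rs(1)]) (auto simp: Rp_def)

lemma T_subgroup: "subgroup T G" unfolding T_def by (rule generate_is_subgroup) (use Rp_carrier in blast)

lemma T_normal: "T \<lhd> G"
  unfolding T_def
proof (rule normal_generateI)
  show "(\<Union>p\<in>{p. Factorial_Ring.prime p}. Rp p) \<subseteq> carrier G" using Rp_carrier by blast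
  fix h g assume h: "h \<in> (\<Union>p\<in>{p. Factorial_Ring.prime p}. Rp p)" and g: "g \<in> carrier G"
  then obtain p where p: "Factorial_Ring.prime p" "h \<in> R" "h \<in> Cp p" unfolding Rp_def by blast
  have "g \<otimes> h \<otimes> inv g \<in> R" using closed_normalD(3)[OF R] g p(2) by (simp add: normal_iff)
  then show "g \<otimes> h \<otimes> inv g \<in> (\<Union>p\<in>{p. Factorial_Ring.prime p}. Rp p)"
    using Cp_normal[OF p(1) g p(3)] p(1) unfolding Rp_def by blast
qed

lemma closure_T: "tp G closure_of T = R"
proof (rule R_min)
  let ?M = "tp G closure_of T"
  show cn: "closed_normal ?M G" by (rule closure_normal[OF T_normal])
  show MR: "?M \<subseteq> R" by (rule closure_of_minimal[OF T_sub Rs(2)])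
  have Tc: "T \<subseteq> carrier G" using T_subgroup by (rule subgroup.subset)
  \<comment> \<open>Approximating inside \<open>R\<close> is possible because
    \<open>Up_dense\<close> keeps its generators in the given closed subgroup, here
    \<open>R\<close>.\<close>
  have RU: "R \<inter> U \<subseteq> ?M"
  proof
    fix u assume u: "u \<in> R \<inter> U"
    then have uc: "u \<in> carrier G" using Rs by blast
    have "\<exists>v\<in>V. u \<otimes> v \<in> T" if V: "open_subgroup V G" for V
    proof -
      obtain N where N: "nrm N" "N \<subseteq> V" using nrm_base[OF V] by blast
      obtain t where t: "t \<in> generate G (\<Union>p\<in>{p. Factorial_Ring.prime p}. R \<inter> Up p)" "inv t \<otimes> u \<in> N"
        using Up_dense[OF Rs(1,2) N(1), of u] u by blast
      have "generate G (\<Union>p\<in>{p. Factorial_Ring.prime p}. R \<inter> Up p) \<subseteq> T"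
        unfolding T_def by (rule mono_generate) (use R_Up in blast)
      then have tT: "t \<in> T" using t(1) by blast
      have tc: "t \<in> carrier G" using tT Tc by blast
      have "inv (inv t \<otimes> u) \<in> V" using t(2) N(2) osubD(6)[OF V] by blast
      moreover have "u \<otimes> inv (inv t \<otimes> u) = t" using tc uc by (simp add: word_simps)
      ultimately show ?thesis using tT by metis
    qed
    then show "u \<in> ?M" using in_closure_iff[OF Tc] uc by blast
  qed
  interpret RG: topgroup "subtg G R" by (rule subtg_topgroup[OF Rs(1)])
  have "open_subgroup (R \<inter> U) (subtg G R)"
    using subgroup_subtg_iff[OF Rs(1)] subgroups_Inter_pair[OF Rs(1) osubD(1)[OF U(1)]] osubD(2)[OF U(1)]
    by (auto simp: open_subgroup_def openin_subtopology)
  then have "open_subgroup ?M (subtg G R)"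
    by (rule RG.osubI[rotated]) (use subgroup_subtg_iff[OF Rs(1)] closed_normalD(1)[OF cn] MR RU in auto)
  then show "openin (subtopology (tp G) R) ?M" by (simp add: open_subgroup_def)
qed

text \<open>\<open>T\<close> is dense in \<open>R\<close> and \<open>U\<close> is open. Statements
  about \<open>R\<close> thereby split into an algebraic one on generators and one on the compact
  part.\<close>

lemma R_decomp: assumes r: "r \<in> R" shows "\<exists>t\<in>T. \<exists>u\<in>R \<inter> U. r = t \<otimes> u"
proof -
  have rc: "r \<in> carrier G" using r Rs by blast
  have "r \<in> tp G closure_of T" using r closure_T by simp
  then obtain u where u: "u \<in> U" "r \<otimes> u \<in> T" using in_closure_iff[OF subgroup.subset[OF T_subgroup]] U(1) by blast
  have uc: "u \<in> carrier G" using u U_carrier by blast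
  have "inv r \<otimes> (r \<otimes> u) \<in> R" using subgroup.m_closed[OF Rs(1) subgroup.m_inv_closed[OF Rs(1) r]] u(2) T_sub by blast
  then have "u \<in> R" using rc uc by simp
  then have "inv u \<in> R \<inter> U" using u(1) osubD(6)[OF U(1)] subgroup.m_inv_closed[OF Rs(1)] by blast
  moreover have "r = (r \<otimes> u) \<otimes> inv u" using rc uc by (simp add: m_assoc)
  ultimately show ?thesis using u(2) by blast
qed

text \<open>\<open>a\<close> is a \<open>p\<close>-coordinate of \<open>r\<close>. A relation at
  this point, since uniqueness is immediate but existence on all of \<open>R\<close> takes several
  steps.\<close>

definition split :: "nat \<Rightarrow> 'a \<Rightarrow> 'a \<Rightarrow> bool" where
  "split p r a \<longleftrightarrow> a \<in> Rp p \<and> (\<exists>d\<in>cent (Cp p). r = a \<otimes> d)"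

lemma cent_Cp: "subgroup (cent (Cp p)) G" "x \<in> cent (Cp p) \<Longrightarrow> x \<in> carrier G"
  using cent_subgroup[of "Cp p"] Cp_carrier by (auto simp: cent_def)

text \<open>Two coordinates differ by an element of \<open>Cp p\<close> that centralizes
  \<open>Cp p\<close>.\<close>

lemma split_unique:
  assumes p: "Factorial_Ring.prime p" and a: "split p r a" and b: "split p r b" shows "a = b"
proof -
  obtain d e where d: "d \<in> cent (Cp p)" "r = a \<otimes> d" and e: "e \<in> cent (Cp p)" "r = b \<otimes> e" using a b by (auto simp: split_def)
  have ab: "a \<in> Cp p" "b \<in> Cp p" using a b by (auto simp: split_def Rp_def)
  have c: "a \<in> carrier G" "b \<in> carrier G" "d \<in> carrier G" "e \<in> carrier G" using ab d e Cp_carrier cent_Cp by blast+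
  have "inv b \<otimes> a = e \<otimes> inv d"
  proof -
    have "a = b \<otimes> e \<otimes> inv d" using d e c by (metis inv_solve_right' m_closed)
    then show ?thesis using c by (simp add: m_assoc)
  qed
  moreover have "e \<otimes> inv d \<in> cent (Cp p)" using subgroup.m_closed[OF cent_Cp(1) e(1) subgroup.m_inv_closed[OF cent_Cp(1) d(1)]] .
  moreover have "inv b \<otimes> a \<in> Cp p" using subgroup.m_closed[OF Cp_subgroup subgroup.m_inv_closed[OF Cp_subgroup ab(2)] ab(1)] .
  ultimately have "inv b \<otimes> a = \<one>" using Cp_cent_Cp[OF p] by simp
  then have "b \<otimes> (inv b \<otimes> a) = b" using c by simp
  then show ?thesis using c by simp
qed

lemma split_mult:
  assumes "split p r a" "split p s b" shows "split p (r \<otimes> s) (a \<otimes> b)"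
proof -
  obtain d e where d: "d \<in> cent (Cp p)" "r = a \<otimes> d" and e: "e \<in> cent (Cp p)" "s = b \<otimes> e" using assms by (auto simp: split_def)
  have ab: "a \<in> Rp p" "b \<in> Rp p" using assms by (auto simp: split_def)
  have c: "a \<in> carrier G" "b \<in> carrier G" "d \<in> carrier G" "e \<in> carrier G" using ab d e Rp_carrier cent_Cp by blast+
  have "b \<otimes> d = d \<otimes> b" using d(1) ab(2) unfolding Rp_def by (intro centD) auto
  then have "r \<otimes> s = (a \<otimes> b) \<otimes> (d \<otimes> e)" unfolding d(2) e(2) using c by (simp add: m_assoc) (simp flip: m_assoc)
  then show ?thesis using subgroup.m_closed[OF Rp_subgroup ab] subgroup.m_closed[OF cent_Cp(1) d(1) e(1)] by (auto simp: split_def)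
qed

lemma split_inv:
  assumes "split p r a" shows "split p (inv r) (inv a)"
proof -
  obtain d where d: "d \<in> cent (Cp p)" "r = a \<otimes> d" "a \<in> Rp p" using assms by (auto simp: split_def)
  have c: "a \<in> carrier G" "d \<in> carrier G" using d Rp_carrier cent_Cp by blast+
  have "a \<otimes> d = d \<otimes> a" using d unfolding Rp_def by (intro centD) auto
  then have "inv r = inv a \<otimes> inv d" unfolding d(2) using c by (metis inv_mult_group)
  then show ?thesis using subgroup.m_inv_closed[OF Rp_subgroup d(3)] subgroup.m_inv_closed[OF cent_Cp(1) d(1)] by (auto simp: split_def)
qed

lemma split_Rp: "a \<in> Rp p \<Longrightarrow> split p a a"
  using subgroup.one_closed[OF cent_Cp(1)[of p]] Rp_carrier by (auto simp: split_def intro!: bexI[of _ \<one>])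

lemma split_Rq:
  assumes "Factorial_Ring.prime p" "Factorial_Ring.prime q" "p \<noteq> q" "a \<in> Rp q" shows "split p a \<one>"
proof -
  have "a \<in> cent (Cp p)" using Cp_Cq_commute[OF assms(1,2,3)] assms(4) Rp_carrier unfolding cent_def Rp_def by blast
  then show ?thesis using subgroup.one_closed[OF Rp_subgroup] Rp_carrier[OF assms(4)]
    by (auto simp: split_def intro!: bexI[of _ a])
qed

text \<open>The subgroup \<open>H\<close> is a parameter so that it can be taken as
  \<open>R \<inter> V\<close> for small open \<open>V\<close>, which shows that small elements have
  small coordinates.\<close>

lemma split_U:
  assumes p: "Factorial_Ring.prime p" and H: "subgroup H G" "closedin (tp G) H" "H \<subseteq> R" and u: "u \<in> H" "u \<in> U"
  shows "\<exists>a\<in>H \<inter> Up p. split p u a"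
proof -
  obtain a b where ab: "a \<in> H" "a \<in> Up p" "b \<in> H" "b \<in> Vp p" "u = a \<otimes> b" using Up_Vp_decomposition[OF p H(1,2) u] by metis
  have "b \<in> cent (Cp p)" unfolding cent_def
    using ab(4) UpVp_carrier centD(1)[of _ "Vp p" b] unfolding Cp_def by fastforce
  then show ?thesis using ab H(3) R_Up by (auto simp: split_def)
qed

text \<open>The elements that have a coordinate form a subgroup. It contains every
  \<open>Rp q\<close>, where the coordinate is the element itself or the identity, hence
  \<open>T\<close>; \<open>split_U\<close> covers the remaining factor from
  \<open>R \<inter> U\<close>.\<close>

lemma split_ex:
  assumes p: "Factorial_Ring.prime p" and r: "r \<in> R" shows "\<exists>a. split p r a"
proof -
  let ?X = "{r \<in> carrier G. \<exists>a. split p r a}"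
  have "subgroup ?X G"
    by (rule subgroupI) (use split_mult split_inv split_Rp[OF subgroup.one_closed[OF Rp_subgroup]] in blast)+
  moreover have "Rp q \<subseteq> ?X" if "Factorial_Ring.prime q" for q
    using split_Rp[of _ q] split_Rq[OF p that] Rp_carrier by (cases "p = q") blast+
  ultimately have "T \<subseteq> ?X" unfolding T_def by (intro generate_subgroup_incl) blast+
  then show ?thesis using R_decomp[OF r] split_U[OF p Rs(1,2)] split_mult by blast
qed

definition proj :: "nat \<Rightarrow> 'a \<Rightarrow> 'a" where "proj p r = (THE a. split p r a)"

lemma proj_split:
  assumes "Factorial_Ring.prime p" shows "r \<in> R \<Longrightarrow> split p r (proj p r)" "split p r a \<Longrightarrow> proj p r = a"
proof -
  show *: "proj p r = a" if "split p r a" for a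
    unfolding proj_def using that split_unique[OF assms] by blast
  show "r \<in> R \<Longrightarrow> split p r (proj p r)" using split_ex[OF assms] * by blast
qed

lemma proj_mult:
  assumes "Factorial_Ring.prime p" "r \<in> R" "s \<in> R" shows "proj p (r \<otimes> s) = proj p r \<otimes> proj p s"
  using proj_split(2)[OF assms(1) split_mult] proj_split(1)[OF assms(1)] assms by blast

lemma proj_Rp: "Factorial_Ring.prime p \<Longrightarrow> r \<in> R \<Longrightarrow> proj p r \<in> Rp p"
  using proj_split(1) by (auto simp: split_def)

lemma proj_id: "Factorial_Ring.prime p \<Longrightarrow> a \<in> Rp p \<Longrightarrow> proj p a = a"
  using proj_split(2) split_Rp by blast

lemma proj_other:
  "Factorial_Ring.prime p \<Longrightarrow> Factorial_Ring.prime q \<Longrightarrow> p \<noteq> q \<Longrightarrow> a \<in> Rp q \<Longrightarrow> proj p a = \<one>"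
  using proj_split(2) split_Rq by blast

text \<open>The decomposition is carried out inside the closed subgroup \<open>R \<inter> V\<close>.
  This is continuity of \<open>proj p\<close> at the identity.\<close>

lemma proj_small:
  assumes p: "Factorial_Ring.prime p" and V: "open_subgroup V G" and u: "u \<in> R" "u \<in> U" "u \<in> V"
  shows "proj p u \<in> V" "proj p u \<in> Up p" "proj p u \<in> R"
proof -
  have "subgroup (R \<inter> V) G" "closedin (tp G) (R \<inter> V)"
    using subgroups_Inter_pair[OF Rs(1) osubD(1)[OF V]] Rs(2) osub_closed[OF V] by auto
  then obtain a where "a \<in> (R \<inter> V) \<inter> Up p" "split p u a" using split_U[OF p, of "R \<inter> V" u] u by blast
  then show "proj p u \<in> V" "proj p u \<in> Up p" "proj p u \<in> R" using proj_split(2)[OF p] by auto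
qed

lemma proj_U: "Factorial_Ring.prime p \<Longrightarrow> u \<in> R \<Longrightarrow> u \<in> U \<Longrightarrow> proj p u \<in> Up p"
  using proj_small(2)[OF _ U(1)] by blast

text \<open>Multiplicativity moves the estimate of \<open>proj_small\<close> from the identity to an
  arbitrary \<open>r\<close>.\<close>

lemma proj_continuous:
  assumes p: "Factorial_Ring.prime p" shows "continuous_map (subtopology (tp G) R) (tp G) (proj p)"
  unfolding continuous_map
proof (intro conjI allI impI)
  show "proj p ` topspace (subtopology (tp G) R) \<subseteq> topspace (tp G)" using proj_Rp[OF p] Rp_carrier by auto
  fix W assume W: "openin (tp G) W"
  have "\<exists>T. openin (subtopology (tp G) R) T \<and> r \<in> T \<and> T \<subseteq> {x \<in> R. proj p x \<in> W}" if r: "r \<in> R" "proj p r \<in> W" for r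
  proof -
    have c: "r \<in> carrier G" "proj p r \<in> carrier G" using r Rs proj_Rp[OF p r(1)] Rp_carrier by auto
    have "openin (tp G) {x \<in> carrier G. proj p r \<otimes> x \<in> W}"
      by (rule open_preimage[OF _ W], intro cintros) (use c in auto)
    then obtain V where V: "open_subgroup V G" "V \<subseteq> {x \<in> carrier G. proj p r \<otimes> x \<in> W}"
      using base[of "{x \<in> carrier G. proj p r \<otimes> x \<in> W}"] c r by auto
    have o: "openin (tp G) {x \<in> carrier G. inv r \<otimes> x \<in> V \<inter> U}"
      by (rule open_preimage[OF _ osubD(2)[OF osub_Int[OF V(1) U(1)]]], intro cintros) (use c in auto)
    have "proj p x \<in> W" if x: "x \<in> R" "inv r \<otimes> x \<in> V" "inv r \<otimes> x \<in> U" for x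
    proof -
      have xc: "x \<in> carrier G" using x Rs by blast
      have i: "inv r \<otimes> x \<in> R" using subgroup.m_closed[OF Rs(1) subgroup.m_inv_closed[OF Rs(1) r(1)] x(1)] .
      have "proj p x = proj p r \<otimes> proj p (inv r \<otimes> x)" using proj_mult[OF p r(1) i] c xc by simp
      then show ?thesis using proj_small(1)[OF p V(1) i x(3,2)] V(2) by auto
    qed
    then have "R \<inter> {x \<in> carrier G. inv r \<otimes> x \<in> V \<inter> U} \<subseteq> {x \<in> R. proj p x \<in> W}" by blast
    moreover have "openin (subtopology (tp G) R) (R \<inter> {x \<in> carrier G. inv r \<otimes> x \<in> V \<inter> U})" using o by (rule openin_subtopology_Int2)
    moreover have "r \<in> R \<inter> {x \<in> carrier G. inv r \<otimes> x \<in> V \<inter> U}" using r c osubD(4)[OF V(1)] osubD(4)[OF U(1)] by simp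
    ultimately show ?thesis by blast
  qed
  then have "openin (subtopology (tp G) R) {x \<in> R. proj p x \<in> W}"
    by (subst openin_subopen) blast
  moreover have "topspace (subtopology (tp G) R) = R" using Rs(3) by auto
  ultimately show "openin (subtopology (tp G) R) {x \<in> topspace (subtopology (tp G) R). proj p x \<in> W}" by simp
qed

text \<open>With trivial coordinates \<open>r\<close> itself centralizes every \<open>Cp p\<close>,
  hence every \<open>Up p\<close>. These generate a dense subgroup of \<open>U\<close> and the
  centralizer of \<open>r\<close> is closed, so \<open>r\<close> commutes with the open subgroup
  \<open>U\<close>.\<close>

lemma proj_injective:
  assumes r: "r \<in> R" and t: "\<And>p. Factorial_Ring.prime p \<Longrightarrow> proj p r = \<one>" shows "r = \<one>"
proof (rule QZ_D[OF _ U(1)])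
  show rc: "r \<in> carrier G" using r Rs by blast
  \<comment> \<open>Written in the shape that \<open>Up_dense\<close> produces when the closed
    subgroup is the whole group.\<close>
  let ?A = "\<Union>p\<in>{p. Factorial_Ring.prime p}. carrier G \<inter> Up p"
  have rC: "r \<in> cent (Cp p)" if "Factorial_Ring.prime p" for p
    using proj_split(1)[OF that r] t[OF that] rc cent_Cp(2) by (auto simp: split_def)
  have com: "a \<otimes> r = r \<otimes> a" if "a \<in> ?A" for a
  proof -
    have "\<exists>p. Factorial_Ring.prime p \<and> a \<in> Cp p" using \<open>a \<in> ?A\<close> Up_sub_Cp by blast
    then obtain p where "Factorial_Ring.prime p" "a \<in> Cp p" by blast
    then show ?thesis using rC centD(1) by blast
  qed
  have cs: "subgroup (cent {r}) G" "closedin (tp G) (cent {r})"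
    using cent_subgroup[of "{r}"] cent_closed[OF Haus, of "{r}"] rc by auto
  have "?A \<subseteq> cent {r}"
  proof
    fix a assume a: "a \<in> ?A"
    then have "a \<in> carrier G" by blast
    then show "a \<in> cent {r}" using com[OF a] by (simp add: cent_def)
  qed
  then have gA: "generate G ?A \<subseteq> cent {r}" by (rule generate_subgroup_incl[OF _ cs(1)])
  fix v assume v: "v \<in> U"
  have vc: "v \<in> carrier G" using v U_carrier by blast
  have "v \<in> tp G closure_of cent {r}"
    unfolding in_closure_iff[OF subgroup.subset[OF cs(1)]]
  proof (intro conjI allI impI vc)
    fix V assume V: "open_subgroup V G"
    obtain N where N: "nrm N" "N \<subseteq> V" using nrm_base[OF V] by blast
    obtain a where a: "a \<in> generate G ?A" "inv a \<otimes> v \<in> N"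
      using Up_dense[OF subgroup_self _ N(1) vc v] closedin_topspace[of "tp G"] by auto
    have ac: "a \<in> cent {r}" "a \<in> carrier G" using a gA by (auto simp: cent_def)
    have "inv (inv a \<otimes> v) \<in> V" using a(2) N(2) osubD(6)[OF V] by blast
    moreover have "v \<otimes> inv (inv a \<otimes> v) = a" using ac vc by (simp add: word_simps)
    ultimately show "\<exists>w\<in>V. v \<otimes> w \<in> cent {r}" using ac(1) by metis
  qed
  then have "v \<in> cent {r}" using cs(2) by (simp add: closure_of_closedin)
  then show "v \<otimes> r = r \<otimes> v" by (simp add: cent_def)
qed

text \<open>Finitely many coordinates are realized by a finite product of the \<open>a p\<close>;
  compactness of \<open>U\<close> gives an element with all of them.\<close>

lemma proj_surjective:
  assumes a: "\<And>p. Factorial_Ring.prime p \<Longrightarrow> a p \<in> R \<inter> Up p"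
  shows "\<exists>w\<in>R \<inter> U. \<forall>p. Factorial_Ring.prime p \<longrightarrow> proj p w = a p"
proof -
  \<comment> \<open>The elements whose coordinates below \<open>n\<close> are as prescribed. In
    terms of centralizers the condition is visibly closed.\<close>
  define K where "K n = (R \<inter> U) \<inter> {w \<in> carrier G. \<forall>p<n. Factorial_Ring.prime p \<longrightarrow> inv (a p) \<otimes> w \<in> cent (Cp p)}" for n :: nat
  have ac: "a p \<in> Rp p" "a p \<in> carrier G" "a p \<in> R \<inter> U" if "Factorial_Ring.prime p" for p
    using a[OF that] R_Up Rp_carrier UpVp_U by blast+
  have KD: "proj p w = a p" if "w \<in> K n" "p < n" "Factorial_Ring.prime p" for w n p
  proof (rule proj_split(2)[OF that(3)])
    have "inv (a p) \<otimes> w \<in> cent (Cp p)" "w \<in> carrier G" using that by (auto simp: K_def)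
    moreover then have "w = a p \<otimes> (inv (a p) \<otimes> w)" using ac[OF that(3)] by simp
    ultimately show "split p w (a p)" using ac(1)[OF that(3)] unfolding split_def by blast
  qed
  have "\<exists>x\<in>U. \<forall>n\<in>UNIV. x \<in> K n"
  proof (rule compact_directed[OF U(2)])
    show "closedin (tp G) (K n)" for n
    proof -
      have c: "closedin (tp G) {w \<in> carrier G. inv (a p) \<otimes> w \<in> cent (Cp p)}" if "Factorial_Ring.prime p" for p
      proof (rule closed_preimage)
        show "closedin (tp G) (cent (Cp p))" by (rule cent_closed[OF Haus]) (use Cp_carrier in blast)
        show "continuous_map (tp G) (tp G) (\<lambda>w. inv (a p) \<otimes> w)" using ac[OF that] by (intro cintros) auto
      qed
      have "K n = (R \<inter> U) \<inter> (carrier G \<inter> (\<Inter>p\<in>{p. p < n \<and> Factorial_Ring.prime p}. {w \<in> carrier G. inv (a p) \<otimes> w \<in> cent (Cp p)}))"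
        unfolding K_def by blast
      also have "\<dots> = (\<Inter>A\<in>{R \<inter> U, carrier G} \<union> (\<lambda>p. {w \<in> carrier G. inv (a p) \<otimes> w \<in> cent (Cp p)}) ` {p. p < n \<and> Factorial_Ring.prime p}. A)"
        by blast
      also have "closedin (tp G) \<dots>"
        by (rule closedin_Inter) (use c Rs(2) osub_closed[OF U(1)] closedin_topspace[of "tp G"] in auto)
      finally show ?thesis .
    qed
    \<comment> \<open>The induction also keeps the later coordinates trivial, so that multiplying by
      \<open>a n\<close> puts exactly \<open>a n\<close> in place \<open>n\<close> and changes
      nothing else.\<close>
    have "\<exists>w\<in>R \<inter> U. (\<forall>p<n. Factorial_Ring.prime p \<longrightarrow> proj p w = a p) \<and> (\<forall>p\<ge>n. Factorial_Ring.prime p \<longrightarrow> proj p w = \<one>)" for n :: nat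
    proof (induction n)
      case 0
      have "\<one> \<in> R \<inter> U" using subgroup.one_closed[OF Rs(1)] osubD(4)[OF U(1)] by blast
      then show ?case using proj_id subgroup.one_closed[OF Rp_subgroup] by (intro bexI[of _ \<one>]) auto
    next
      case (Suc n)
      then obtain w where w: "w \<in> R \<inter> U" "\<And>p. p < n \<Longrightarrow> Factorial_Ring.prime p \<Longrightarrow> proj p w = a p"
        "\<And>p. p \<ge> n \<Longrightarrow> Factorial_Ring.prime p \<Longrightarrow> proj p w = \<one>" by blast
      show ?case
      proof (cases "Factorial_Ring.prime n")
        case True
        have "w \<otimes> a n \<in> R \<inter> U" using w(1) ac(3)[OF True] subgroup.m_closed[OF Rs(1)] osubD(5)[OF U(1)] by blast
        moreover have pm: "proj p (w \<otimes> a n) = proj p w \<otimes> proj p (a n)" if "Factorial_Ring.prime p" for p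
          using proj_mult[OF that] w(1) ac(3)[OF True] by blast
        moreover have "proj n (a n) = a n" using proj_id[OF True] ac[OF True] by blast
        moreover have "proj p (a n) = \<one>" if "Factorial_Ring.prime p" "p \<noteq> n" for p using proj_other[OF that(1) True that(2)] ac[OF True] by blast
        ultimately show ?thesis
        proof (intro bexI[of _ "w \<otimes> a n"] conjI allI impI)
          fix p assume *: "p < Suc n" "Factorial_Ring.prime p"
          show "proj p (w \<otimes> a n) = a p"
          proof (cases "p = n")
            case True then show ?thesis using pm[OF *(2)] w(3)[of p] * ac(2)[of p] \<open>proj n (a n) = a n\<close> by simp
          next
            case False then show ?thesis using pm[OF *(2)] w(2)[of p] * ac(2)[of p] proj_other[OF *(2) \<open>Factorial_Ring.prime n\<close> False] ac(1)[OF \<open>Factorial_Ring.prime n\<close>] by simp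
          qed
        next
          fix p assume *: "p \<ge> Suc n" "Factorial_Ring.prime p"
          then show "proj p (w \<otimes> a n) = \<one>" using pm[OF *(2)] w(3)[of p] proj_other[OF *(2) \<open>Factorial_Ring.prime n\<close>] ac(1)[OF \<open>Factorial_Ring.prime n\<close>] by simp
        qed
      next
        case False
        show ?thesis
        proof (intro bexI[of _ w] conjI allI impI)
          fix p assume "p < Suc n" "Factorial_Ring.prime p"
          then show "proj p w = a p" using w(2)[of p] False by (cases "p = n") auto
        qed (use w in auto)
      qed
    qed
    then show "U \<inter> K n \<noteq> {}" for n
    proof -
      obtain w where w: "w \<in> R \<inter> U" "\<And>p. p < n \<Longrightarrow> Factorial_Ring.prime p \<Longrightarrow> proj p w = a p"
        using \<open>\<And>n. \<exists>w\<in>R \<inter> U. (\<forall>p<n. Factorial_Ring.prime p \<longrightarrow> proj p w = a p) \<and> (\<forall>p\<ge>n. Factorial_Ring.prime p \<longrightarrow> proj p w = \<one>)\<close>[of n] by blast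
      have wc: "w \<in> carrier G" using w(1) U_carrier by blast
      have "inv (a p) \<otimes> w \<in> cent (Cp p)" if p: "p < n" "Factorial_Ring.prime p" for p
      proof -
        obtain d where d: "d \<in> cent (Cp p)" "w = a p \<otimes> d"
          using proj_split(1)[OF p(2), of w] w(1) w(2)[OF p] by (auto simp: split_def)
        then show ?thesis using ac(2)[OF p(2)] cent_Cp(2) by simp
      qed
      then have "w \<in> K n" using w(1) wc by (simp add: K_def)
      then show ?thesis using w(1) by blast
    qed
    show "\<exists>k\<in>UNIV. K k \<subseteq> K i \<inter> K j" for i j
      by (rule bexI[of _ "max i j"]) (auto simp: K_def)
  qed auto
  then obtain w where w: "\<And>n. w \<in> K n" by blast
  have "w \<in> R \<inter> U" using w[of 0] by (simp add: K_def)
  moreover have "proj p w = a p" if "Factorial_Ring.prime p" for p using KD[OF w[of "Suc p"] _ that] by simp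
  ultimately show ?thesis by blast
qed

text \<open>The elements with this property form a subgroup. It contains each \<open>Rp q\<close>,
  whose elements have a single non-trivial coordinate, and \<open>R \<inter> U\<close>, where all
  coordinates lie in \<open>U\<close>; so it is all of \<open>R\<close> by
  \<open>R_decomp\<close>.\<close>

lemma proj_almost_all:
  assumes r: "r \<in> R" shows "\<exists>n. \<forall>p\<ge>n. Factorial_Ring.prime p \<longrightarrow> proj p r \<in> U"
proof -
  let ?X = "{r \<in> R. \<exists>n. \<forall>p\<ge>n. Factorial_Ring.prime p \<longrightarrow> proj p r \<in> U}"
  have pinv: "proj p (inv x) = inv (proj p x)" if "Factorial_Ring.prime p" "x \<in> R" for p x
    using proj_split(2)[OF that(1) split_inv[OF proj_split(1)[OF that]]] .
  have X: "subgroup ?X G"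
  proof (rule subgroupI)
    show "?X \<subseteq> carrier G" using Rs by blast
    have "proj p \<one> = \<one>" if "Factorial_Ring.prime p" for p using proj_id[OF that subgroup.one_closed[OF Rp_subgroup]] .
    then have "\<one> \<in> ?X" using subgroup.one_closed[OF Rs(1)] osubD(4)[OF U(1)] by simp
    then show "?X \<noteq> {}" by blast
    fix x assume "x \<in> ?X"
    then obtain n where x: "x \<in> R" and n: "\<And>p. p \<ge> n \<Longrightarrow> Factorial_Ring.prime p \<Longrightarrow> proj p x \<in> U" by blast
    have "\<forall>p\<ge>n. Factorial_Ring.prime p \<longrightarrow> proj p (inv x) \<in> U" using n pinv[OF _ x] osubD(6)[OF U(1)] by simp
    then show "inv x \<in> ?X" using subgroup.m_inv_closed[OF Rs(1) x] by blast
    fix y assume "y \<in> ?X"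
    then obtain m where y: "y \<in> R" and m: "\<And>p. p \<ge> m \<Longrightarrow> Factorial_Ring.prime p \<Longrightarrow> proj p y \<in> U" by blast
    have "\<forall>p\<ge>max m n. Factorial_Ring.prime p \<longrightarrow> proj p (x \<otimes> y) \<in> U"
      using n m proj_mult[OF _ x y] osubD(5)[OF U(1)] by simp
    then show "x \<otimes> y \<in> ?X" using subgroup.m_closed[OF Rs(1) x y] by blast
  qed
  have "Rp q \<subseteq> ?X" if q: "Factorial_Ring.prime q" for q
  proof
    fix x assume x: "x \<in> Rp q"
    have "proj p x \<in> U" if "p \<ge> Suc q" "Factorial_Ring.prime p" for p
      using proj_other[OF that(2) q _ x] that(1) osubD(4)[OF U(1)] by simp
    then show "x \<in> ?X" using x by (auto simp: Rp_def)
  qed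
  then have "T \<subseteq> ?X" unfolding T_def by (intro generate_subgroup_incl[OF _ X]) blast
  moreover have "R \<inter> U \<subseteq> ?X" using proj_U UpVp_U by blast
  ultimately show ?thesis using R_decomp[OF r] subgroup.m_closed[OF X] by blast
qed

end

section \<open>Local direct products\<close>

lemma topspace_ldp_S:
  assumes "\<And>p. p \<in> \<pi> \<Longrightarrow> topspace (tp (K p)) = carrier (K p)" "\<And>p. p \<in> \<pi> \<Longrightarrow> V p \<subseteq> carrier (K p)"
  shows "topspace (ldp_S \<pi> K V n) = (\<Pi>\<^sub>E p\<in>\<pi>. if p < n then carrier (K p) else V p)"
proof -
  have "topspace (if p < n then tp (K p) else subtopology (tp (K p)) (V p)) = (if p < n then carrier (K p) else V p)"
    if "p \<in> \<pi>" for p using assms(1,2)[OF that] by auto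
  then show ?thesis unfolding ldp_S_def topspace_product_topology by (intro PiE_cong) simp
qed

lemma openin_ldp:
  "openin (tp (ldp \<pi> K V)) W \<longleftrightarrow> W \<subseteq> (\<Union>n. topspace (ldp_S \<pi> K V n)) \<and>
     (\<forall>n. openin (ldp_S \<pi> K V n) (W \<inter> topspace (ldp_S \<pi> K V n)))"
proof -
  have "istopology (\<lambda>W. W \<subseteq> (\<Union>n. topspace (ldp_S \<pi> K V n)) \<and> (\<forall>n. openin (ldp_S \<pi> K V n) (W \<inter> topspace (ldp_S \<pi> K V n))))"
    unfolding istopology_def
  proof (intro conjI allI impI)
    fix S S' n
    assume "S \<subseteq> (\<Union>n. topspace (ldp_S \<pi> K V n)) \<and> (\<forall>n. openin (ldp_S \<pi> K V n) (S \<inter> topspace (ldp_S \<pi> K V n)))"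
      "S' \<subseteq> (\<Union>n. topspace (ldp_S \<pi> K V n)) \<and> (\<forall>n. openin (ldp_S \<pi> K V n) (S' \<inter> topspace (ldp_S \<pi> K V n)))"
    moreover have "S \<inter> S' \<inter> topspace (ldp_S \<pi> K V n) = (S \<inter> topspace (ldp_S \<pi> K V n)) \<inter> (S' \<inter> topspace (ldp_S \<pi> K V n))" by blast
    ultimately show "openin (ldp_S \<pi> K V n) (S \<inter> S' \<inter> topspace (ldp_S \<pi> K V n))"
      using openin_Int by metis
  next
    fix F n
    assume F: "\<forall>S\<in>F. S \<subseteq> (\<Union>n. topspace (ldp_S \<pi> K V n)) \<and> (\<forall>n. openin (ldp_S \<pi> K V n) (S \<inter> topspace (ldp_S \<pi> K V n)))"
    have "\<Union>F \<inter> topspace (ldp_S \<pi> K V n) = (\<Union>S\<in>F. S \<inter> topspace (ldp_S \<pi> K V n))" by blast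
    moreover have "openin (ldp_S \<pi> K V n) (\<Union>S\<in>F. S \<inter> topspace (ldp_S \<pi> K V n))" by (rule openin_Union) (use F in blast)
    ultimately show "openin (ldp_S \<pi> K V n) (\<Union>F \<inter> topspace (ldp_S \<pi> K V n))" by simp
  qed blast+
  then show ?thesis by (simp add: ldp_def topology_inverse')
qed

lemma topspace_ldp: "topspace (tp (ldp \<pi> K V)) = carrier (ldp \<pi> K V)"
proof -
  have c: "carrier (ldp \<pi> K V) = (\<Union>n. topspace (ldp_S \<pi> K V n))" by (simp add: ldp_def)
  have "openin (tp (ldp \<pi> K V)) (carrier (ldp \<pi> K V))"
    unfolding openin_ldp c
  proof (intro conjI allI)
    fix n
    have "(\<Union>n. topspace (ldp_S \<pi> K V n)) \<inter> topspace (ldp_S \<pi> K V n) = topspace (ldp_S \<pi> K V n)" by blast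
    then show "openin (ldp_S \<pi> K V n) ((\<Union>n. topspace (ldp_S \<pi> K V n)) \<inter> topspace (ldp_S \<pi> K V n))" by simp
  qed simp
  moreover have "topspace (tp (ldp \<pi> K V)) \<subseteq> carrier (ldp \<pi> K V)"
    using openin_ldp[of \<pi> K V "topspace (tp (ldp \<pi> K V))"] openin_topspace c by blast
  ultimately show ?thesis using openin_subset by blast
qed

text \<open>A recognition criterion for local direct products. \<open>inj\<close>, \<open>fW\<close>
  and \<open>surjW\<close> identify the compact open subgroup \<open>W\<close> with the product of
  the \<open>V p\<close>; \<open>almost\<close> and \<open>single\<close> control what lies outside
  \<open>W\<close>.\<close>

locale ldp_coordinates = topgroup G for G :: "'a tgroup" (structure) +
  fixes W :: "'a set" and \<pi> :: "nat set" and K :: "nat \<Rightarrow> 'b tgroup" and V :: "nat \<Rightarrow> 'b set"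
    and f :: "nat \<Rightarrow> 'a \<Rightarrow> 'b"
  assumes W: "open_subgroup W G" "compactin (tp G) W"
    and K: "\<And>p. p \<in> \<pi> \<Longrightarrow> topgroup (K p)" "\<And>p. p \<in> \<pi> \<Longrightarrow> Hausdorff_space (tp (K p))"
    and V: "\<And>p. p \<in> \<pi> \<Longrightarrow> open_subgroup (V p) (K p)"
    and f: "\<And>p. p \<in> \<pi> \<Longrightarrow> f p \<in> hom G (K p)" "\<And>p. p \<in> \<pi> \<Longrightarrow> continuous_map (tp G) (tp (K p)) (f p)"
    and fW: "\<And>p x. p \<in> \<pi> \<Longrightarrow> x \<in> W \<Longrightarrow> f p x \<in> V p"
    and inj: "\<And>x. x \<in> carrier G \<Longrightarrow> (\<And>p. p \<in> \<pi> \<Longrightarrow> f p x = \<one>\<^bsub>K p\<^esub>) \<Longrightarrow> x = \<one>"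
    and almost: "\<And>x. x \<in> carrier G \<Longrightarrow> \<exists>n. \<forall>p\<in>\<pi>. p \<ge> n \<longrightarrow> f p x \<in> V p"
    and surjW: "\<And>a. (\<And>p. p \<in> \<pi> \<Longrightarrow> a p \<in> V p) \<Longrightarrow> \<exists>w\<in>W. \<forall>p\<in>\<pi>. f p w = a p"
    and single: "\<And>q k. q \<in> \<pi> \<Longrightarrow> k \<in> carrier (K q) \<Longrightarrow> \<exists>x\<in>carrier G. f q x = k \<and> (\<forall>p\<in>\<pi>. p \<noteq> q \<longrightarrow> f p x = \<one>\<^bsub>K p\<^esub>)"
begin

abbreviation "S n \<equiv> ldp_S \<pi> K V n"

definition F :: "'a \<Rightarrow> nat \<Rightarrow> 'b" where "F x = (\<lambda>p\<in>\<pi>. f p x)"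

lemma grp: "p \<in> \<pi> \<Longrightarrow> group (K p)" using K(1) by (simp add: topgroup_def)
lemma gh: "p \<in> \<pi> \<Longrightarrow> group_hom G (K p) (f p)"
  using f(1) grp is_group by (simp add: group_hom_def group_hom_axioms_def)
lemma Vc: "p \<in> \<pi> \<Longrightarrow> V p \<subseteq> carrier (K p)" using V subgroup.subset unfolding open_subgroup_def by blast
lemma fc: "p \<in> \<pi> \<Longrightarrow> x \<in> carrier G \<Longrightarrow> f p x \<in> carrier (K p)" using group_hom.hom_closed[OF gh] .
lemma fm: "p \<in> \<pi> \<Longrightarrow> x \<in> carrier G \<Longrightarrow> y \<in> carrier G \<Longrightarrow> f p (x \<otimes> y) = f p x \<otimes>\<^bsub>K p\<^esub> f p y"
  using group_hom.hom_mult[OF gh] .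
lemma fi: "p \<in> \<pi> \<Longrightarrow> x \<in> carrier G \<Longrightarrow> f p (inv x) = inv\<^bsub>K p\<^esub> f p x" using group_hom.hom_inv[OF gh] .
lemma Vsub: "p \<in> \<pi> \<Longrightarrow> subgroup (V p) (K p)" using V by (simp add: open_subgroup_def)
lemma Wc: "w \<in> W \<Longrightarrow> w \<in> carrier G" using osubD(7)[OF W(1)] .

lemma tsS: "topspace (S n) = (\<Pi>\<^sub>E p\<in>\<pi>. if p < n then carrier (K p) else V p)"
  by (rule topspace_ldp_S) (use topgroup.topspace_tp[OF K(1)] Vc in auto)

lemma in_S: "g \<in> topspace (S n) \<longleftrightarrow> g \<in> extensional \<pi> \<and> (\<forall>p\<in>\<pi>. g p \<in> carrier (K p)) \<and> (\<forall>p\<in>\<pi>. p \<ge> n \<longrightarrow> g p \<in> V p)"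
proof
  assume "g \<in> topspace (S n)"
  then have h: "g \<in> extensional \<pi>" "\<And>p. p \<in> \<pi> \<Longrightarrow> g p \<in> (if p < n then carrier (K p) else V p)"
    unfolding tsS PiE_iff by auto
  have "g p \<in> carrier (K p)" if "p \<in> \<pi>" for p using h(2)[OF that] Vc[OF that] by (auto split: if_splits)
  moreover have "g p \<in> V p" if "p \<in> \<pi>" "p \<ge> n" for p using h(2)[OF that(1)] that(2) by simp
  ultimately show "g \<in> extensional \<pi> \<and> (\<forall>p\<in>\<pi>. g p \<in> carrier (K p)) \<and> (\<forall>p\<in>\<pi>. p \<ge> n \<longrightarrow> g p \<in> V p)"
    using h(1) by blast
qed (auto simp: tsS PiE_iff)

lemma carrier_ldp: "carrier (ldp \<pi> K V) = (\<Union>n. topspace (S n))" by (simp add: ldp_def)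

lemma F_in: assumes "x \<in> carrier G" shows "F x \<in> carrier (ldp \<pi> K V)"
proof -
  obtain n where "\<forall>p\<in>\<pi>. p \<ge> n \<longrightarrow> f p x \<in> V p" using almost[OF assms] by blast
  then have "F x \<in> topspace (S n)" unfolding in_S using fc[OF _ assms] by (auto simp: F_def)
  then show ?thesis unfolding carrier_ldp by blast
qed

lemma F_hom: "F \<in> hom G (ldp \<pi> K V)"
proof (rule homI)
  fix x y assume "x \<in> carrier G" "y \<in> carrier G"
  then show "F (x \<otimes> y) = F x \<otimes>\<^bsub>ldp \<pi> K V\<^esub> F y" by (auto simp: F_def ldp_def fm fun_eq_iff)
qed (rule F_in)

lemma F_inj: "inj_on F (carrier G)"
proof (rule inj_onI)
  fix x y assume xy: "x \<in> carrier G" "y \<in> carrier G" "F x = F y"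
  have "inv x \<otimes> y = \<one>"
  proof (rule inj)
    fix p assume p: "p \<in> \<pi>"
    interpret Kp: group "K p" by (rule grp[OF p])
    have "f p x = f p y" using fun_cong[OF xy(3), of p] p by (simp add: F_def)
    then show "f p (inv x \<otimes> y) = \<one>\<^bsub>K p\<^esub>" using p xy fm fi fc by simp
  qed (use xy in simp)
  then have "x \<otimes> (inv x \<otimes> y) = x" using xy by simp
  then show "x = y" using xy by simp
qed

text \<open>Stage 0 is the image of \<open>W\<close>. At stage \<open>Suc n\<close> the coordinate
  \<open>n\<close>, if it belongs to the index set, is replaced by the identity to reach stage
  \<open>n\<close>, and is put back by multiplying with an element from
  \<open>single\<close>.\<close>

lemma F_surj: "g \<in> topspace (S n) \<Longrightarrow> \<exists>x\<in>carrier G. F x = g"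
proof (induction n arbitrary: g)
  case 0
  then have g: "g \<in> extensional \<pi>" "\<And>p. p \<in> \<pi> \<Longrightarrow> g p \<in> V p" unfolding in_S by auto
  obtain w where "w \<in> W" "\<forall>p\<in>\<pi>. f p w = g p" using surjW[of g] g(2) by blast
  then show ?case using g(1) Wc by (intro bexI[of _ w]) (auto simp: F_def extensional_def fun_eq_iff)
next
  case (Suc n)
  show ?case
  proof (cases "n \<in> \<pi>")
    case False
    have "g p \<in> V p" if "p \<in> \<pi>" "p \<ge> n" for p
      using Suc.prems that False unfolding in_S by (cases "p = n") auto
    then have "g \<in> topspace (S n)" using Suc.prems unfolding in_S by blast
    then show ?thesis by (rule Suc.IH)
  next
    case True
    define g' where "g' = g(n := \<one>\<^bsub>K n\<^esub>)"
    have "g' \<in> topspace (S n)"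
      using Suc.prems True subgroup.one_closed[OF Vsub] Vc[OF True] unfolding in_S g'_def
      by (auto simp: extensional_def)
    then obtain x where x: "x \<in> carrier G" "F x = g'" using Suc.IH by blast
    have "g n \<in> carrier (K n)" using Suc.prems True unfolding in_S by blast
    then obtain y where y: "y \<in> carrier G" "f n y = g n" "\<And>p. p \<in> \<pi> \<Longrightarrow> p \<noteq> n \<Longrightarrow> f p y = \<one>\<^bsub>K p\<^esub>"
      using single[OF True] by blast
    have "F (x \<otimes> y) p = g p" for p
    proof (cases "p \<in> \<pi>")
      case p: True
      interpret Kp: group "K p" by (rule grp[OF p])
      have fx: "f p x = g' p" using fun_cong[OF x(2), of p] p by (simp add: F_def)
      have gc: "g p \<in> carrier (K p)" using Suc.prems p unfolding in_S by blast
      show ?thesis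
      proof (cases "p = n")
        case True then show ?thesis using p fm[OF p x(1) y(1)] fx y(2) Kp.l_one[OF gc] by (simp add: F_def g'_def)
      next
        case False then show ?thesis using p fm[OF p x(1) y(1)] fx y(3)[OF p False] gc by (simp add: F_def g'_def)
      qed
    next
      case False then show ?thesis using Suc.prems unfolding in_S by (auto simp: F_def extensional_def)
    qed
    then show ?thesis using x(1) y(1) by (intro bexI[of _ "x \<otimes> y"]) auto
  qed
qed

lemma F_image: "F ` carrier G = carrier (ldp \<pi> K V)"
proof
  show "F ` carrier G \<subseteq> carrier (ldp \<pi> K V)" using F_in by blast
  show "carrier (ldp \<pi> K V) \<subseteq> F ` carrier G" unfolding carrier_ldp using F_surj by blast
qed

lemma proj_cont:
  assumes "p \<in> \<pi>" shows "continuous_map (S n) (tp (K p)) (\<lambda>g. g p)"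
proof -
  have "continuous_map (S n) (if p < n then tp (K p) else subtopology (tp (K p)) (V p)) (\<lambda>g. g p)"
    unfolding ldp_S_def by (rule continuous_map_product_projection[OF assms])
  then show ?thesis by (auto split: if_splits simp: continuous_map_in_subtopology)
qed

lemma into_S:
  assumes g: "\<And>x. x \<in> topspace X' \<Longrightarrow> g x \<in> extensional \<pi>"
    and c: "\<And>p. p \<in> \<pi> \<Longrightarrow> continuous_map X' (tp (K p)) (\<lambda>x. g x p)"
    and v: "\<And>p x. p \<in> \<pi> \<Longrightarrow> p \<ge> n \<Longrightarrow> x \<in> topspace X' \<Longrightarrow> g x p \<in> V p"
  shows "continuous_map X' (S n) g"
  unfolding ldp_S_def continuous_map_componentwise
proof (intro conjI ballI)
  show "g ` topspace X' \<subseteq> extensional \<pi>" using g by blast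
  fix p assume p: "p \<in> \<pi>"
  show "continuous_map X' (if p < n then tp (K p) else subtopology (tp (K p)) (V p)) (\<lambda>x. g x p)"
    using c[OF p] v[OF p] by (auto simp: continuous_map_in_subtopology)
qed

text \<open>All of the neighbourhood \<open>x W\<close> is mapped into one stage \<open>S n\<close>,
  because the coordinates of \<open>W\<close> lie in the \<open>V p\<close>. There continuity can be
  checked coordinate by coordinate.\<close>

lemma F_continuous: "continuous_map (tp G) (tp (ldp \<pi> K V)) F"
  unfolding continuous_map
proof (intro conjI allI impI)
  show "F ` topspace (tp G) \<subseteq> topspace (tp (ldp \<pi> K V))" using F_in by (auto simp: topspace_ldp)
  fix A assume A: "openin (tp (ldp \<pi> K V)) A"
  have "\<exists>T. openin (tp G) T \<and> x \<in> T \<and> T \<subseteq> {x \<in> carrier G. F x \<in> A}" if x: "x \<in> carrier G" "F x \<in> A" for x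
  proof -
    obtain n where n: "\<forall>p\<in>\<pi>. p \<ge> n \<longrightarrow> f p x \<in> V p" using almost[OF x(1)] by blast
    let ?X = "subtopology (tp G) W"
    have ts: "topspace ?X = W" using Wc by auto
    have "continuous_map ?X (S n) (\<lambda>w. F (x \<otimes> w))"
    proof (rule into_S)
      fix p assume p: "p \<in> \<pi>"
      have "continuous_map (tp G) (tp (K p)) (f p \<circ> (\<lambda>w. x \<otimes> w))"
        by (rule continuous_map_compose[OF _ f(2)[OF p]], intro cintros) (use x in auto)
      then have "continuous_map ?X (tp (K p)) (\<lambda>w. f p (x \<otimes> w))"
        by (simp add: o_def continuous_map_from_subtopology)
      then show "continuous_map ?X (tp (K p)) (\<lambda>w. F (x \<otimes> w) p)" using p by (simp add: F_def)
      fix w assume "n \<le> p" "w \<in> topspace ?X"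
      then show "F (x \<otimes> w) p \<in> V p" using p n fm[OF p x(1) Wc] fW[OF p] subgroup.m_closed[OF Vsub[OF p]] ts by (simp add: F_def)
    qed (simp add: F_def)
    moreover have "openin (S n) (A \<inter> topspace (S n))" using A unfolding openin_ldp by blast
    ultimately have o: "openin ?X {w \<in> topspace ?X. F (x \<otimes> w) \<in> A \<inter> topspace (S n)}" by (rule openin_continuous_map_preimage)
    define B where "B = {w \<in> topspace ?X. F (x \<otimes> w) \<in> A \<inter> topspace (S n)}"
    have Bo: "openin (tp G) B" using o osubD(2)[OF W(1)] unfolding B_def by (rule openin_trans_full)
    have oB: "openin (tp G) {y \<in> carrier G. inv x \<otimes> y \<in> B}"
      by (rule open_preimage[OF _ Bo], intro cintros) (use x in auto)
    have "F x \<in> topspace (S n)" unfolding in_S using n fc[OF _ x(1)] by (auto simp: F_def)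
    then have "\<one> \<in> B" using x osubD(4)[OF W(1)] ts by (simp add: B_def)
    moreover have "F y \<in> A" if "y \<in> carrier G" "inv x \<otimes> y \<in> B" for y
      using that x unfolding B_def by simp
    ultimately show ?thesis using oB x by (intro exI[of _ "{y \<in> carrier G. inv x \<otimes> y \<in> B}"]) auto
  qed
  then have "openin (tp G) {x \<in> carrier G. F x \<in> A}" by (subst openin_subopen) blast
  then show "openin (tp G) {x \<in> topspace (tp G). F x \<in> A}" by simp
qed

text \<open>A continuous bijection from a compact space onto a Hausdorff one. This is the source of
  openness of \<open>F\<close>.\<close>

lemma F_homeo_W: "homeomorphic_map (subtopology (tp G) W) (S 0) F"
proof (rule continuous_imp_homeomorphic_map)
  let ?X = "subtopology (tp G) W"
  have ts: "topspace ?X = W" using Wc by auto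
  show "continuous_map ?X (S 0) F"
  proof (rule into_S)
    fix p assume p: "p \<in> \<pi>"
    show "continuous_map ?X (tp (K p)) (\<lambda>w. F w p)" using p continuous_map_from_subtopology[OF f(2)[OF p]] by (simp add: F_def)
    fix w assume "w \<in> topspace ?X"
    then show "F w p \<in> V p" using p fW ts by (simp add: F_def)
  qed (simp add: F_def)
  show "compact_space ?X" by (rule compact_space_subtopology[OF W(2)])
  show "Hausdorff_space (S 0)"
    unfolding ldp_S_def Hausdorff_space_product_topology using K(2) by (auto intro!: Hausdorff_space_subtopology)
  show "inj_on F (topspace ?X)" using F_inj Wc unfolding ts inj_on_def by blast
  show "F ` topspace ?X = topspace (S 0)"
  proof
    show "F ` topspace ?X \<subseteq> topspace (S 0)" unfolding ts in_S subset_iff using fc[OF _ Wc] fW by (auto simp: F_def in_S)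
    show "topspace (S 0) \<subseteq> F ` topspace ?X"
    proof
      fix g assume "g \<in> topspace (S 0)"
      then have g: "g \<in> extensional \<pi>" "\<And>p. p \<in> \<pi> \<Longrightarrow> g p \<in> V p" unfolding in_S by auto
      obtain w where w: "w \<in> W" "\<forall>p\<in>\<pi>. f p w = g p" using surjW[of g] g(2) by blast
      then have "F w = g" using g(1) by (auto simp: F_def extensional_def fun_eq_iff)
      then show "g \<in> F ` topspace ?X" using w(1) ts by blast
    qed
  qed
qed

text \<open>Openness must be verified in every stage \<open>S n\<close>. Near
  \<open>g = F x\<close>, left division by \<open>g\<close> leads from \<open>S n\<close> to
  \<open>S 0\<close>, where \<open>F_homeo_W\<close> applies.\<close>

lemma F_open: "open_map (tp G) (tp (ldp \<pi> K V)) F"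
  unfolding open_map_def
proof (intro allI impI)
  fix A assume A: "openin (tp G) A"
  have Ac: "A \<subseteq> carrier G" using openin_subset[OF A] by simp
  have "openin (S n) (F ` A \<inter> topspace (S n))" for n
  proof (subst openin_subopen, intro ballI)
    fix g assume g: "g \<in> F ` A \<inter> topspace (S n)"
    then obtain x where x: "x \<in> A" "g = F x" by blast
    have xc: "x \<in> carrier G" using x Ac by blast
    have gp: "g p = f p x" if "p \<in> \<pi>" for p using x that by (simp add: F_def)
    have gS: "g \<in> topspace (S n)" using g by blast
    have gc: "g p \<in> carrier (K p)" if "p \<in> \<pi>" for p using gS that unfolding in_S by blast
    have gV: "g p \<in> V p" if "p \<in> \<pi>" "p \<ge> n" for p using gS that unfolding in_S by blast
    define D where "D = W \<inter> {w \<in> carrier G. x \<otimes> w \<in> A}"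
    have "openin (tp G) {w \<in> carrier G. x \<otimes> w \<in> A}"
      by (rule open_preimage[OF _ A], intro cintros) (use xc in auto)
    then have "openin (subtopology (tp G) W) D" unfolding D_def by (rule openin_subtopology_Int2)
    then have FD: "openin (S 0) (F ` D)" using homeomorphic_imp_open_map[OF F_homeo_W] by (simp add: open_map_def)
    \<comment> \<open>The points of stage \<open>n\<close> that left division by \<open>g\<close>
      takes into stage 0. Only the finitely many coordinates below \<open>n\<close> impose a
      condition, so \<open>Y\<close> is open.\<close>
    define Y where "Y = (\<Inter>p\<in>{p \<in> \<pi>. p < n}. {h \<in> topspace (S n). inv\<^bsub>K p\<^esub> (g p) \<otimes>\<^bsub>K p\<^esub> h p \<in> V p}) \<inter> topspace (S n)"
    have cm: "continuous_map (S n) (tp (K p)) (\<lambda>h. inv\<^bsub>K p\<^esub> (g p) \<otimes>\<^bsub>K p\<^esub> h p)" if p: "p \<in> \<pi>" for p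
    proof -
      interpret Kp: topgroup "K p" by (rule K(1)[OF p])
      show ?thesis by (intro Kp.cmult proj_cont[OF p]) (use gc[OF p] in simp)
    qed
    have Yo: "openin (S n) Y"
      unfolding Y_def
    proof (rule openin_INT)
      show "finite {p \<in> \<pi>. p < n}" by simp
      fix p assume "p \<in> {p \<in> \<pi>. p < n}"
      then have p: "p \<in> \<pi>" by blast
      show "openin (S n) {h \<in> topspace (S n). inv\<^bsub>K p\<^esub> (g p) \<otimes>\<^bsub>K p\<^esub> h p \<in> V p}"
        by (rule openin_continuous_map_preimage[OF cm[OF p]]) (use V[OF p] in \<open>simp add: open_subgroup_def\<close>)
    qed
    define \<psi> where "\<psi> h = (\<lambda>p\<in>\<pi>. inv\<^bsub>K p\<^esub> (g p) \<otimes>\<^bsub>K p\<^esub> h p)" for h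
    let ?Y = "subtopology (S n) Y"
    have tsY: "topspace ?Y = Y" by (auto simp: Y_def)
    have "continuous_map ?Y (S 0) \<psi>"
    proof (rule into_S)
      fix p assume p: "p \<in> \<pi>"
      show "continuous_map ?Y (tp (K p)) (\<lambda>h. \<psi> h p)" using p continuous_map_from_subtopology[OF cm[OF p]] by (simp add: \<psi>_def)
      fix h assume "h \<in> topspace ?Y"
      then have h: "h \<in> Y" "h \<in> topspace (S n)" using tsY by auto
      show "\<psi> h p \<in> V p"
      proof (cases "p < n")
        case True then show ?thesis using h(1) p by (simp add: Y_def \<psi>_def)
      next
        case False
        then have "h p \<in> V p" using h(2) p by (auto simp: in_S)
        then show ?thesis using p False gV[OF p] subgroup.m_closed[OF Vsub[OF p]] subgroup.m_inv_closed[OF Vsub[OF p]] by (simp add: \<psi>_def)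
      qed
    qed (simp add: \<psi>_def)
    then have "openin ?Y {h \<in> topspace ?Y. \<psi> h \<in> F ` D}" using FD by (rule openin_continuous_map_preimage)
    then have Bo: "openin (S n) {h \<in> Y. \<psi> h \<in> F ` D}" using Yo unfolding tsY by (rule openin_trans_full)
    \<comment> \<open>If \<open>g\<close> divided into \<open>h\<close> is \<open>F w\<close> with
      \<open>w \<in> D\<close>, then \<open>h = F (x w)\<close>, and \<open>x w \<in> A\<close> by
      the choice of \<open>D\<close>.\<close>
    have "{h \<in> Y. \<psi> h \<in> F ` D} \<subseteq> F ` A \<inter> topspace (S n)"
    proof
      fix h assume h: "h \<in> {h \<in> Y. \<psi> h \<in> F ` D}"
      then have hS: "h \<in> topspace (S n)" by (auto simp: Y_def)
      obtain w where w: "w \<in> D" "\<psi> h = F w" using h by blast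
      have wc: "w \<in> carrier G" "x \<otimes> w \<in> A" using w(1) by (auto simp: D_def)
      have "F (x \<otimes> w) p = h p" for p
      proof (cases "p \<in> \<pi>")
        case p: True
        interpret Kp: group "K p" by (rule grp[OF p])
        have hp: "h p \<in> carrier (K p)" using hS p unfolding in_S by blast
        have "f p w = inv\<^bsub>K p\<^esub> (g p) \<otimes>\<^bsub>K p\<^esub> h p" using fun_cong[OF w(2), of p] p by (simp add: F_def \<psi>_def)
        then show ?thesis using p fm[OF p xc wc(1)] gp[OF p] gc[OF p] hp by (simp add: F_def)
      next
        case False then show ?thesis using hS unfolding in_S by (auto simp: F_def extensional_def)
      qed
      then have "F (x \<otimes> w) = h" by blast
      then show "h \<in> F ` A \<inter> topspace (S n)" using wc(2) hS by blast
    qed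
    moreover have "g \<in> {h \<in> Y. \<psi> h \<in> F ` D}"
    proof -
      have e: "inv\<^bsub>K p\<^esub> (g p) \<otimes>\<^bsub>K p\<^esub> g p = \<one>\<^bsub>K p\<^esub>" if "p \<in> \<pi>" for p
        using group.l_inv[OF grp[OF that] gc[OF that]] .
      have "g \<in> Y" using g e subgroup.one_closed[OF Vsub] by (auto simp: Y_def)
      moreover have "\<psi> g = F \<one>" using e group_hom.hom_one[OF gh] by (auto simp: \<psi>_def F_def fun_eq_iff)
      moreover have "\<one> \<in> D" using osubD(4)[OF W(1)] x(1) xc by (simp add: D_def)
      ultimately show ?thesis by blast
    qed
    ultimately show "\<exists>T. openin (S n) T \<and> g \<in> T \<and> T \<subseteq> F ` A \<inter> topspace (S n)" using Bo by blast
  qed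
  then show "openin (tp (ldp \<pi> K V)) (F ` A)" unfolding openin_ldp carrier_ldp[symmetric] using Ac F_in by blast
qed

theorem iso_ldp: "tg_iso G (ldp \<pi> K V)"
proof -
  have "homeomorphic_map (tp G) (tp (ldp \<pi> K V)) F"
    by (rule bijective_open_imp_homeomorphic_map[OF F_continuous F_open]) (use F_image F_inj in \<open>simp_all add: topspace_ldp\<close>)
  then show ?thesis unfolding tg_iso_def bij_betw_def using F_hom F_inj F_image by blast
qed

end

section \<open>The structure theorem\<close>

text \<open>Were another prime \<open>q\<close> to divide the order, Sylow's theorem with exponent 1
  would give a subgroup of order \<open>q\<close>, and a non-trivial element of it would be killed
  by both \<open>q\<close> and a power of \<open>p\<close>.\<close>

lemma (in group) card_prime_power:
  assumes p: "Factorial_Ring.prime (p::nat)" and fin: "finite (carrier G)"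
    and t: "\<And>x. x \<in> carrier G \<Longrightarrow> \<exists>n. x [^] (p ^ n) = \<one>"
  shows "\<exists>k. card (carrier G) = p ^ k"
proof -
  have pos: "order G > 0" using fin order_gt_0_iff_finite by simp
  define k where "k = multiplicity p (order G)"
  define m where "m = order G div p ^ k"
  have nm: "order G = p ^ k * m" unfolding m_def k_def by (simp add: multiplicity_dvd)
  have pm: "\<not> p dvd m" unfolding m_def k_def
    using multiplicity_decompose[of "order G" p] pos p by (metis not_prime_unit not_gr_zero)
  have "m = 1"
  proof (rule ccontr)
    assume "m \<noteq> 1"
    then obtain q where q: "Factorial_Ring.prime q" "q dvd m" using prime_factor_nat by blast
    then obtain r where r: "m = q * r" by blast
    have "order G = q ^ 1 * (p ^ k * r)" using nm r by simp
    then obtain H where H: "subgroup H G" "card H = q ^ 1" using sylow_thm[OF q(1) is_group _ fin] by blast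
    have Hf: "finite H" using finite_subset[OF subgroup.subset[OF H(1)] fin] .
    have "H \<noteq> {\<one>}" using H(2) prime_gt_1_nat[OF q(1)] by auto
    then obtain x where x: "x \<in> H" "x \<noteq> \<one>" using subgroup.one_closed[OF H(1)] by blast
    have xc: "x \<in> carrier G" using subgroup.mem_carrier[OF H(1) x(1)] .
    interpret H: group "G\<lparr>carrier := H\<rparr>" by (rule subgroup.subgroup_is_group[OF H(1) is_group])
    have "x [^]\<^bsub>G\<lparr>carrier := H\<rparr>\<^esub> order (G\<lparr>carrier := H\<rparr>) = \<one>\<^bsub>G\<lparr>carrier := H\<rparr>\<^esub>"
      by (rule H.pow_order_eq_1) (use x in simp)
    then have xq: "x [^] q = \<one>" using H(2) nat_pow_consistent[of x q H] by (simp add: order_def)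
    obtain n where n: "x [^] (p ^ n) = \<one>" using t[OF xc] by blast
    have "q \<noteq> p" using q(2) pm by blast
    then have "coprime q (p ^ n)" using primes_coprime[OF q(1) p] by simp
    moreover have "x [^] gcd q (p ^ n) \<in> {\<one>}" by (rule subgroup_pow_gcd[OF triv_subgroup xc]) (use xq n in auto)
    ultimately show False using x(2) xc by simp
  qed
  then show ?thesis using nm by (auto simp: order_def)
qed

text \<open>Quotients by open normal subgroups are compact and discrete, hence finite, so
  \<open>card_prime_power\<close> reduces the index condition to torsion of single elements.\<close>

lemma pro_p_criterion:
  assumes p: "Factorial_Ring.prime p" and G: "profinite G"
    and t: "\<And>x N. x \<in> carrier G \<Longrightarrow> N \<lhd> G \<Longrightarrow> openin (tp G) N \<Longrightarrow> \<exists>n. x [^]\<^bsub>G\<^esub> (p ^ n) \<in> N"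
  shows "pro_p p G"
  unfolding pro_p_def
proof (intro conjI allI impI G)
  fix N assume N: "N \<lhd> G \<and> openin (tp G) N"
  have tG: "tdlcsc G" "compact_space (tp G)" using G by (simp_all add: profinite_def)
  interpret topgroup G by (rule tdlcsc_topgroup[OF tG(1)])
  interpret N: normal N G using N by blast
  let ?Q = "G Mod N"
  interpret Q: group ?Q by (rule N.factorgroup_is_group)
  interpret h: group_hom G ?Q "\<lambda>x. N #>\<^bsub>G\<^esub> x" by unfold_locales (use N.r_coset_hom_Mod in blast)
  note q = quot_hom_quottg[OF topgroup_axioms, of N]
  have d: "discrete_tg (quottg G N)" using discrete_if_kernel_open[OF q(1) tG(1)] q(2) N by simp
  have "profinite (quottg G N)"
    by (rule profinite_image[OF q(1)]) (use N G d in \<open>simp_all add: discrete_tg_def\<close>)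
  then have "finite (carrier (quottg G N))"
    using d by (simp add: profinite_def discrete_tg_def compact_space_discrete_topology)
  then have fin: "finite (carrier ?Q)" by (simp add: FactGroup_def)
  have "\<exists>n. y [^]\<^bsub>?Q\<^esub> (p ^ n) = \<one>\<^bsub>?Q\<^esub>" if y: "y \<in> carrier ?Q" for y
  proof -
    obtain x where x: "x \<in> carrier G" "y = N #>\<^bsub>G\<^esub> x" using y unfolding carrier_FactGroup by blast
    obtain n where n: "x [^]\<^bsub>G\<^esub> (p ^ n) \<in> N" using t[OF x(1)] N by blast
    have "y [^]\<^bsub>?Q\<^esub> (p ^ n) = N #>\<^bsub>G\<^esub> (x [^]\<^bsub>G\<^esub> (p ^ n))" using h.hom_nat_pow[OF x(1), of "p ^ n"] x(2) by simp
    also have "\<dots> = N" using coset_join2[OF _ N.subgroup_axioms n] x(1) by simp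
    finally show ?thesis by auto
  qed
  then have "\<exists>k. card (carrier ?Q) = p ^ k" by (rule Q.card_prime_power[OF p fin])
  then show "\<exists>k. card (rcosets\<^bsub>G\<^esub> N) = p ^ k" by (simp add: FactGroup_def)
qed

text \<open>The factors are stated on the fixed type of sets of naturals, so \<open>K p\<close> is a
  copy of \<open>Rp p\<close> along \<open>e p\<close>, and the coordinate maps are
  \<open>proj p\<close> followed by \<open>e p\<close>.\<close>

theorem (in residual_pronil_group) residual_is_ldp:
  assumes G: "tdlcsc G"
  shows "\<exists>(\<pi> :: nat set) (L :: nat \<Rightarrow> nat set tgroup) (V :: nat \<Rightarrow> nat set set).
    (\<forall>p\<in>\<pi>. Factorial_Ring.prime p \<and> tdlcsc (L p) \<and> locally_pro_p p (L p) \<and>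
        open_subgroup (V p) (L p) \<and> compactin (tp (L p)) (V p) \<and> pro_p p (subtg (L p) (V p))) \<and>
    tg_iso (subtg G R) (ldp \<pi> L V)"
proof -
  let ?L = "\<lambda>p. subtg G (Rp p)"
  have tL: "tdlcsc (?L p)" for p by (rule tdlcsc_subtg[OF G Rp_subgroup Rp_closed])
  have "\<exists>e (K :: nat set tgroup). quot_hom e (?L p) K \<and> inj_on e (Rp p) \<and> tdlcsc K" for p
    using tdlcsc_copy[OF tL[of p]] by (metis subtg_simps(1))
  then obtain e and K :: "nat \<Rightarrow> nat set tgroup"
    where e: "\<And>p. quot_hom (e p) (?L p) (K p)" "\<And>p. inj_on (e p) (Rp p)" "\<And>p. tdlcsc (K p)" by metis
  define A where "A p = R \<inter> Up p" for p
  define V where "V p = e p ` A p" for p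
  have A: "subgroup (A p) G" "A p \<subseteq> Rp p" for p
    unfolding A_def using subgroups_Inter_pair[OF Rs(1) Up_subgroup] R_Up by auto
  \<comment> \<open>This form shows that \<open>A p\<close> is open in \<open>Rp p\<close>; the
    defining one, \<open>R \<inter> Up p\<close>, that it is closed and consists of
    \<open>p\<close>-elements.\<close>
  have AU: "A p = Rp p \<inter> U" if "Factorial_Ring.prime p" for p
    unfolding A_def Rp_def using Cp_U[OF that] Up_sub_Cp UpVp_U by blast
  have sA: "subtg (?L p) (A p) = subtg G (A p)" for p by (rule subtg_subtg[OF A(2)])
  have AL: "subgroup (A p) (?L p)" for p using A subgroup_subtg_iff[OF Rp_subgroup] by simp
  have eA: "quot_hom (e p) (subtg G (A p)) (subtg (K p) (V p))" for p
    using quot_hom_restrict_sub(2)[OF e(1) _ AL] e(2) unfolding sA V_def by simp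
  have Vs: "subgroup (V p) (K p)" for p
    unfolding V_def using quot_hom_restrict_sub(1)[OF e(1) _ AL] e(2) by simp
  have Vo: "open_subgroup (V p) (K p)" if "Factorial_Ring.prime p" for p
  proof -
    have "openin (tp (?L p)) (A p)" using osubD(2)[OF U(1)] unfolding AU[OF that] by (auto simp: openin_subtopology)
    then show ?thesis using Vs quot_homD(7)[OF e(1)] unfolding open_subgroup_def open_map_def V_def by blast
  qed
  have Acl: "closedin (tp G) (A p)" for p unfolding A_def Up_def using Rs(2) tor_closed by blast
  have Acomp: "compactin (tp G) (A p)" for p
    by (rule closed_compactin[OF U(2) _ Acl]) (auto simp: A_def Up_def)
  have V_compact: "compactin (tp (K p)) (V p)" for p
    unfolding V_def by (rule image_compactin[OF _ quot_homD(6)[OF e(1)]]) (use Acomp A(2) in \<open>simp add: compactin_subtopology\<close>)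
  have pp: "pro_p p (subtg (K p) (V p))" if p: "Factorial_Ring.prime p" for p
  proof (rule pro_p_criterion[OF p])
    have "closedin (tp (K p)) (V p)" using V_compact e(3) compactin_imp_closedin by (auto simp: tdlcsc_def)
    then show "profinite (subtg (K p) (V p))"
      using tdlcsc_subtg[OF e(3) Vs] V_compact by (simp add: profinite_def compact_space_subtopology)
    fix x N assume x: "x \<in> carrier (subtg (K p) (V p))" and N: "N \<lhd> subtg (K p) (V p)" "openin (tp (subtg (K p) (V p))) N"
    obtain a where a: "a \<in> A p" "x = e p a" using x by (auto simp: V_def)
    have "openin (tp (subtg G (A p))) {y \<in> carrier (subtg G (A p)). e p y \<in> N}" by (rule quot_hom_preimage_open[OF eA N(2)])
    then obtain O' where O': "openin (tp G) O'" "{y \<in> A p. e p y \<in> N} = O' \<inter> A p" by (auto simp: openin_subtopology)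
    have "e p \<one> = \<one>\<^bsub>K p\<^esub>" using quot_homD(10)[OF eA] by simp
    moreover have "\<one>\<^bsub>K p\<^esub> \<in> N" using subgroup.one_closed[OF normal_imp_subgroup[OF N(1)]] by simp
    ultimately have "\<one> \<in> {y \<in> A p. e p y \<in> N}" using subgroup.one_closed[OF A(1)[of p]] by simp
    then have "\<one> \<in> O'" unfolding O'(2) by blast
    then obtain W where W: "open_subgroup W G" "W \<subseteq> O'" using base[OF O'(1)] by blast
    obtain n where n: "a [^] (p ^ n) \<in> W" using a(1) W(1) unfolding A_def Up_def tor_def by blast
    have "a [^] (p ^ n) \<in> A p" using subgroup_pow[OF A(1) a(1)] .
    then have "e p (a [^] (p ^ n)) \<in> N" using n W(2) O'(2) by blast
    moreover have "e p (a [^] (p ^ n)) = x [^]\<^bsub>subtg (K p) (V p)\<^esub> (p ^ n)"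
      using group_hom.hom_nat_pow[OF quot_homD(5)[OF eA[of p]], of a "p ^ n"] a by (simp add: pow_subtg)
    ultimately show "\<exists>n. x [^]\<^bsub>subtg (K p) (V p)\<^esub> (p ^ n) \<in> N" by auto
  qed
  let ?\<pi> = "{p. Factorial_Ring.prime (p::nat)}"
  interpret RG: topgroup "subtg G R" by (rule subtg_topgroup[OF Rs(1)])
  have pe: "proj p x \<in> Rp p" if "p \<in> ?\<pi>" "x \<in> R" for p x using proj_Rp that by simp
  have einj: "e p a = e p b \<longleftrightarrow> a = b" if "a \<in> Rp p" "b \<in> Rp p" for p a b using e(2)[of p] that by (auto simp: inj_on_def)
  have e1: "e p \<one> = \<one>\<^bsub>K p\<^esub>" for p using quot_homD(10)[OF e(1)] by simp
  have R1: "\<one> \<in> Rp p" for p using subgroup.one_closed[OF Rp_subgroup] .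
  interpret ldp_coordinates "subtg G R" "R \<inter> U" ?\<pi> K V "\<lambda>p x. e p (proj p x)"
  proof (intro ldp_coordinates.intro ldp_coordinates_axioms.intro RG.topgroup_axioms)
    show "open_subgroup (R \<inter> U) (subtg G R)"
      using subgroup_subtg_iff[OF Rs(1)] subgroups_Inter_pair[OF Rs(1) osubD(1)[OF U(1)]] osubD(2)[OF U(1)]
      by (auto simp: open_subgroup_def openin_subtopology)
    have "compactin (tp G) (R \<inter> U)" by (rule closed_compactin[OF U(2)]) (use Rs(2) osub_closed[OF U(1)] in auto)
    then show "compactin (tp (subtg G R)) (R \<inter> U)" by (simp add: compactin_subtopology)
    show "topgroup (K p)" "Hausdorff_space (tp (K p))" for p using e(3)[of p] tdlcsc_topgroup by (auto simp: tdlcsc_def)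
    show "open_subgroup (V p) (K p)" if "p \<in> ?\<pi>" for p using Vo that by simp
    show "(\<lambda>x. e p (proj p x)) \<in> hom (subtg G R) (K p)" if "p \<in> ?\<pi>" for p
    proof (rule homI)
      fix x y assume xy: "x \<in> carrier (subtg G R)" "y \<in> carrier (subtg G R)"
      then show "e p (proj p (x \<otimes>\<^bsub>subtg G R\<^esub> y)) = e p (proj p x) \<otimes>\<^bsub>K p\<^esub> e p (proj p y)"
        using proj_mult[of p x y] that pe[OF that] quot_homD(9)[OF e(1)[of p], of "proj p x" "proj p y"] by simp
    next
      fix x assume "x \<in> carrier (subtg G R)"
      then show "e p (proj p x) \<in> carrier (K p)" using quot_homD(8)[OF e(1)[of p]] pe[OF that] by simp
    qed
    show "continuous_map (tp (subtg G R)) (tp (K p)) (\<lambda>x. e p (proj p x))" if "p \<in> ?\<pi>" for p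
    proof -
      have "continuous_map (subtopology (tp G) R) (subtopology (tp G) (Rp p)) (proj p)"
        using proj_continuous[of p] pe[OF that] that Rs(3) by (auto simp: continuous_map_in_subtopology)
      from continuous_map_compose[OF this] quot_homD(6)[OF e(1)[of p]] show ?thesis by (simp add: o_def)
    qed
    show "e p (proj p x) \<in> V p" if "p \<in> ?\<pi>" "x \<in> R \<inter> U" for p x
      using that proj_small(2,3)[OF _ U(1), of p x] by (auto simp: V_def A_def)
    show "x = \<one>\<^bsub>subtg G R\<^esub>" if "x \<in> carrier (subtg G R)" "\<And>p. p \<in> ?\<pi> \<Longrightarrow> e p (proj p x) = \<one>\<^bsub>K p\<^esub>" for x
    proof -
      have "proj p x = \<one>" if p: "Factorial_Ring.prime p" for p
        using that \<open>\<And>p. p \<in> ?\<pi> \<Longrightarrow> e p (proj p x) = \<one>\<^bsub>K p\<^esub>\<close>[of p] einj[OF pe R1] e1 \<open>x \<in> carrier (subtg G R)\<close> by simp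
      then show ?thesis using proj_injective[of x] \<open>x \<in> carrier (subtg G R)\<close> by simp
    qed
    show "\<exists>n. \<forall>p\<in>?\<pi>. n \<le> p \<longrightarrow> e p (proj p x) \<in> V p" if "x \<in> carrier (subtg G R)" for x
    proof -
      have xR: "x \<in> R" using that by simp
      obtain n where n: "\<forall>p\<ge>n. Factorial_Ring.prime p \<longrightarrow> proj p x \<in> U" using proj_almost_all[OF xR] by blast
      have "e p (proj p x) \<in> V p" if "p \<in> ?\<pi>" "n \<le> p" for p
        using that n pe[OF that(1) xR] AU[of p] by (simp add: V_def)
      then show ?thesis by blast
    qed
    show "\<exists>w\<in>R \<inter> U. \<forall>p\<in>?\<pi>. e p (proj p w) = a p" if a: "\<And>p. p \<in> ?\<pi> \<Longrightarrow> a p \<in> V p" for a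
    proof -
      have "\<exists>b. b \<in> A p \<and> a p = e p b" if "p \<in> ?\<pi>" for p using a[OF that] by (auto simp: V_def)
      then obtain b where b: "\<And>p. p \<in> ?\<pi> \<Longrightarrow> b p \<in> A p \<and> a p = e p (b p)" by metis
      obtain w where "w \<in> R \<inter> U" "\<forall>p. Factorial_Ring.prime p \<longrightarrow> proj p w = b p"
        using proj_surjective[of b] b unfolding A_def by blast
      then show ?thesis using b by (intro bexI[of _ w]) auto
    qed
    show "\<exists>x\<in>carrier (subtg G R). e q (proj q x) = k \<and> (\<forall>p\<in>?\<pi>. p \<noteq> q \<longrightarrow> e p (proj p x) = \<one>\<^bsub>K p\<^esub>)"
      if q: "q \<in> ?\<pi>" and k: "k \<in> carrier (K q)" for q k
    proof -
      obtain x where x: "x \<in> Rp q" "k = e q x" using k quot_homD(4)[OF e(1)[of q]] by auto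
      have "e p (proj p x) = \<one>\<^bsub>K p\<^esub>" if "p \<in> ?\<pi>" "p \<noteq> q" for p
        using proj_other[of p q x] that q x(1) e1 by simp
      moreover have "proj q x = x" using proj_id q x(1) by simp
      moreover have "x \<in> R" using x(1) by (simp add: Rp_def)
      ultimately show ?thesis using x(2) by (intro bexI[of _ x]) auto
    qed
  qed
  show ?thesis
  proof (intro exI[of _ ?\<pi>] exI[of _ K] exI[of _ V] conjI ballI iso_ldp e(3))
    fix p assume "p \<in> ?\<pi>"
    then have p: "Factorial_Ring.prime p" by simp
    show "Factorial_Ring.prime p" "open_subgroup (V p) (K p)" "compactin (tp (K p)) (V p)" "pro_p p (subtg (K p) (V p))"
      by (rule p Vo[OF p] V_compact pp[OF p])+
    show "locally_pro_p p (K p)" unfolding locally_pro_p_def using Vo[OF p] V_compact[of p] pp[OF p] by blast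
  qed
qed

text \<open>An open normal subgroup \<open>N\<close> of the image is pulled back to
  \<open>N'\<close> in \<open>U\<close>. Nilpotency of the quotient by \<open>N'\<close> puts a term
  of the lower central series of \<open>U\<close> inside \<open>N'\<close>, and homomorphic images
  of lower central terms are lower central terms.\<close>

lemma pro_nilpotent_image:
  assumes q: "quot_hom q G H" and H: "tdlcsc H" and U: "open_subgroup U G" "compactin (tp G) U" "pro_nilpotent (subtg G U)"
  shows "open_subgroup (q ` U) H" "compactin (tp H) (q ` U)" "pro_nilpotent (subtg H (q ` U))"
proof -
  interpret G: topgroup G by (rule quot_homD[OF q])
  interpret H: topgroup H by (rule quot_homD[OF q])
  interpret q: group_hom G H q by (rule quot_homD[OF q])
  note Us = G.osubD(1)[OF U(1)]
  show o: "open_subgroup (q ` U) H"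
    using q.subgroup_img_is_subgroup[OF Us] quot_homD(7)[OF q] G.osubD(2)[OF U(1)] by (simp add: open_subgroup_def open_map_def)
  show c: "compactin (tp H) (q ` U)" by (rule image_compactin[OF U(2) quot_homD(6)[OF q]])
  let ?U = "subtg G U" and ?V = "subtg H (q ` U)"
  interpret SU: topgroup ?U by (rule G.subtg_topgroup[OF Us])
  interpret SV: topgroup ?V by (rule H.subtg_topgroup[OF H.osubD(1)[OF o]])
  have Uc: "u \<in> carrier G" if "u \<in> U" for u using G.osubD(7)[OF U(1) that] .
  have hom: "q \<in> hom ?U ?V" using Uc by (auto simp: hom_def)
  have "nilpotent (?V Mod N)" if N: "N \<lhd> ?V" "openin (tp ?V) N" for N
  proof -
    interpret N: normal N ?V by (rule N(1))
    interpret Q: group "?V Mod N" by (rule N.factorgroup_is_group)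
    let ?g = "\<lambda>x. N #>\<^bsub>?V\<^esub> q x"
    have "(\<lambda>x. N #>\<^bsub>?V\<^esub> x) \<circ> q \<in> hom ?U (?V Mod N)" by (rule hom_compose[OF hom N.r_coset_hom_Mod])
    then interpret g: group_hom ?U "?V Mod N" ?g by unfold_locales (simp add: o_def)
    have gim: "?g ` carrier ?U = carrier (?V Mod N)" unfolding carrier_FactGroup by (simp add: image_image)
    define N' where "N' = kernel ?U (?V Mod N) ?g"
    have gone: "?g x = \<one>\<^bsub>?V Mod N\<^esub> \<longleftrightarrow> q x \<in> N" if "x \<in> U" for x
      using SV.coset_join1[OF _ _ N.subgroup_axioms, of "q x"] SV.coset_join2[OF _ N.subgroup_axioms, of "q x"] that by auto
    have N'eq: "N' = {x \<in> U. q x \<in> N}" unfolding N'_def kernel_def using gone by auto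
    have N'n: "N' \<lhd> ?U" unfolding N'_def by (rule g.normal_kernel)
    have "continuous_map (tp ?U) (tp ?V) q"
      using quot_homD(6)[OF q] by (auto simp: continuous_map_in_subtopology continuous_map_from_subtopology)
    from openin_continuous_map_preimage[OF this N(2)] have "openin (tp ?U) N'" using Uc unfolding N'eq
      by (metis (no_types, lifting) Collect_cong SU.topspace_tp subtg_simps(1))
    then have nil: "nilpotent (?U Mod N')" using U(3) N'n by (simp add: pro_nilpotent_def del: subtg_simps)
    interpret N': normal N' ?U by (rule N'n)
    interpret Q': group "?U Mod N'" by (rule N'.factorgroup_is_group)
    interpret r: group_hom ?U "?U Mod N'" "\<lambda>x. N' #>\<^bsub>?U\<^esub> x" by unfold_locales (use N'.r_coset_hom_Mod in blast)
    obtain n where n: "lower_central (?U Mod N') n = {\<one>\<^bsub>?U Mod N'\<^esub>}" using nil by (auto simp: nilpotent_def)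
    have rim: "(\<lambda>x. N' #>\<^bsub>?U\<^esub> x) ` carrier ?U = carrier (?U Mod N')" unfolding carrier_FactGroup ..
    have "lower_central ?U n \<subseteq> N'"
    proof
      fix x assume x: "x \<in> lower_central ?U n"
      then have "N' #>\<^bsub>?U\<^esub> x \<in> lower_central (?U Mod N') n" unfolding r.lower_central_image[OF rim] by blast
      then have "N' #>\<^bsub>?U\<^esub> x = N'" using n by simp
      moreover have "x \<in> carrier ?U" using subgroup.mem_carrier[OF SU.lower_central_subgroup x] .
      ultimately show "x \<in> N'" using SU.coset_join1[OF _ _ N'.subgroup_axioms, of x] by blast
    qed
    then have "lower_central (?V Mod N) n \<subseteq> {\<one>\<^bsub>?V Mod N\<^esub>}"
      unfolding g.lower_central_image[OF gim] N'_def kernel_def by blast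
    moreover have "\<one>\<^bsub>?V Mod N\<^esub> \<in> lower_central (?V Mod N) n" using subgroup.one_closed[OF Q.lower_central_subgroup] .
    ultimately have "lower_central (?V Mod N) n = {\<one>\<^bsub>?V Mod N\<^esub>}" by blast
    then show ?thesis unfolding nilpotent_def using Q.is_group by blast
  qed
  moreover have "profinite ?V"
    using tdlcsc_subtg[OF H H.osubD(1)[OF o] H.osub_closed[OF o]] c by (simp add: profinite_def compact_space_subtopology)
  ultimately show "pro_nilpotent ?V" unfolding pro_nilpotent_def by blast
qed

lemma tg_iso_trans:
  assumes "quot_hom h G H" "inj_on h (carrier G)" "tg_iso H L" shows "tg_iso G L"
proof -
  obtain f where f: "f \<in> hom H L" "bij_betw f (carrier H) (carrier L)" "homeomorphic_map (tp H) (tp L) f"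
    using assms(3) by (auto simp: tg_iso_def)
  obtain g where g: "g \<in> hom G H" "bij_betw g (carrier G) (carrier H)" "homeomorphic_map (tp G) (tp H) g"
    using quot_hom_imp_tg_iso[OF assms(1,2)] by (auto simp: tg_iso_def)
  show ?thesis unfolding tg_iso_def
    using hom_compose[OF g(1) f(1)] bij_betw_trans[OF g(2) f(2)] homeomorphic_map_compose[OF g(3) f(3)] by blast
qed

text \<open>The preimage of \<open>M\<close> maps onto \<open>M\<close> with elementary kernel
  \<open>A\<close>, so it is elementary and already contained in the radical
  \<open>A\<close>.\<close>

lemma trivial_if_elementary_normal:
  assumes G: "tdlcsc G" and Rad: "is_Rad G A" and q: "quot_hom q G H" "kernel G H q = A" and H: "tdlcsc H"
    and M: "closed_normal M H" "elementary (subtg H M)"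
  shows "M = {\<one>\<^bsub>H\<^esub>}"
proof -
  note Md = closed_normalD[OF M(1)]
  let ?K = "{x \<in> carrier G. q x \<in> M}"
  have K: "closed_normal ?K G"
    using quot_hom_preimage_normal[OF q(1) Md(3)] quot_hom_preimage_closed[OF q(1) Md(2)] by (simp add: closed_normal_def)
  note Kd = closed_normalD[OF K]
  have "A \<subseteq> ?K" using subgroup.one_closed[OF Md(1)] unfolding q(2)[symmetric] kernel_def by auto
  then have "subtg (subtg G ?K) A = subtg G A" by (rule subtg_subtg)
  then have "elementary (subtg (subtg G ?K) (kernel (subtg G ?K) (subtg H M) q))"
    unfolding kernel_restrict[OF Md(1)] q(2) using Rad by (simp add: is_Rad_def)
  then have "elementary (subtg G ?K)"
    using elementary_extension[OF tdlcsc_subtg[OF G Kd(1,2)] quot_hom_restrict[OF q(1) Md(1)] _ M(2) tdlcsc_subtg[OF H Md(1,2)]] by simp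
  then have "?K \<subseteq> A" using Rad K unfolding is_Rad_def by blast
  have "m = \<one>\<^bsub>H\<^esub>" if "m \<in> M" for m
  proof -
    have "m \<in> q ` carrier G" using subgroup.mem_carrier[OF Md(1) that] quot_homD(4)[OF q(1)] by simp
    then obtain x where "x \<in> carrier G" "m = q x" by blast
    then have "x \<in> A" using \<open>?K \<subseteq> A\<close> that by blast
    then show ?thesis using \<open>m = q x\<close> unfolding q(2)[symmetric] kernel_def by simp
  qed
  then show ?thesis using subgroup.one_closed[OF Md(1)] by blast
qed

lemma residual_minimal_open:
  assumes H: "tdlcsc H" and Res: "is_Res H R" and M: "closed_normal M H" "M \<subseteq> R" "openin (subtopology (tp H) R) M"
  shows "M = R"
proof -
  have R: "closed_normal R H" and eR: "elementary (quottg H R)" using Res by (simp_all add: is_Res_def)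
  note Rd = closed_normalD[OF R] and Md = closed_normalD[OF M(1)]
  note r = quot_hom_quottg[OF tdlcsc_topgroup[OF H] Md(3)]
  note s = quot_hom_quottg[OF tdlcsc_topgroup[OF H] Rd(3)]
  note tM = tdlcsc_quottg[OF H M(1)] and tR = tdlcsc_quottg[OF H R]
  let ?P = "quottg H M" and ?r = "\<lambda>x. M #>\<^bsub>H\<^esub> x"
  obtain h where h: "quot_hom h ?P (quottg H R)" "kernel ?P (quottg H R) h = ?r ` R"
    "\<And>x. x \<in> carrier H \<Longrightarrow> h (?r x) = R #>\<^bsub>H\<^esub> x"
    using quot_hom_factor[OF r(1) s(1)] r(2) s(2) M(2) by metis
  have Ks: "subgroup (?r ` R) ?P" using kernel_subgroup[OF h(1)] h(2) by simp
  \<comment> \<open>\<open>R\<close> is a union of cosets of \<open>M\<close>, so the projection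
    restricts to a quotient map of \<open>R\<close> onto its image with kernel \<open>M\<close>;
    openness of \<open>M\<close> in \<open>R\<close> makes that image discrete.\<close>
  have pre: "{x \<in> carrier H. ?r x \<in> ?r ` R} = R"
  proof
    show "R \<subseteq> {x \<in> carrier H. ?r x \<in> ?r ` R}" using subgroup.mem_carrier[OF Rd(1)] by blast
    show "{x \<in> carrier H. ?r x \<in> ?r ` R} \<subseteq> R"
    proof
      fix x assume x: "x \<in> {x \<in> carrier H. ?r x \<in> ?r ` R}"
      then have "?r x \<in> kernel ?P (quottg H R) h" using h(2) by blast
      then have "R #>\<^bsub>H\<^esub> x = \<one>\<^bsub>quottg H R\<^esub>" using h(3) x by (simp add: kernel_def)
      then show "x \<in> R" using s(2) x unfolding kernel_def by blast
    qed
  qed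
  have "quot_hom ?r (subtg H R) (subtg ?P (?r ` R))" using quot_hom_restrict[OF r(1) Ks] unfolding pre .
  moreover have "kernel (subtg H R) (subtg ?P (?r ` R)) ?r = M" using kernel_restrict[OF Ks, of H ?r] r(2) unfolding pre by simp
  ultimately have "discrete_tg (subtg ?P (?r ` R))"
    using discrete_if_kernel_open[of ?r "subtg H R"] tdlcsc_subtg[OF H Rd(1,2)] M(3) by simp
  then have "elementary (subtg ?P (kernel ?P (quottg H R) h))" unfolding h(2) by (rule discrete_elementary)
  then have "elementary ?P" by (rule elementary_extension[OF tM h(1) _ eR tR])
  then show ?thesis using Res M(1,2) unfolding is_Res_def by blast
qed

theorem mainTheorem5:
  fixes G :: "'a tgroup"
  assumes "tdlcsc G" and "locally_pro_nilpotent G"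
  shows "elementary G \<or>
    (\<forall>A1 R. is_Rad G A1 \<longrightarrow> is_Res (quottg G A1) R \<longrightarrow>
       (let A2 = \<Union>R in
          elementary (subtg G A1) \<and> elementary (quottg G A2) \<and>
          (\<exists>(\<pi> :: nat set) (L :: nat \<Rightarrow> nat set tgroup) (U :: nat \<Rightarrow> nat set set).
              (\<forall>p\<in>\<pi>. Factorial_Ring.prime p \<and> tdlcsc (L p) \<and> locally_pro_p p (L p) \<and>
                      open_subgroup (U p) (L p) \<and> compactin (tp (L p)) (U p) \<and>
                      pro_p p (subtg (L p) (U p))) \<and>
              tg_iso (quottg (subtg G A2) A1) (ldp \<pi> L U))))"
proof (rule disjI2, intro allI impI)
  \<comment> \<open>The structure statement also covers elementary \<open>G\<close>, as the
    degenerate case where \<open>A1\<close> is the whole group.\<close>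
  fix A1 R assume Rad: "is_Rad G A1" and Res: "is_Res (quottg G A1) R"
  note G = assms(1)
  let ?H = "quottg G A1"
  let ?q = "\<lambda>x. A1 #>\<^bsub>G\<^esub> x"
  have A1: "closed_normal A1 G" and eA1: "elementary (subtg G A1)" using Rad by (simp_all add: is_Rad_def)
  have R: "closed_normal R ?H" and eR: "elementary (quottg ?H R)" using Res by (simp_all add: is_Res_def)
  note Rd = closed_normalD[OF R]
  note H = tdlcsc_quottg[OF G A1]
  note q = quot_hom_quottg[OF tdlcsc_topgroup[OF G] closed_normalD(3)[OF A1]]
  interpret H: tdgroup ?H by (rule tdlcsc_tdgroup[OF H])
  obtain U where U: "open_subgroup U G" "compactin (tp G) U" "pro_nilpotent (subtg G U)"
    using assms(2) by (auto simp: locally_pro_nilpotent_def)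
  note V = pro_nilpotent_image[OF q(1) H U]
  have "tp ?H closure_of quasi_center ?H = {\<one>\<^bsub>?H\<^esub>}"
    using trivial_if_elementary_normal[OF G Rad q H] closure_quasi_center_elementary[OF H] by blast
  moreover have "quasi_center ?H \<subseteq> tp ?H closure_of quasi_center ?H"
    by (rule closure_of_subset) (simp only: H.topspace_tp quasi_center_def, blast)
  moreover have "\<one>\<^bsub>?H\<^esub> \<in> quasi_center ?H" using subgroup.one_closed[OF normal_imp_subgroup[OF H.quasi_center_normal]] .
  ultimately have QZ: "quasi_center ?H = {\<one>\<^bsub>?H\<^esub>}" by blast
  interpret res: residual_pronil_group ?H "?q ` U" R
    by unfold_locales (use V QZ R residual_minimal_open[OF H Res] in auto)
  \<comment> \<open>\<open>R\<close> is a set of cosets of \<open>A1\<close>, so its union is its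
    preimage in \<open>G\<close>, the second term of the ascending elementary series.\<close>
  have A2: "\<Union>R = {x \<in> carrier G. ?q x \<in> R}"
  proof -
    interpret topgroup G by (rule tdlcsc_topgroup[OF G])
    interpret N: normal A1 G using A1 by (simp add: closed_normal_def)
    have Rsub: "R \<subseteq> rcosets\<^bsub>G\<^esub> A1" using subgroup.subset[OF Rd(1)] by simp
    show ?thesis
    proof safe
      fix x A assume x: "x \<in> A" "A \<in> R"
      then have "A \<in> rcosets\<^bsub>G\<^esub> A1" using Rsub by blast
      then obtain a where a: "a \<in> carrier G" "A = A1 #>\<^bsub>G\<^esub> a" by (auto simp: RCOSETS_def)
      then show "x \<in> carrier G" using x(1) r_coset_subset_G[OF N.subset] by blast
      show "A1 #>\<^bsub>G\<^esub> x \<in> R" using repr_independence[of x A1 a] a x N.subgroup_axioms by simp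
    next
      fix x assume "x \<in> carrier G" "A1 #>\<^bsub>G\<^esub> x \<in> R"
      then show "x \<in> \<Union>R" using rcos_self[OF _ N.subgroup_axioms, of x] by blast
    qed
  qed
  have "elementary (quottg G (\<Union>R))"
  proof -
    note s = quot_hom_quottg[OF tdlcsc_topgroup[OF H] Rd(3)]
    note tR = tdlcsc_quottg[OF H R]
    note c = quot_hom_comp[OF q(1) s(1)]
    \<comment> \<open>The composite projection identifies the quotient of \<open>G\<close> by
      \<open>A2\<close> with the quotient of \<open>?H\<close> by its residual, which is
      elementary.\<close>
    have k: "kernel G (quottg ?H R) (\<lambda>x. R #>\<^bsub>?H\<^esub> ?q x) = \<Union>R"
      unfolding A2 using s(2) quot_homD(8)[OF q(1)] unfolding kernel_def by blast
    obtain h where h: "quot_hom h (quottg G (\<Union>R)) (quottg ?H R)" "inj_on h (carrier (quottg G (\<Union>R)))"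
      using quottg_iso[OF c] unfolding k by blast
    obtain g where "quot_hom g (quottg ?H R) (quottg G (\<Union>R))" "inj_on g (carrier (quottg ?H R))"
      using quot_hom_inverse[OF h] by metis
    then show ?thesis by (rule elementary_iso[OF eR tR])
  qed
  moreover have "\<exists>(\<pi> :: nat set) (L :: nat \<Rightarrow> nat set tgroup) (U :: nat \<Rightarrow> nat set set).
              (\<forall>p\<in>\<pi>. Factorial_Ring.prime p \<and> tdlcsc (L p) \<and> locally_pro_p p (L p) \<and>
                      open_subgroup (U p) (L p) \<and> compactin (tp (L p)) (U p) \<and>
                      pro_p p (subtg (L p) (U p))) \<and>
              tg_iso (quottg (subtg G (\<Union>R)) A1) (ldp \<pi> L U)"
  proof -
    \<comment> \<open>The quotient of \<open>A2\<close> by \<open>A1\<close>, formed inside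
      \<open>A2\<close>, is only isomorphic to the subgroup \<open>R\<close> of \<open>?H\<close>
      with its subspace topology, on which the coordinates were built.\<close>
    have f: "quot_hom ?q (subtg G (\<Union>R)) (subtg ?H R)" using quot_hom_restrict[OF q(1) Rd(1)] unfolding A2 .
    have "kernel (subtg G (\<Union>R)) (subtg ?H R) ?q = A1" using kernel_restrict[OF Rd(1), of G ?q] q(2) unfolding A2 by simp
    then obtain h where "quot_hom h (quottg (subtg G (\<Union>R)) A1) (subtg ?H R)" "inj_on h (carrier (quottg (subtg G (\<Union>R)) A1))"
      using quottg_iso[OF f] by metis
    note iso = tg_iso_trans[OF this]
    show ?thesis using res.residual_is_ldp[OF H] by (elim exE conjE) (intro exI conjI iso)
  qed
  ultimately show "let A2 = \<Union>R in
          elementary (subtg G A1) \<and> elementary (quottg G A2) \<and>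
          (\<exists>(\<pi> :: nat set) (L :: nat \<Rightarrow> nat set tgroup) (U :: nat \<Rightarrow> nat set set).
              (\<forall>p\<in>\<pi>. Factorial_Ring.prime p \<and> tdlcsc (L p) \<and> locally_pro_p p (L p) \<and>
                      open_subgroup (U p) (L p) \<and> compactin (tp (L p)) (U p) \<and>
                      pro_p p (subtg (L p) (U p))) \<and>
              tg_iso (quottg (subtg G A2) A1) (ldp \<pi> L U))"
    using eA1 unfolding Let_def by blast
qed

end
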